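(* Let $p$ be a prime and let $G$ be a finite $p$-group such that $|G:G'| = p^2$. If $G$ has an irreducible complex character of degree $> p$, then $G$ has an irreducible complex character $\chi$ with $p < \chi(1) \le p^{\frac{p+1}{2}}$.
   Context: $G'$ denotes the commutator (derived) subgroup of $G$. Characters are ordinary (complex) characters, and the degree of $\chi$ is $\chi(1)$. *)

theory Defs
  imports
    "HOL-Algebra.Generated_Groups"
    "Jordan_Normal_Form.VS_Connect"
begin

text \<open>A matrix representation of degree \<open>n\<close> is a homomorphism into \<open>GL(n, \<complex>)\<close>, the unit group
  of the ring of complex \<open>n \<times> n\<close> matrices.\<close>

definition complex_representation ::
    "('a, 'b) monoid_scheme \<Rightarrow> nat \<Rightarrow> ('a \<Rightarrow> complex mat) \<Rightarrow> bool" where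
  "complex_representation G n \<rho> \<longleftrightarrow> \<rho> \<in> hom G (units_of (ring_mat TYPE(complex) n ()))"

definition irreducible_representation ::
    "('a, 'b) monoid_scheme \<Rightarrow> nat \<Rightarrow> ('a \<Rightarrow> complex mat) \<Rightarrow> bool" where
  "irreducible_representation G n \<rho> \<longleftrightarrow>
     complex_representation G n \<rho> \<and> n > 0 \<and>
     (\<forall>W. VectorSpace.subspace class_ring W (module_vec TYPE(complex) n) \<and>
          (\<forall>g \<in> carrier G. \<forall>w \<in> W. \<rho> g *\<^sub>v w \<in> W)
        \<longrightarrow> W = {0\<^sub>v n} \<or> W = carrier_vec n)"

definition mat_trace :: "'a :: comm_monoid_add mat \<Rightarrow> 'a" where
  "mat_trace A = (\<Sum>i < dim_row A. A $$ (i, i))"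

text \<open>Characters are restricted to \<open>carrier G\<close>, so that equality of characters does not depend on
  values outside the group.\<close>

definition character_of ::
    "('a, 'b) monoid_scheme \<Rightarrow> ('a \<Rightarrow> complex mat) \<Rightarrow> 'a \<Rightarrow> complex" where
  "character_of G \<rho> = (\<lambda>g \<in> carrier G. mat_trace (\<rho> g))"

definition irreducible_characters :: "('a, 'b) monoid_scheme \<Rightarrow> ('a \<Rightarrow> complex) set" where
  "irreducible_characters G = {character_of G \<rho> | n \<rho>. irreducible_representation G n \<rho>}"

text \<open>The value of a character at the identity is a natural number, the degree of the
  representation (see \<open>character_of_one\<close>); taking the real part only makes it comparable to reals.\<close>

definition character_degree :: "('a, 'b) monoid_scheme \<Rightarrow> ('a \<Rightarrow> complex) \<Rightarrow> real" where
  "character_degree G \<chi> = Re (\<chi> \<one>\<^bsub>G\<^esub>)"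

lemma character_of_one:
  assumes "group G" and "complex_representation G n \<rho>"
  shows "character_of G \<rho> \<one>\<^bsub>G\<^esub> = of_nat n"
proof -
  interpret G: group G by fact
  interpret R: ring "ring_mat TYPE(complex) n ()" by (rule ring_mat)
  have "\<rho> \<one>\<^bsub>G\<^esub> = \<one>\<^bsub>units_of (ring_mat TYPE(complex) n ())\<^esub>"
    using assms hom_one[OF _ assms(1) R.units_group]
    unfolding complex_representation_def by blast
  then have "\<rho> \<one>\<^bsub>G\<^esub> = 1\<^sub>m n"
    by (simp add: units_of_def ring_mat_simps)
  then show ?thesis
    by (simp add: character_of_def mat_trace_def)
qed

lemma character_degree_character_of:
  assumes "group G" and "complex_representation G n \<rho>"
  shows "character_degree G (character_of G \<rho>) = real n"
  using character_of_one[OF assms] by (simp add: character_degree_def)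

end

theory Submission
  imports
    Defs
    Complex_Main
    "HOL-Algebra.Group_Action"
    "HOL-Algebra.Multiplicative_Group"
    "HOL-Algebra.Zassenhaus"
    "HOL-Library.Function_Algebras"
begin

text \<open>
  Let \<open>\<rho>\<close> be, among the irreducible representations of \<open>G\<close> of degree larger than \<open>p\<close>, one whose
  kernel \<open>K\<close> is as large as possible, and let \<open>Z / K\<close> be a central subgroup of order \<open>p\<close> of \<open>G / K\<close>.
  Every irreducible representation that is trivial on \<open>Z\<close> then has degree at most \<open>p\<close>. This makes
  \<open>G / Z\<close> so close to abelian that \<open>G\<close> has a large subgroup \<open>B\<close> that is abelian modulo \<open>K\<close>, and a
  common eigenvector of \<open>B\<close> shows that the degree of \<open>\<rho>\<close> is at most \<open>|G : B|\<close> (\<open>dim_le_index\<close>).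

  How is the structure of \<open>G / Z\<close> found? If an irreducible representation of degree at most \<open>p\<close> is
  not commutative, an element of the second centre of its image has \<open>p\<close> different eigenvalues, and
  the subgroup fixing the one-dimensional eigenspaces is a maximal subgroup whose image is abelian
  (\<open>commuting_maximal_of_small_degree\<close>). Irreducible representations separate the points of every
  quotient of \<open>G\<close> (\<open>separating_irreducible_representation\<close>). Hence for all normal \<open>N \<supseteq> Z\<close> and
  \<open>h \<notin> N\<close> there are a normal \<open>K' \<supseteq> N\<close> with \<open>h \<notin> K'\<close> and a maximal subgroup that is abelian modulo
  \<open>K'\<close>. As \<open>|G : G'| = p\<^sup>2\<close>, two different maximal subgroups generate \<open>G\<close>, and a commutator argument
  turns this into a dichotomy (\<open>abelian_mod_or_gam4\<close>): one maximal subgroup \<open>M\<close> is abelian modulo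
  \<open>Z\<close>, or \<open>\<gamma>\<^sub>4(G) \<le> Z\<close>.

  Let \<open>p = 2k + 1\<close>. If \<open>\<gamma>\<^sub>4(G) \<le> Z\<close>, then \<open>B = G'\<close> is abelian modulo \<open>K\<close> and has index
  \<open>p\<^sup>2 \<le> p\<^bsup>k+1\<^esup>\<close>. Otherwise the commutator is an alternating form on \<open>M / Z\<close> with values in the
  \<open>p\<close>-th roots of unity, invariant under conjugation by an element \<open>x \<notin> M\<close>. The map \<open>D = x - 1\<close> on
  \<open>M / Z\<close> increases the index of a submodule by a factor of at most \<open>p\<close>, because \<open>|M : G'| = p\<close>, and
  \<open>D\<^sup>p\<close> maps into the radical of the form, because \<open>(x - 1)\<^sup>p = x\<^sup>p - 1\<close> modulo \<open>p\<close> and \<open>x\<^sup>p \<in> M\<close>.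
  As \<open>D\<close> is, up to a unit, skew adjoint, \<open>D\<^sup>i(M)\<close> and \<open>D\<^sup>j(M)\<close> are orthogonal when \<open>i + j \<ge> p\<close>. So the
  form on \<open>B = D\<^sup>k(M)\<close> factors through a quotient of order at most \<open>p\<close>, on which an alternating form
  vanishes; \<open>B\<close> has index at most \<open>p\<^bsup>k+1\<^esup>\<close> (\<open>large_abelian_subgroup\<close>).

  For \<open>p = 2\<close> there is no \<open>\<rho>\<close> at all: a \<open>2\<close>-group with \<open>|G : G'| = 4\<close> has an abelian subgroup of
  index \<open>2\<close> (\<open>two_group_abelian_maximal\<close>), so that all its degrees are at most \<open>2\<close>.
\<close>

section \<open>Commutators modulo a normal subgroup\<close>

context group
begin

lemma l_inv_cancel: "x \<in> carrier G \<Longrightarrow> y \<in> carrier G \<Longrightarrow> inv x \<otimes> (x \<otimes> y) = y"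
  by (simp flip: m_assoc)

lemma r_inv_cancel: "x \<in> carrier G \<Longrightarrow> y \<in> carrier G \<Longrightarrow> x \<otimes> (inv x \<otimes> y) = y"
  by (simp flip: m_assoc)

text \<open>With \<open>m_assoc\<close> and \<open>inv_mult_group\<close>, the cancellation laws form a complete rewriting system for
  free groups: every identity between words is proved by rewriting with them.\<close>
lemmas word_simps = m_assoc inv_mult_group l_inv_cancel r_inv_cancel

text \<open>This is the convention of \<open>derived_set\<close>.\<close>
definition cmt :: "'a \<Rightarrow> 'a \<Rightarrow> 'a" where
  "cmt a b = a \<otimes> b \<otimes> inv a \<otimes> inv b"

lemma cmt_closed [simp, intro]: "a \<in> carrier G \<Longrightarrow> b \<in> carrier G \<Longrightarrow> cmt a b \<in> carrier G"
  by (simp add: cmt_def)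

lemma inv_cmt: "a \<in> carrier G \<Longrightarrow> b \<in> carrier G \<Longrightarrow> inv (cmt a b) = cmt b a"
  by (simp add: cmt_def word_simps)

lemma cmt_self [simp]: "a \<in> carrier G \<Longrightarrow> cmt a a = \<one>"
  by (simp add: cmt_def word_simps)

lemma cmt_one_right [simp]: "a \<in> carrier G \<Longrightarrow> cmt a \<one> = \<one>"
  by (simp add: cmt_def)

lemma cmt_mult_left:
  "a \<in> carrier G \<Longrightarrow> b \<in> carrier G \<Longrightarrow> c \<in> carrier G \<Longrightarrow>
    cmt (a \<otimes> b) c = a \<otimes> cmt b c \<otimes> inv a \<otimes> cmt a c"
  by (simp add: cmt_def word_simps)

lemma cmt_mult_right:
  "a \<in> carrier G \<Longrightarrow> b \<in> carrier G \<Longrightarrow> c \<in> carrier G \<Longrightarrow>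
    cmt a (b \<otimes> c) = cmt a b \<otimes> (b \<otimes> cmt a c \<otimes> inv b)"
  by (simp add: cmt_def word_simps)

lemma cmt_inv_left:
  "a \<in> carrier G \<Longrightarrow> c \<in> carrier G \<Longrightarrow> cmt (inv a) c = inv a \<otimes> cmt c a \<otimes> a"
  by (simp add: cmt_def word_simps)

lemma conj_cmt:
  "g \<in> carrier G \<Longrightarrow> a \<in> carrier G \<Longrightarrow> b \<in> carrier G \<Longrightarrow>
    g \<otimes> cmt a b \<otimes> inv g = cmt (g \<otimes> a \<otimes> inv g) (g \<otimes> b \<otimes> inv g)"
  by (simp add: cmt_def word_simps)

lemma mult_eq_cmt_mult: "a \<in> carrier G \<Longrightarrow> b \<in> carrier G \<Longrightarrow> a \<otimes> b = cmt a b \<otimes> (b \<otimes> a)"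
  by (simp add: cmt_def word_simps)

lemma conj_eq_cmt_mult: "a \<in> carrier G \<Longrightarrow> b \<in> carrier G \<Longrightarrow> a \<otimes> b \<otimes> inv a = cmt a b \<otimes> b"
  by (simp add: cmt_def word_simps)

lemma cmt_one_iff:
  assumes "a \<in> carrier G" "b \<in> carrier G"
  shows "cmt a b = \<one> \<longleftrightarrow> a \<otimes> b = b \<otimes> a"
proof
  assume "cmt a b = \<one>"
  then show "a \<otimes> b = b \<otimes> a" using mult_eq_cmt_mult[OF assms] assms by simp
next
  assume "a \<otimes> b = b \<otimes> a"
  then have "cmt a b = b \<otimes> a \<otimes> inv a \<otimes> inv b" by (simp add: cmt_def)
  then show "cmt a b = \<one>" using assms by (simp add: word_simps)
qed

lemma conj_in_normal:
  assumes "N \<lhd> G" "n \<in> N" "g \<in> carrier G"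
  shows "g \<otimes> n \<otimes> inv g \<in> N" and "inv g \<otimes> n \<otimes> g \<in> N"
proof -
  interpret normal N G by fact
  show "g \<otimes> n \<otimes> inv g \<in> N" "inv g \<otimes> n \<otimes> g \<in> N"
    using inv_op_closed1 inv_op_closed2 assms by auto
qed

lemma normal_generate_Un:
  assumes A: "A \<lhd> G" and B: "B \<lhd> G"
  shows "generate G (A \<union> B) \<lhd> G"
proof (rule normal_generateI)
  show "A \<union> B \<subseteq> carrier G"
    using subgroup.subset[OF normal_imp_subgroup[OF A]] subgroup.subset[OF normal_imp_subgroup[OF B]] by simp
  show "g \<otimes> h \<otimes> inv g \<in> A \<union> B" if "h \<in> A \<union> B" "g \<in> carrier G" for h g
    using that conj_in_normal(1)[OF A] conj_in_normal(1)[OF B] by blast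
qed

lemma normal_Int:
  assumes A: "A \<lhd> G" and B: "B \<lhd> G"
  shows "A \<inter> B \<lhd> G"
proof (rule normal_invI)
  show "subgroup (A \<inter> B) G"
    using A B by (intro subgroups_Inter_pair normal_imp_subgroup)
  show "g \<otimes> h \<otimes> inv g \<in> A \<inter> B" if "g \<in> carrier G" "h \<in> A \<inter> B" for g h
    using that conj_in_normal(1)[OF A] conj_in_normal(1)[OF B] by blast
qed

lemma carrier_normal: "carrier G \<lhd> G"
  by (rule normal_invI) (auto intro: subgroup_self)

lemma finite_closed_subgroup:
  assumes fin: "finite (carrier G)" and S: "S \<subseteq> carrier G" "S \<noteq> {}"
    and cl: "\<And>a b. a \<in> S \<Longrightarrow> b \<in> S \<Longrightarrow> a \<otimes> b \<in> S"
  shows "subgroup S G"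
proof (rule subgroupI[OF S])
  fix a assume a: "a \<in> S"
  have ac: "a \<in> carrier G" using a S by blast
  have pow: "a [^] Suc n \<in> S" for n by (induction n) (use a cl ac in auto)
  let ?n = "Coset.order G"
  have n0: "?n > 0" using fin order_gt_0_iff_finite by blast
  have "a [^] (2 * ?n - 1) \<otimes> a = a [^] (2 * ?n - 1 + 1)" using ac by simp
  also have "\<dots> = (a [^] ?n) [^] (2::nat)" using n0 ac by (simp add: nat_pow_pow mult.commute)
  also have "\<dots> = \<one>" using pow_order_eq_1[OF ac] by simp
  finally have "inv a = a [^] (2 * ?n - 1)" using ac by (metis inv_equality nat_pow_closed)
  also have "\<dots> = a [^] Suc (2 * ?n - 2)" using n0 by (simp add: Suc_diff_Suc numeral_2_eq_2)
  finally show "inv a \<in> S" using pow by metis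
qed (use cl in auto)

lemma power_coprime_mem:
  assumes S: "subgroup S G" and a: "a \<in> carrier G" "a [^] n = \<one>" and i: "a [^] (i::int) \<in> S"
    and co: "coprime i (int n)"
  shows "a \<in> S"
proof -
  obtain u v where uv: "u * i + v * int n = 1" using bezout_int[of i "int n"] co by auto
  have "a = a [^] (i * u + int n * v)" using uv a by (simp add: mult.commute)
  also have "\<dots> = (a [^] i) [^] u \<otimes> (a [^] int n) [^] v"
    using a by (simp add: int_pow_mult int_pow_pow)
  also have "\<dots> = (a [^] i) [^] u" using a by (simp add: int_pow_int)
  also have "\<dots> \<in> S" using i S subgroup_int_pow_closed by blast
  finally show ?thesis .
qed

lemma cmt_in_normal:
  assumes "N \<lhd> G" "n \<in> N" "g \<in> carrier G"
  shows "cmt n g \<in> N" and "cmt g n \<in> N"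
proof -
  interpret normal N G by fact
  have n: "n \<in> carrier G" using assms by (simp add: mem_carrier)
  have "cmt g n = (g \<otimes> n \<otimes> inv g) \<otimes> inv n" by (simp add: cmt_def)
  then show 1: "cmt g n \<in> N" using conj_in_normal[OF assms] assms by simp
  show "cmt n g \<in> N" using m_inv_closed[OF 1] inv_cmt[OF assms(3) n] by simp
qed

lemma cmt_swap_mem:
  assumes "subgroup N G" "a \<in> carrier G" "b \<in> carrier G"
  shows "cmt a b \<in> N \<longleftrightarrow> cmt b a \<in> N"
  using assms inv_cmt subgroup.m_inv_closed by metis

lemma quotient_hom:
  assumes "N \<lhd> G"
  shows "group_hom G (G Mod N) ((#>) N)"
  using assms is_group
  by (intro group_hom.intro group_hom_axioms.intro normal.factorgroup_is_group normal.r_coset_hom_Mod)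

text \<open>Modulo \<open>N\<close> the two elements commute.\<close>
lemma power_mult_mod:
  assumes N: "N \<lhd> G" and u: "u \<in> carrier G" and w: "w \<in> carrier G" and c: "cmt u w \<in> N"
  shows "\<exists>n\<in>N. (u \<otimes> w) [^] (i::int) = n \<otimes> (u [^] i \<otimes> w [^] i)"
proof -
  interpret N: normal N G by fact
  interpret Q: group "G Mod N" by (rule N.factorgroup_is_group)
  interpret h: group_hom G "G Mod N" "(#>) N" by (rule quotient_hom[OF N])
  have uw: "u \<otimes> w \<in> carrier G" "w \<otimes> u \<in> carrier G" using u w by auto
  have "u \<otimes> w \<in> N #> (w \<otimes> u)" using c mult_eq_cmt_mult[OF u w] by (auto simp: r_coset_def)
  then have "N #> (w \<otimes> u) = N #> (u \<otimes> w)" by (rule repr_independence[OF _ uw(2) N.subgroup_axioms])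
  then have com: "(N #> u) \<otimes>\<^bsub>G Mod N\<^esub> (N #> w) = (N #> w) \<otimes>\<^bsub>G Mod N\<^esub> (N #> u)"
    using h.hom_mult[OF u w] h.hom_mult[OF w u] by argo
  have "N #> (u \<otimes> w) [^] i = ((N #> u) \<otimes>\<^bsub>G Mod N\<^esub> (N #> w)) [^]\<^bsub>G Mod N\<^esub> i"
    using h.hom_int_pow[OF uw(1), of i] h.hom_mult[OF u w] by argo
  also have "\<dots> = N #> (u [^] i \<otimes> w [^] i)"
    using Q.int_pow_mult_distrib[OF com h.hom_closed[OF u] h.hom_closed[OF w], of i]
      h.hom_int_pow[OF u, of i] h.hom_int_pow[OF w, of i]
      h.hom_mult[OF int_pow_closed[OF u, of i] int_pow_closed[OF w, of i]] by argo
  finally have "(u \<otimes> w) [^] i \<in> N #> (u [^] i \<otimes> w [^] i)"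
    using rcos_self[OF int_pow_closed[OF uw(1), of i] N.subgroup_axioms] by simp
  then show ?thesis by (auto simp: r_coset_def)
qed

text \<open>The centralizer of \<open>B\<close> modulo \<open>N\<close>. Most facts below about commutator subgroups have the form
  \<open>[A, B] \<le> N\<close>, which is written \<open>A \<subseteq> centr N B\<close>; that \<open>centr N B\<close> is a subgroup (when \<open>N\<close> is
  normal) replaces computations with products of commutators.\<close>
definition centr :: "'a set \<Rightarrow> 'a set \<Rightarrow> 'a set" where
  "centr N B = {a \<in> carrier G. \<forall>b\<in>B. cmt a b \<in> N}"

lemma centr_subgroup:
  assumes N: "N \<lhd> G" and B: "B \<subseteq> carrier G"
  shows "subgroup (centr N B) G"
proof -
  interpret normal N G by fact
  show ?thesis
  proof (rule subgroupI)
    show "centr N B \<subseteq> carrier G" by (auto simp: centr_def)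
    have "\<one> \<in> centr N B" using B by (auto simp: centr_def cmt_def word_simps subset_iff)
    then show "centr N B \<noteq> {}" by blast
  next
    fix a assume a: "a \<in> centr N B"
    then show "inv a \<in> centr N B"
      using B conj_in_normal(2)[OF N] cmt_swap_mem[OF subgroup_axioms]
      by (auto simp: centr_def cmt_inv_left subset_iff)
  next
    fix a b assume "a \<in> centr N B" "b \<in> centr N B"
    then show "a \<otimes> b \<in> centr N B"
      using B conj_in_normal(1)[OF N]
      by (auto simp: centr_def cmt_mult_left subset_iff)
  qed
qed

lemma centr_swap:
  assumes "subgroup N G" "A \<subseteq> carrier G" "B \<subseteq> carrier G"
  shows "A \<subseteq> centr N B \<longleftrightarrow> B \<subseteq> centr N A"
  using assms cmt_swap_mem[OF assms(1)] unfolding centr_def subset_iff by blast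

lemma centr_carrier_normal:
  assumes N: "N \<lhd> G"
  shows "centr N (carrier G) \<lhd> G"
proof -
  interpret normal N G by fact
  have "g \<otimes> a \<otimes> inv g \<in> centr N (carrier G)" if g: "g \<in> carrier G" and a: "a \<in> centr N (carrier G)" for g a
  proof -
    have ac: "a \<in> carrier G" using a by (auto simp: centr_def)
    have "cmt (g \<otimes> a \<otimes> inv g) b \<in> N" if b: "b \<in> carrier G" for b
    proof -
      have e: "g \<otimes> (inv g \<otimes> b \<otimes> g) \<otimes> inv g = b" using g b by (simp add: word_simps)
      have "cmt a (inv g \<otimes> b \<otimes> g) \<in> N" using a g b by (simp add: centr_def)
      from conj_in_normal(1)[OF N this g] show ?thesis
        using conj_cmt[OF g ac, of "inv g \<otimes> b \<otimes> g"] g b ac by (simp add: e)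
    qed
    then show ?thesis using g ac by (simp add: centr_def)
  qed
  with centr_subgroup[OF N] show ?thesis by (auto intro: normal_invI)
qed

text \<open>The subgroup \<open>\<langle>a\<rangle>N\<close>, for a normal subgroup \<open>N\<close>.\<close>
definition cyc_ext :: "'a \<Rightarrow> 'a set \<Rightarrow> 'a set" where
  "cyc_ext a N = {a [^] (i::int) \<otimes> n | i n. n \<in> N}"

lemma cyc_ext_subgroup:
  assumes N: "N \<lhd> G" and a: "a \<in> carrier G"
  shows "subgroup (cyc_ext a N) G"
proof -
  interpret normal N G by fact
  show ?thesis
  proof (rule subgroupI)
    show "cyc_ext a N \<subseteq> carrier G" using a by (auto simp: cyc_ext_def mem_carrier)
    show "cyc_ext a N \<noteq> {}" 
      using subgroup.one_closed[OF subgroup_axioms] unfolding cyc_ext_def by blast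
  next
    fix x assume "x \<in> cyc_ext a N"
    then obtain i n where x: "x = a [^] (i::int) \<otimes> n" "n \<in> N" by (auto simp: cyc_ext_def)
    have "inv x = a [^] (- i) \<otimes> (a [^] i \<otimes> inv n \<otimes> inv (a [^] i))"
      using a x by (simp add: mem_carrier word_simps int_pow_neg)
    moreover have "a [^] i \<otimes> inv n \<otimes> inv (a [^] i) \<in> N"
      using a x by (intro conj_in_normal(1)[OF N]) auto
    ultimately show "inv x \<in> cyc_ext a N" by (auto simp: cyc_ext_def)
  next
    fix x y assume "x \<in> cyc_ext a N" "y \<in> cyc_ext a N"
    then obtain i n j m where x: "x = a [^] (i::int) \<otimes> n" "n \<in> N" and y: "y = a [^] (j::int) \<otimes> m" "m \<in> N"
      by (auto simp: cyc_ext_def)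
    have "x \<otimes> y = a [^] (i + j) \<otimes> ((inv (a [^] j) \<otimes> n \<otimes> a [^] j) \<otimes> m)"
      using a x y by (simp add: mem_carrier word_simps int_pow_mult)
    moreover have "(inv (a [^] j) \<otimes> n \<otimes> a [^] j) \<otimes> m \<in> N"
      using a x y conj_in_normal(2)[OF N] by auto
    ultimately show "x \<otimes> y \<in> cyc_ext a N" by (auto simp: cyc_ext_def)
  qed
qed

lemma cyc_ext_incl:
  assumes "subgroup N G" "a \<in> carrier G"
  shows "N \<subseteq> cyc_ext a N" and "a \<in> cyc_ext a N"
proof -
  interpret subgroup N G by fact
  have "n = a [^] (0::int) \<otimes> n" if "n \<in> N" for n using that by (simp add: mem_carrier)
  then show "N \<subseteq> cyc_ext a N" unfolding cyc_ext_def by blast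
  have "a = a [^] (1::int) \<otimes> \<one>" using assms by simp
  with subgroup.one_closed[OF subgroup_axioms] show "a \<in> cyc_ext a N"
    unfolding cyc_ext_def by blast
qed

lemma cyc_ext_least:
  assumes "subgroup S G" "a \<in> S" "N \<subseteq> S"
  shows "cyc_ext a N \<subseteq> S"
  using assms subgroup_int_pow_closed subgroup.m_closed unfolding cyc_ext_def by fastforce

lemma cyc_ext_normal:
  assumes N: "N \<lhd> G" and a: "a \<in> centr N (carrier G)"
  shows "cyc_ext a N \<lhd> G" and "cyc_ext a N \<subseteq> centr N (carrier G)"
proof -
  have ac: "a \<in> carrier G" using a by (auto simp: centr_def)
  have sub: "subgroup N G" using N by (rule normal_imp_subgroup)
  have "N \<subseteq> centr N (carrier G)"
    using cmt_in_normal[OF N] subgroup.subset[OF sub] by (auto simp: centr_def)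
  then show le: "cyc_ext a N \<subseteq> centr N (carrier G)"
    by (intro cyc_ext_least centr_subgroup[OF N] a) auto
  have S: "subgroup (cyc_ext a N) G" using cyc_ext_subgroup[OF N ac] .
  have "g \<otimes> b \<otimes> inv g \<in> cyc_ext a N" if g: "g \<in> carrier G" and b: "b \<in> cyc_ext a N" for g b
  proof -
    have bc: "b \<in> carrier G" using subgroup.mem_carrier[OF S b] .
    have "cmt b g \<in> N" using le b g by (auto simp: centr_def)
    then have "cmt g b \<in> cyc_ext a N"
      using cmt_swap_mem[OF sub bc g] cyc_ext_incl[OF sub ac] by auto
    then show ?thesis using b subgroup.m_closed[OF S] conj_eq_cmt_mult[OF g bc] by simp
  qed
  then show "cyc_ext a N \<lhd> G" using S by (auto intro: normal_invI)
qed

lemma card_cyc_ext_le: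
  assumes N: "subgroup N G" and fin: "finite N" and a: "a \<in> carrier G" "a [^] p \<in> N" and p: "p > (0::nat)"
  shows "card (cyc_ext a N) \<le> p * card N"
proof -
  interpret subgroup N G by fact
  have "cyc_ext a N \<subseteq> (\<lambda>(t, n). a [^] (t::nat) \<otimes> n) ` ({..<p} \<times> N)"
  proof
    fix x assume "x \<in> cyc_ext a N"
    then obtain i n where x: "x = a [^] (i::int) \<otimes> n" "n \<in> N" by (auto simp: cyc_ext_def)
    define t where "t = nat (i mod int p)"
    have i: "i = int t + int p * (i div int p)" using p by (simp add: t_def)
    have "a [^] i = a [^] t \<otimes> (a [^] p) [^] (i div int p)"
      by (subst i) (use a in \<open>simp add: int_pow_mult int_pow_int flip: int_pow_pow\<close>)
    moreover have "(a [^] p) [^] (i div int p) \<in> N"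
      using a(2) subgroup_int_pow_closed subgroup_axioms by blast
    ultimately have "x = a [^] t \<otimes> ((a [^] p) [^] (i div int p) \<otimes> n)"
      "(a [^] p) [^] (i div int p) \<otimes> n \<in> N"
      using a x by (simp_all add: m_assoc mem_carrier)
    moreover have "t < p" using p by (simp add: t_def nat_less_iff)
    ultimately show "x \<in> (\<lambda>(t, n). a [^] (t::nat) \<otimes> n) ` ({..<p} \<times> N)" by force
  qed
  from card_mono[OF _ this] have "card (cyc_ext a N) \<le> card ((\<lambda>(t, n). a [^] (t::nat) \<otimes> n) ` ({..<p} \<times> N))"
    using fin by simp
  also have "\<dots> \<le> card ({..<p} \<times> N)" by (rule card_image_le) (use fin in simp)
  finally show ?thesis by (simp add: card_cartesian_product)
qed

lemma cyc_ext_power_mem: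
  assumes N: "N \<lhd> G" and a: "a \<in> carrier G" "a [^] (q::nat) \<in> N" and b: "b \<in> cyc_ext a N"
  shows "b [^] q \<in> N"
proof -
  interpret N: normal N G by fact
  obtain i l where b': "b = a [^] (i::int) \<otimes> l" "l \<in> N" using b by (auto simp: cyc_ext_def)
  have lc: "l \<in> carrier G" and ai: "a [^] i \<in> carrier G" using b' a N.mem_carrier by auto
  obtain n where n: "n \<in> N" "b [^] int q = n \<otimes> ((a [^] i) [^] int q \<otimes> l [^] int q)"
    using power_mult_mod[OF N ai lc cmt_in_normal(2)[OF N b'(2) ai], of "int q"] b'(1) by blast
  have "(a [^] i) [^] int q = (a [^] q) [^] i"
    using a by (metis int_pow_int int_pow_pow mult.commute)
  then have "(a [^] i) [^] int q \<in> N" "l [^] int q \<in> N"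
    using a(2) b'(2) N.subgroup_axioms subgroup_int_pow_closed by auto
  then show ?thesis using n by (simp add: int_pow_int)
qed

lemma centr_mono: "N \<subseteq> N' \<Longrightarrow> B' \<subseteq> B \<Longrightarrow> centr N B \<subseteq> centr N' B'"
  by (auto simp: centr_def)

lemma cyc_ext_le_centr:
  assumes "N \<lhd> G" "B \<subseteq> carrier G" "a \<in> centr N B" "H \<subseteq> centr N B"
  shows "cyc_ext a H \<subseteq> centr N B"
  using assms by (intro cyc_ext_least centr_subgroup)

text \<open>The commutator subgroup \<open>[A, G]\<close>.\<close>
definition bracket :: "'a set \<Rightarrow> 'a set" where
  "bracket A = generate G {cmt a g | a g. a \<in> A \<and> g \<in> carrier G}"

lemma derived_eq_bracket: "derived G (carrier G) = bracket (carrier G)"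
  unfolding derived_def bracket_def cmt_def by (rule arg_cong[of _ _ "generate G"]) auto

lemma bracket_normal:
  assumes A: "A \<lhd> G"
  shows "bracket A \<lhd> G"
  unfolding bracket_def
proof (rule normal_generateI)
  interpret normal A G by fact
  show "{cmt a g | a g. a \<in> A \<and> g \<in> carrier G} \<subseteq> carrier G" by (auto simp: mem_carrier)
  fix h g assume "h \<in> {cmt a g | a g. a \<in> A \<and> g \<in> carrier G}" and g: "g \<in> carrier G"
  then obtain a b where "h = cmt a b" "a \<in> A" "b \<in> carrier G" by auto
  then have "g \<otimes> h \<otimes> inv g = cmt (g \<otimes> a \<otimes> inv g) (g \<otimes> b \<otimes> inv g)"
    "g \<otimes> a \<otimes> inv g \<in> A"
    using g conj_cmt conj_in_normal(1)[OF A] by (auto simp: mem_carrier)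
  then show "g \<otimes> h \<otimes> inv g \<in> {cmt a g | a g. a \<in> A \<and> g \<in> carrier G}"
    using g \<open>b \<in> carrier G\<close> by blast
qed

lemma bracket_mem: "a \<in> A \<Longrightarrow> g \<in> carrier G \<Longrightarrow> cmt a g \<in> bracket A"
  unfolding bracket_def by (auto intro: generate.incl)

lemma bracket_least:
  assumes "subgroup N G" "\<And>a g. a \<in> A \<Longrightarrow> g \<in> carrier G \<Longrightarrow> cmt a g \<in> N"
  shows "bracket A \<subseteq> N"
  unfolding bracket_def using assms by (intro generate_subgroup_incl) auto

lemma bracket_subset: "A \<lhd> G \<Longrightarrow> bracket A \<subseteq> A"
  by (rule bracket_least) (auto intro: normal_imp_subgroup cmt_in_normal)

lemma bracket_le_iff:
  assumes "subgroup N G" "A \<subseteq> carrier G"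
  shows "bracket A \<subseteq> N \<longleftrightarrow> A \<subseteq> centr N (carrier G)"
proof
  show "bracket A \<subseteq> N \<Longrightarrow> A \<subseteq> centr N (carrier G)"
    using bracket_mem assms(2) by (auto simp: centr_def)
  show "A \<subseteq> centr N (carrier G) \<Longrightarrow> bracket A \<subseteq> N"
    by (rule bracket_least[OF assms(1)]) (auto simp: centr_def)
qed

end

section \<open>Chief factors of finite p-groups\<close>

locale p_group = group +
  fixes p m :: nat
  assumes prime_p: "prime p" and order_eq: "Coset.order G = p ^ m"
begin

lemma p_gt_1: "p > 1" using prime_p prime_gt_1_nat by blast

lemma finite_carrier: "finite (carrier G)"
  using order_eq p_gt_1 order_gt_0_iff_finite by simp

lemma finite_sub: "N \<subseteq> carrier G \<Longrightarrow> finite N"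
  using finite_carrier finite_subset by blast

lemma card_subgroup_pos: "subgroup S G \<Longrightarrow> card S > 0"
  using finite_sub[OF subgroup.subset] subgroup.one_closed card_gt_0_iff by blast

lemma card_subgroup_dvd:
  assumes "subgroup S G" "subgroup T G" "S \<subseteq> T"
  shows "card S dvd card T"
proof -
  interpret T: group "G\<lparr>carrier := T\<rparr>" using assms(2) subgroup_imp_group by blast
  have S: "subgroup S (G\<lparr>carrier := T\<rparr>)" using assms by (simp add: subgroup_incl)
  have "card S dvd card (rcosets\<^bsub>G\<lparr>carrier := T\<rparr>\<^esub> S) * card S" by simp
  also have "\<dots> = card T" using T.lagrange[OF S] by (simp add: Coset.order_def)
  finally show ?thesis .
qed

lemma card_subgroup:
  assumes "subgroup S G"
  shows "card S dvd p ^ m"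
  using card_subgroup_dvd[OF assms subgroup_self] subgroup.subset[OF assms] order_eq by (simp add: Coset.order_def)

lemma card_subgroup_pow:
  assumes "subgroup S G"
  obtains k where "k \<le> m" "card S = p ^ k"
  using card_subgroup[OF assms] divides_primepow_nat[OF prime_p] by blast

lemma proper_subgroup_card:
  assumes "subgroup S G" "subgroup T G" "S \<subset> T"
  shows "p * card S dvd card T"
proof -
  obtain i where i: "card S = p ^ i" using assms card_subgroup_pow by blast
  obtain j where j: "card T = p ^ j" using assms card_subgroup_pow by blast
  have "card S < card T"
    using assms finite_sub[OF subgroup.subset[OF assms(2)]] psubset_card_mono by blast
  then have "i < j" using i j p_gt_1 by simp
  then have "p ^ Suc i dvd p ^ j" by (intro le_imp_power_dvd) simp
  then show ?thesis using i j by simp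
qed

text \<open>All conjugacy classes have \<open>p\<close>-power length. If \<open>\<one>\<close> were the only class of length one in \<open>N\<close>,
  then \<open>|N|\<close> would be \<open>1\<close> modulo \<open>p\<close>.\<close>
lemma normal_meets_center:
  assumes N: "N \<lhd> G" and nt: "N \<noteq> {\<one>}"
  shows "\<exists>a\<in>N. a \<noteq> \<one> \<and> (\<forall>g\<in>carrier G. g \<otimes> a = a \<otimes> g)"
proof (rule ccontr)
  assume no: "\<not> ?thesis"
  interpret N: normal N G by fact
  define \<phi> where "\<phi> = (\<lambda>g. \<lambda>h \<in> carrier G. g \<otimes> h \<otimes> inv g)"
  interpret group_action G "carrier G" \<phi> unfolding \<phi>_def by (rule action_by_conjugation)
  let ?O = "orbit G \<phi>"
  have orb: "?O a = {g \<otimes> a \<otimes> inv g | g. g \<in> carrier G}" if "a \<in> N" for a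
    using that N.mem_carrier unfolding orbit_def \<phi>_def by auto
  have sub: "?O a \<subseteq> N" if "a \<in> N" for a
    using orb[OF that] conj_in_normal(1)[OF N that] by auto
  have self: "a \<in> ?O a" if "a \<in> N" for a using that N.mem_carrier orbit_refl by blast
  have finN: "finite N" by (rule finite_sub[OF N.subset])
  have un: "N = \<Union> (?O ` N)" using sub self by blast
  have "pairwise disjnt (?O ` N)"
    using disjoint_union N.mem_carrier unfolding pairwise_def disjnt_def orbits_def by blast
  then have card: "card N = (\<Sum>C\<in>?O ` N. card C)"
    by (subst un, intro card_Union_disjoint) (auto intro: finite_subset[OF sub finN])
  have dvd: "p dvd card (?O a)" if a: "a \<in> N" "a \<noteq> \<one>" for a
  proof -
    have ac: "a \<in> carrier G" using a by (simp add: N.mem_carrier)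
    obtain g where g: "g \<in> carrier G" "g \<otimes> a \<noteq> a \<otimes> g" using no a by blast
    have "g \<otimes> a = (g \<otimes> a \<otimes> inv g) \<otimes> g" using g ac by (simp add: word_simps)
    then have "g \<otimes> a \<otimes> inv g \<noteq> a" using g(2) by force
    moreover have "g \<otimes> a \<otimes> inv g \<in> ?O a" using orb[OF a(1)] g by auto
    ultimately have "card {a, g \<otimes> a \<otimes> inv g} \<le> card (?O a)"
      using self[OF a(1)] by (intro card_mono finite_subset[OF sub[OF a(1)] finN]) auto
    then have gt: "card (?O a) > 1" using \<open>g \<otimes> a \<otimes> inv g \<noteq> a\<close> by auto
    have "card (?O a) dvd p ^ m"
      using orbit_stabilizer_theorem[OF ac] order_eq by (metis dvd_triv_left)
    then obtain i where "card (?O a) = p ^ i" using divides_primepow_nat[OF prime_p] by blast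
    then show ?thesis using gt by (cases i) auto
  qed
  have one: "?O \<one> = {\<one>}" using orb[of \<one>] by (auto intro: exI[of _ \<one>])
  have "card N = 1 + (\<Sum>C\<in>?O ` N - {{\<one>}}. card C)"
    unfolding card using one finN by (subst sum.remove[of _ "{\<one>}"]) force+
  moreover have "p dvd (\<Sum>C\<in>?O ` N - {{\<one>}}. card C)"
    using dvd one by (intro dvd_sum) auto
  moreover have "p dvd card N"
  proof -
    have "{\<one>} \<subset> N" using nt by auto
    from proper_subgroup_card[OF triv_subgroup N.subgroup_axioms this] show ?thesis by simp
  qed
  ultimately have "p dvd 1" by (metis dvd_add_left_iff)
  then show False using p_gt_1 by simp
qed

lemma quotient_p_group:
  assumes N: "N \<lhd> G"
  shows "\<exists>k. p_group (G Mod N) p k"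
proof -
  interpret normal N G by fact
  have "Coset.order (G Mod N) dvd Coset.order (G Mod N) * card N" by simp
  also have "\<dots> = p ^ m"
    using lagrange[OF subgroup_axioms] order_eq by (simp add: Coset.order_def FactGroup_def)
  finally have "Coset.order (G Mod N) dvd p ^ m" .
  then obtain k where "Coset.order (G Mod N) = p ^ k" using divides_primepow_nat[OF prime_p] by blast
  then show ?thesis
    using prime_p factorgroup_is_group by (auto intro!: exI[of _ k] p_group.intro p_group_axioms.intro)
qed

lemma power_of_order_p_mod:
  assumes N: "subgroup N G" and a: "a \<in> carrier G" "a \<notin> N"
  shows "\<exists>j::nat. a [^] j \<notin> N \<and> (a [^] j) [^] p \<in> N"
proof -
  have "a [^] (p ^ m) \<in> N"
    using pow_order_eq_1[OF a(1)] order_eq subgroup.one_closed[OF N] by simp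
  moreover have "a [^] (p ^ (0::nat)) \<notin> N" using a by simp
  ultimately obtain i where "a [^] (p ^ i) \<notin> N" "a [^] (p ^ Suc i) \<in> N"
    using dec_induct[of 0 m "\<lambda>i. a [^] (p ^ i) \<notin> N"] by blast
  moreover have "(a [^] (p ^ i)) [^] p = a [^] (p ^ Suc i)"
    using a by (simp add: nat_pow_pow mult.commute)
  ultimately show ?thesis by metis
qed

text \<open>A nontrivial normal subgroup of \<open>G / L\<close> contains a nontrivial central element, and a power of it has order \<open>p\<close>.\<close>
lemma central_mod_exists:
  assumes L: "L \<lhd> G" and A: "A \<lhd> G" and LA: "L \<subset> A"
  shows "\<exists>a \<in> A - L. a \<in> centr L (carrier G) \<and> a [^] p \<in> L"
proof -
  interpret L: normal L G by fact
  interpret A: normal A G by fact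
  obtain k where "p_group (G Mod L) p k" using quotient_p_group[OF L] by blast
  then interpret Q: p_group "G Mod L" p k .
  interpret h: group_hom G "G Mod L" "(#>) L" by (rule quotient_hom[OF L])
  have nrm: "(#>) L ` A \<lhd> G Mod L"
    by (rule normal.surj_hom_normal_subgroup[OF A h.group_hom_axioms]) (simp add: carrier_FactGroup)
  have ker: "L #> a = L \<longleftrightarrow> a \<in> L" if "a \<in> carrier G" for a
    using that coset_join1 coset_join2 L.subgroup_axioms L.subset by blast
  obtain a0 where "a0 \<in> A" "a0 \<notin> L" using LA by auto
  then have "(#>) L ` A \<noteq> {\<one>\<^bsub>G Mod L\<^esub>}" using ker[of a0] A.mem_carrier by auto
  from Q.normal_meets_center[OF nrm this] obtain a where a: "a \<in> A" "L #> a \<noteq> L"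
    and c: "\<And>g. g \<in> carrier G \<Longrightarrow> (L #> g) <#> (L #> a) = (L #> a) <#> (L #> g)"
    by (auto simp: carrier_FactGroup)
  have ac: "a \<in> carrier G" using a A.mem_carrier by blast
  have "cmt a g \<in> L" if g: "g \<in> carrier G" for g
  proof -
    have "L #> (g \<otimes> a) = L #> (a \<otimes> g)" by (metis c[OF g] L.rcos_sum[OF g ac] L.rcos_sum[OF ac g])
    moreover have "g \<otimes> a \<in> L #> (g \<otimes> a)"
      by (rule rcos_self[OF _ L.subgroup_axioms]) (use g ac in simp)
    ultimately have "g \<otimes> a \<otimes> inv (a \<otimes> g) \<in> L"
      using L.rcos_module_imp[OF is_group, of "a \<otimes> g" "g \<otimes> a"] g ac by simp
    then have "cmt g a \<in> L" using g ac by (simp add: cmt_def word_simps)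
    then show ?thesis using cmt_swap_mem[OF L.subgroup_axioms g ac] by simp
  qed
  then have a_centr: "a \<in> centr L (carrier G)" using ac by (simp add: centr_def)
  have "a \<notin> L" using a ker[OF ac] by simp
  from power_of_order_p_mod[OF L.subgroup_axioms ac this] obtain j :: nat
    where j: "a [^] j \<notin> L" "(a [^] j) [^] p \<in> L" by blast
  moreover have "a [^] j \<in> A" using a(1) A.subgroup_axioms by (metis int_pow_int subgroup_int_pow_closed)
  moreover have "a [^] j \<in> centr L (carrier G)"
    using a_centr centr_subgroup[OF L] by (metis int_pow_int subgroup_int_pow_closed subset_refl)
  ultimately show ?thesis by blast
qed

text \<open>A maximal choice of \<open>L\<close> works: a subgroup of order \<open>p\<close> of \<open>A / L\<close> that is central in \<open>G / L\<close> must be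
  all of \<open>A / L\<close>.\<close>
lemma maximal_normal_below:
  assumes N: "N \<lhd> G" and A: "A \<lhd> G" and NA: "N \<subset> A"
  obtains L where "L \<lhd> G" "N \<subseteq> L" "L \<subset> A" "A \<subseteq> centr L (carrier G)"
    "\<And>a. a \<in> A \<Longrightarrow> a [^] p \<in> L"
    "card A \<le> p * card L"
    "\<And>K. K \<lhd> G \<Longrightarrow> L \<subseteq> K \<Longrightarrow> K \<subset> A \<Longrightarrow> K = L"
proof -
  let ?P = "\<lambda>L. L \<lhd> G \<and> N \<subseteq> L \<and> L \<subset> A"
  have "card L \<le> card A" if "?P L" for L
    using that finite_sub[OF subgroup.subset[OF normal_imp_subgroup[OF A]]] by (intro card_mono) auto
  then have "\<exists>L. ?P L \<and> (\<forall>K. ?P K \<longrightarrow> card K \<le> card L)"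
    using ex_has_greatest_nat[of ?P N card "Suc (card A)"] assms by (auto simp: less_Suc_eq_le)
  then obtain L where L: "?P L" and max: "\<And>K. ?P K \<Longrightarrow> card K \<le> card L"
    by blast
  have Ln: "L \<lhd> G" using L by blast
  have Ls: "subgroup L G" using Ln by (rule normal_imp_subgroup)
  have eq: "K = L" if K: "K \<lhd> G" "L \<subseteq> K" "K \<subset> A" for K
  proof -
    have "card K \<le> card L" using K L by (intro max) auto
    then show ?thesis
      using K finite_sub[OF subgroup.subset[OF normal_imp_subgroup[OF K(1)]]] card_seteq by metis
  qed
  obtain a where a: "a \<in> A - L" "a \<in> centr L (carrier G)" "a [^] p \<in> L"
    using central_mod_exists[OF Ln A] L by blast
  have ac: "a \<in> carrier G" using a by (simp add: centr_def)
  have "cyc_ext a L \<subseteq> A"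
    using a L cyc_ext_least[OF normal_imp_subgroup[OF A]] by auto
  moreover have "cyc_ext a L \<noteq> L" using cyc_ext_incl[OF Ls ac] a by auto
  ultimately have A_eq: "A = cyc_ext a L"
    using eq[OF cyc_ext_normal(1)[OF Ln a(2)] cyc_ext_incl(1)[OF Ls ac]] by auto
  have cen: "A \<subseteq> centr L (carrier G)" unfolding A_eq by (rule cyc_ext_normal(2)[OF Ln a(2)])
  have fin: "finite L" using finite_sub subgroup.subset[OF Ls] by blast
  have "card A \<le> p * card L"
    unfolding A_eq by (rule card_cyc_ext_le[OF Ls fin ac a(3)]) (use p_gt_1 in simp)
  moreover have "b [^] p \<in> L" if "b \<in> A" for b
    using cyc_ext_power_mem[OF Ln ac a(3)] that A_eq by blast
  ultimately show thesis using that[of L] L cen eq by blast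
qed

end

section \<open>Maximal subgroups when the abelianization has order p squared\<close>

context group
begin

text \<open>The terms \<open>\<gamma>\<^sub>2 = G'\<close>, \<open>\<gamma>\<^sub>3\<close> and \<open>\<gamma>\<^sub>4\<close> of the lower central series.\<close>
definition gam2 where "gam2 = bracket (carrier G)"
definition gam3 where "gam3 = bracket gam2"
definition gam4 where "gam4 = bracket gam3"

lemma gam_normal: "gam2 \<lhd> G" "gam3 \<lhd> G" "gam4 \<lhd> G"
  unfolding gam2_def gam3_def gam4_def by (intro bracket_normal carrier_normal)+

lemma gam_subgroup: "subgroup gam2 G" "subgroup gam3 G" "subgroup gam4 G"
  using gam_normal normal_imp_subgroup by auto

lemma gam_subset: "gam2 \<subseteq> carrier G" "gam3 \<subseteq> carrier G" "gam4 \<subseteq> carrier G"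
  using gam_subgroup subgroup.subset by auto

lemma gam_decreasing: "gam3 \<subseteq> gam2" "gam4 \<subseteq> gam3"
  using bracket_subset[OF gam_normal(1)] bracket_subset[OF gam_normal(2)] by (simp_all add: gam3_def gam4_def)

lemma subgroup_above_gam2_normal:
  assumes S: "subgroup S G" and g: "gam2 \<subseteq> S"
  shows "S \<lhd> G"
proof (rule normal_invI[OF S])
  fix x h assume x: "x \<in> carrier G" and h: "h \<in> S"
  have hc: "h \<in> carrier G" using subgroup.mem_carrier[OF S h] .
  have "cmt x h \<in> S" using subsetD[OF g] bracket_mem[OF x hc] by (simp add: gam2_def)
  then show "x \<otimes> h \<otimes> inv x \<in> S"
    using conj_eq_cmt_mult[OF x hc] subgroup.m_closed[OF S] h by simp
qed

lemma gam2_centr: "gam2 \<subseteq> centr gam3 (carrier G)"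
  using bracket_le_iff[OF gam_subgroup(2) gam_subset(1)] by (simp add: gam3_def)

lemma gam3_centr_iff: "N \<lhd> G \<Longrightarrow> gam3 \<subseteq> N \<longleftrightarrow> gam2 \<subseteq> centr N (carrier G)"
  using bracket_le_iff[OF normal_imp_subgroup gam_subset(1)] by (simp add: gam3_def)

lemma gam4_centr_iff: "N \<lhd> G \<Longrightarrow> gam4 \<subseteq> N \<longleftrightarrow> gam3 \<subseteq> centr N (carrier G)"
  using bracket_le_iff[OF normal_imp_subgroup gam_subset(2)] by (simp add: gam4_def)

lemma gam2_centr_iff: "N \<lhd> G \<Longrightarrow> gam2 \<subseteq> N \<longleftrightarrow> carrier G \<subseteq> centr N (carrier G)"
  using bracket_le_iff[OF normal_imp_subgroup subset_refl] by (simp add: gam2_def)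

end

context p_group
begin

text \<open>This is how nilpotency is used: to show \<open>A \<le> N\<close>, one may assume that \<open>A\<close> is central modulo \<open>N\<close>.\<close>
lemma not_subset_central_quotient:
  assumes A: "A \<lhd> G" and N: "N \<lhd> G" and AN: "\<not> A \<subseteq> N"
  obtains L where "L \<lhd> G" "N \<subseteq> L" "\<not> A \<subseteq> L" "A \<subseteq> centr L (carrier G)"
    "\<And>a. a \<in> A \<Longrightarrow> a [^] p \<in> L"
proof -
  let ?P = "generate G (A \<union> N)"
  have sub: "A \<subseteq> ?P" "N \<subseteq> ?P" by (auto intro: generate.incl)
  then have "N \<subset> ?P" using AN by blast
  from maximal_normal_below[OF N normal_generate_Un[OF A N] this]
  obtain L where L: "L \<lhd> G" "N \<subseteq> L" "L \<subset> ?P" "?P \<subseteq> centr L (carrier G)" "\<And>a. a \<in> ?P \<Longrightarrow> a [^] p \<in> L"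
    by metis
  have "\<not> A \<subseteq> L" using L generate_subgroup_incl[of "A \<union> N" L] normal_imp_subgroup by blast
  then show thesis using that L sub by blast
qed

text \<open>An exponent prime to \<open>p\<close> is invertible modulo the order of \<open>a\<close>.\<close>
lemma power_mem_or_prime_dvd:
  assumes S: "subgroup S G" and a: "a \<in> carrier G" and i: "a [^] (i::int) \<in> S"
  shows "a \<in> S \<or> int p dvd i"
proof (rule disjCI)
  assume "\<not> int p dvd i"
  moreover have "prime (int p)" using prime_p by simp
  ultimately have "coprime (int p) i" using prime_imp_coprime by blast
  then have "coprime i (int (p ^ m))" by (simp add: coprime_commute)
  then show "a \<in> S"
    using power_coprime_mem[OF S a _ i] pow_order_eq_1[OF a] order_eq by simp
qed

lemma power_p_mem_of_index_p:
  assumes N: "N \<lhd> G" and S: "subgroup S G" and NS: "N \<subseteq> S" and card: "card S = p * card N" and s: "s \<in> S"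
  shows "s [^] p \<in> N"
proof -
  interpret T: group "G\<lparr>carrier := S\<rparr>" using S subgroup_imp_group by blast
  have nT: "N \<lhd> G\<lparr>carrier := S\<rparr>" by (rule normal_restrict_supergroup[OF S N NS])
  interpret nT: normal N "G\<lparr>carrier := S\<rparr>" by fact
  interpret Q: group "G\<lparr>carrier := S\<rparr> Mod N" by (rule nT.factorgroup_is_group)
  have "card (rcosets\<^bsub>G\<lparr>carrier := S\<rparr>\<^esub> N) * card N = p * card N"
    using T.lagrange[OF nT.subgroup_axioms] card by (simp add: Coset.order_def)
  moreover have "card N > 0"
    by (rule card_subgroup_pos[OF normal_imp_subgroup[OF N]])
  ultimately have ord: "Coset.order (G\<lparr>carrier := S\<rparr> Mod N) = p"
    by (simp add: Coset.order_def FactGroup_def)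
  have sc: "s \<in> carrier (G\<lparr>carrier := S\<rparr>)" using s by simp
  then have "N #>\<^bsub>G\<lparr>carrier := S\<rparr>\<^esub> s \<in> carrier (G\<lparr>carrier := S\<rparr> Mod N)" by (simp add: carrier_FactGroup)
  from Q.pow_order_eq_1[OF this]
  have "N #>\<^bsub>G\<lparr>carrier := S\<rparr>\<^esub> (s [^]\<^bsub>G\<lparr>carrier := S\<rparr>\<^esub> p) = N"
    using nT.FactGroup_pow[OF sc, of p] by (simp add: ord)
  then have "s [^]\<^bsub>G\<lparr>carrier := S\<rparr>\<^esub> p \<in> N"
    using T.rcos_self[OF T.nat_pow_closed[OF sc] nT.subgroup_axioms, of p] by simp
  then show ?thesis by (simp flip: nat_pow_consistent)
qed

end

locale p_group_abelianization_square = p_group +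
  assumes card_gam2: "card (carrier G) = p ^ 2 * card gam2"
begin

text \<open>The maximal subgroups of \<open>G\<close>; they have index \<open>p\<close> and contain \<open>\<gamma>\<^sub>2\<close>.\<close>
definition max_sub :: "'a set \<Rightarrow> bool" where
  "max_sub M \<longleftrightarrow> subgroup M G \<and> gam2 \<subseteq> M \<and> p * card M = card (carrier G)"

lemma max_subD:
  assumes "max_sub M"
  shows "subgroup M G" "gam2 \<subseteq> M" "p * card M = card (carrier G)" "card M = p * card gam2" "M \<lhd> G" "M \<subseteq> carrier G"
  using assms p_gt_1 subgroup_above_gam2_normal subgroup.subset
  by (auto simp: max_sub_def card_gam2 power2_eq_square)

lemma max_sub_exists: "\<exists>M. max_sub M"
proof -
  have "card gam2 > 0"
    by (rule card_subgroup_pos[OF gam_subgroup(1)])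
  moreover have "1 < p ^ 2" using one_less_power[OF p_gt_1, of 2] by simp
  ultimately have "card gam2 < card (carrier G)" unfolding card_gam2 by simp
  then have "gam2 \<subset> carrier G" using gam_subset by auto
  from maximal_normal_below[OF gam_normal(1) carrier_normal this]
  obtain L where L: "L \<lhd> G" "gam2 \<subseteq> L" "L \<subset> carrier G" "card (carrier G) \<le> p * card L" by metis
  have "p * card L dvd card (carrier G)"
    by (rule proper_subgroup_card) (use L normal_imp_subgroup subgroup_self in auto)
  then have "p * card L \<le> card (carrier G)"
    by (rule dvd_imp_le) (use finite_carrier card_gt_0_iff in blast)
  then have "p * card L = card (carrier G)" using L(4) by simp
  then show ?thesis using L(2) normal_imp_subgroup[OF L(1)] unfolding max_sub_def by blast
qed

lemma max_sub_maximal: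
  assumes M: "max_sub M" and S: "subgroup S G" and MS: "M \<subset> S"
  shows "S = carrier G"
proof -
  have "p * card M dvd card S" using proper_subgroup_card[OF max_subD(1)[OF M] S MS] .
  moreover have "card S > 0"
    by (rule card_subgroup_pos[OF S])
  ultimately have "card (carrier G) \<le> card S" using max_subD(3)[OF M] dvd_imp_le by metis
  then show ?thesis using card_seteq[OF finite_carrier subgroup.subset[OF S]] by simp
qed

lemma max_sub_two:
  assumes "max_sub M" "max_sub M'" "M \<noteq> M'" "subgroup S G" "M \<subseteq> S" "M' \<subseteq> S"
  shows "S = carrier G"
proof -
  have "M \<noteq> S"
  proof
    assume "M = S"
    then have "M' \<subseteq> M" using assms by simp
    moreover have "card M = card M'" using assms(1,2) by (simp add: max_subD(4))
    ultimately show False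
      using assms(3) card_subset_eq[OF finite_sub[OF max_subD(6)[OF assms(1)]]] by metis
  qed
  then show ?thesis using max_sub_maximal[OF assms(1,4)] assms(5) by blast
qed

lemma max_sub_elem:
  assumes M: "max_sub M"
  obtains s where "s \<in> M" "s \<notin> gam2"
proof -
  have "card gam2 > 0"
    by (rule card_subgroup_pos[OF gam_subgroup(1)])
  then have "card gam2 < card M" using max_subD(4)[OF M] p_gt_1 by simp
  then have "M \<noteq> gam2" by auto
  then show thesis using that max_subD(2)[OF M] by blast
qed

lemma max_sub_outside:
  assumes M: "max_sub M"
  obtains x where "x \<in> carrier G" "x \<notin> M"
proof -
  have "card (carrier G) > 0" using finite_carrier card_gt_0_iff by blast
  then have "card M < card (carrier G)" using max_subD(3)[OF M] p_gt_1
    by (metis One_nat_def Suc_lessI nat_0_less_mult_iff n_less_m_mult_n)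
  then have "M \<noteq> carrier G" by auto
  then show thesis using that max_subD(6)[OF M] by blast
qed

lemma max_sub_eq_cyc_ext:
  assumes M: "max_sub M" and s: "s \<in> M" "s \<notin> gam2"
  shows "M = cyc_ext s gam2"
proof -
  have sc: "s \<in> carrier G" using max_subD(6)[OF M] s by blast
  have sub: "cyc_ext s gam2 \<subseteq> M" by (rule cyc_ext_least[OF max_subD(1)[OF M] s(1) max_subD(2)[OF M]])
  have S: "subgroup (cyc_ext s gam2) G" by (rule cyc_ext_subgroup[OF gam_normal(1) sc])
  have "gam2 \<subset> cyc_ext s gam2" using cyc_ext_incl[OF gam_subgroup(1) sc] s by blast
  from proper_subgroup_card[OF gam_subgroup(1) S this]
  have "p * card gam2 dvd card (cyc_ext s gam2)" .
  moreover have "card (cyc_ext s gam2) > 0"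
    by (rule card_subgroup_pos[OF S])
  ultimately have "card M \<le> card (cyc_ext s gam2)" using max_subD(4)[OF M] dvd_imp_le by metis
  then show ?thesis using card_seteq[OF finite_sub[OF max_subD(6)[OF M]] sub] by simp
qed

text \<open>Modulo \<open>\<gamma>\<^sub>3\<close>, the subgroup \<open>M\<close> is generated by the central subgroup \<open>\<gamma>\<^sub>2\<close> and one element.\<close>
lemma max_sub_centr:
  assumes M: "max_sub M" and N: "N \<lhd> G" and g: "gam3 \<subseteq> N"
  shows "M \<subseteq> centr N M"
proof -
  obtain s where s: "s \<in> M" "s \<notin> gam2" using max_sub_elem[OF M] .
  have sc: "s \<in> carrier G" using max_subD(6)[OF M] s by blast
  note eq = max_sub_eq_cyc_ext[OF M s]
  have g2: "gam2 \<subseteq> centr N B" if "B \<subseteq> carrier G" for B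
    using gam3_centr_iff[OF N] g centr_mono[of N N B "carrier G"] that by blast
  have "cyc_ext s gam2 \<subseteq> centr N {s}"
    using sc subgroup.one_closed[OF normal_imp_subgroup[OF N]]
    by (intro cyc_ext_le_centr[OF N] g2) (auto simp: centr_def)
  then have "{s} \<subseteq> centr N M"
    using centr_swap[OF normal_imp_subgroup[OF N] max_subD(6)[OF M], of "{s}"] sc eq by auto
  then show ?thesis
    using cyc_ext_le_centr[OF N max_subD(6)[OF M] _ g2[OF max_subD(6)[OF M]], of s] eq by auto
qed

text \<open>Modulo \<open>\<langle>[s, x]\<rangle>\<gamma>\<^sub>3\<close>, the group is generated by \<open>s\<close>, \<open>x\<close> and the central subgroup \<open>\<gamma>\<^sub>2\<close>, hence abelian.\<close>
lemma gam2_le_cyc_ext: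
  assumes M: "max_sub M" and s: "s \<in> M" "s \<notin> gam2" and x: "x \<in> carrier G" "x \<notin> M"
  shows "gam2 \<subseteq> cyc_ext (cmt s x) gam3"
proof -
  have sc: "s \<in> carrier G" using max_subD(6)[OF M] s by blast
  let ?c = "cmt s x"
  have c2: "?c \<in> gam2" using bracket_mem[OF sc x(1)] by (simp add: gam2_def)
  then have cc: "?c \<in> centr gam3 (carrier G)" using gam2_centr by blast
  let ?T = "cyc_ext ?c gam3"
  have T: "?T \<lhd> G" by (rule cyc_ext_normal(1)[OF gam_normal(2) cc])
  have Ts: "subgroup ?T G" using T by (rule normal_imp_subgroup)
  have inc: "gam3 \<subseteq> ?T" "?c \<in> ?T" using cyc_ext_incl[OF gam_subgroup(2), of ?c] sc x by auto
  have g2: "gam2 \<subseteq> centr ?T B" if "B \<subseteq> carrier G" for B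
    using gam3_centr_iff[OF T] inc centr_mono[of ?T ?T B "carrier G"] that by blast
  have gen: "S = carrier G" if "subgroup S G" "s \<in> S" "x \<in> S" "gam2 \<subseteq> S" for S
    using max_sub_maximal[OF M that(1)] cyc_ext_least[OF that(1,2,4)] max_sub_eq_cyc_ext[OF M s] that(3) x by blast
  have one: "\<one> \<in> ?T" using subgroup.one_closed[OF Ts] .
  have "centr ?T {x} = carrier G"
    using sc x inc one g2 by (intro gen centr_subgroup[OF T]) (auto simp: centr_def)
  then have xx: "x \<in> centr ?T (carrier G)"
    using centr_swap[OF Ts, of "carrier G" "{x}"] x by auto
  have "centr ?T {s} = carrier G"
    using sc x inc one g2 cmt_swap_mem[OF Ts sc x(1)]
    by (intro gen centr_subgroup[OF T]) (auto simp: centr_def)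
  then have "s \<in> centr ?T (carrier G)"
    using centr_swap[OF Ts, of "carrier G" "{s}"] sc by auto
  then have "centr ?T (carrier G) = carrier G"
    using xx g2 by (intro gen centr_subgroup[OF T]) auto
  then show ?thesis using gam2_centr_iff[OF T] by simp
qed

text \<open>Suppose not; by nilpotency one may assume \<open>\<gamma>\<^sub>3\<close> central modulo \<open>K\<close>, that is, \<open>\<gamma>\<^sub>4 \<le> K\<close>. Then both
  \<open>M0\<close> and \<open>M\<close> centralize \<open>\<gamma>\<^sub>2\<close> modulo \<open>K\<close>, and together they generate \<open>G\<close>.\<close>
lemma gam3_le_of_abelian_mod:
  assumes M0: "max_sub M0" and M: "max_sub M" "M \<noteq> M0"
    and Z: "Z \<lhd> G" and ab0: "M0 \<subseteq> centr (generate G (gam4 \<union> Z)) M0"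
    and K: "K \<lhd> G" "Z \<subseteq> K" and ab: "M \<subseteq> centr K M"
  shows "gam3 \<subseteq> K"
proof (rule ccontr)
  assume "\<not> gam3 \<subseteq> K"
  from not_subset_central_quotient[OF gam_normal(2) K(1) this]
  obtain L where L: "L \<lhd> G" "K \<subseteq> L" "\<not> gam3 \<subseteq> L" "gam3 \<subseteq> centr L (carrier G)" by metis
  have "gam4 \<subseteq> L" using gam4_centr_iff L by blast
  then have "generate G (gam4 \<union> Z) \<subseteq> L"
    using L K normal_imp_subgroup[OF L(1)] by (intro generate_subgroup_incl) auto
  then have "M0 \<subseteq> centr L gam2" using ab0 max_subD(2)[OF M0] centr_mono by blast
  moreover have "M \<subseteq> centr L gam2" using ab max_subD(2)[OF M(1)] centr_mono L(2) by blast
  ultimately have "centr L gam2 = carrier G"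
    using max_sub_two[OF M0 M(1) M(2)[symmetric] centr_subgroup[OF L(1) gam_subset(1)]] by blast
  then have "gam2 \<subseteq> centr L (carrier G)"
    using centr_swap[OF normal_imp_subgroup[OF L(1)] gam_subset(1) subset_refl] by simp
  then show False using gam3_centr_iff L by blast
qed

text \<open>The hypothesis \<open>sep\<close> is what the representations of degree at most \<open>p\<close> provide. If some \<open>M0\<close> is
  abelian modulo \<open>\<gamma>\<^sub>4 Z\<close>, then a normal subgroup above \<open>Z\<close> modulo which another maximal subgroup is
  abelian contains \<open>\<gamma>\<^sub>3\<close> and with it \<open>[M0, M0]\<close>. So all the subgroups \<open>K\<close> from \<open>sep\<close> contain \<open>[M0, M0]\<close>,
  and they intersect in \<open>Z\<close>. If there is no such \<open>M0\<close> and \<open>\<gamma>\<^sub>4\<close> is not in \<open>Z\<close>, a chief factor \<open>\<gamma>\<^sub>4 Z / L\<close>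
  leads to two different maximal subgroups that centralize \<open>\<gamma>\<^sub>2\<close> modulo the elements central modulo \<open>L\<close>,
  which makes \<open>\<gamma>\<^sub>4\<close> trivial modulo \<open>L\<close>.\<close>
theorem abelian_mod_or_gam4:
  assumes Z: "Z \<lhd> G"
    and sep: "\<And>N h. N \<lhd> G \<Longrightarrow> Z \<subseteq> N \<Longrightarrow> h \<in> carrier G - N \<Longrightarrow>
      \<exists>K M. K \<lhd> G \<and> N \<subseteq> K \<and> h \<notin> K \<and> max_sub M \<and> M \<subseteq> centr K M"
  shows "(\<exists>M. max_sub M \<and> M \<subseteq> centr Z M) \<or> gam4 \<subseteq> Z"
proof (cases "\<exists>M0. max_sub M0 \<and> M0 \<subseteq> centr (generate G (gam4 \<union> Z)) M0")
  case True
  then obtain M0 where M0: "max_sub M0" "M0 \<subseteq> centr (generate G (gam4 \<union> Z)) M0" by blast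
  have "cmt a b \<in> Z" if ab: "a \<in> M0" "b \<in> M0" for a b
  proof (rule ccontr)
    assume nz: "cmt a b \<notin> Z"
    have abc: "a \<in> carrier G" "b \<in> carrier G" using ab max_subD(6)[OF M0(1)] by auto
    obtain K M where K: "K \<lhd> G" "Z \<subseteq> K" "cmt a b \<notin> K" "max_sub M" "M \<subseteq> centr K M"
      using sep[OF Z subset_refl, of "cmt a b"] nz abc by auto
    have "M \<noteq> M0" using K(3,5) ab by (auto simp: centr_def)
    then have "gam3 \<subseteq> K" using gam3_le_of_abelian_mod[OF M0(1) K(4) _ Z M0(2) K(1,2,5)] by blast
    then have "M0 \<subseteq> centr K M0" using max_sub_centr[OF M0(1) K(1)] by blast
    then show False using K(3) ab by (auto simp: centr_def)
  qed
  then have "M0 \<subseteq> centr Z M0" using max_subD(6)[OF M0(1)] by (auto simp: centr_def)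
  then show ?thesis using M0 by blast
next
  case False
  have "gam4 \<subseteq> Z"
  proof (rule ccontr)
    let ?P = "generate G (gam4 \<union> Z)"
    assume "\<not> gam4 \<subseteq> Z"
    moreover have incP: "gam4 \<subseteq> ?P" "Z \<subseteq> ?P" by (auto intro: generate.incl)
    ultimately have "Z \<subset> ?P" by blast
    note Pn = normal_generate_Un[OF gam_normal(3) Z]
    from maximal_normal_below[OF Z Pn \<open>Z \<subset> ?P\<close>]
    obtain L where L: "L \<lhd> G" "Z \<subseteq> L" "L \<subset> ?P" "?P \<subseteq> centr L (carrier G)"
      and maxL: "\<And>K. K \<lhd> G \<Longrightarrow> L \<subseteq> K \<Longrightarrow> K \<subset> ?P \<Longrightarrow> K = L" by metis
    have Ls: "subgroup L G" using L(1) by (rule normal_imp_subgroup)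
    have "\<not> gam4 \<subseteq> L" using L generate_subgroup_incl[of "gam4 \<union> Z" L] Ls by blast
    then obtain w where w: "w \<in> gam4" "w \<notin> L" by blast
    have wc: "w \<in> carrier G" using w gam_subset by blast
    have wP: "w \<in> ?P" using w incP by blast
    have meet: "K \<inter> ?P = L" if "K \<lhd> G" "L \<subseteq> K" "w \<notin> K" for K
      using maxL[OF normal_Int[OF that(1) Pn]] that L wP by blast
    \<comment> \<open>\<open>K\<close> meets the chief factor \<open>?P / L\<close> trivially, so what it has in common with \<open>\<gamma>\<^sub>3\<close> is central
      modulo \<open>L\<close>.\<close>
    have central: "K \<inter> gam3 \<subseteq> centr L (carrier G)" if K: "K \<lhd> G" "L \<subseteq> K" "w \<notin> K" for K
    proof
      fix u assume u: "u \<in> K \<inter> gam3"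
      have "cmt u g \<in> L" if g: "g \<in> carrier G" for g
      proof -
        have "cmt u g \<in> K" using cmt_in_normal(1)[OF \<open>K \<lhd> G\<close>] u g by blast
        moreover have "cmt u g \<in> gam4" using bracket_mem[OF _ g, of u gam3] u by (simp add: gam4_def)
        ultimately show ?thesis using meet[OF K] incP by blast
      qed
      then show "u \<in> centr L (carrier G)" using u gam_subset by (auto simp: centr_def)
    qed
    obtain K1 M1 where K1: "K1 \<lhd> G" "L \<subseteq> K1" "w \<notin> K1" and M1: "max_sub M1" "M1 \<subseteq> centr K1 M1"
      using sep[OF L(1,2), of w] w wc by blast
    obtain a b where ab: "a \<in> M1" "b \<in> M1" "cmt a b \<notin> ?P"
      using False M1(1) max_subD(6)[OF M1(1)] unfolding centr_def by blast
    define u where "u = cmt a b"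
    have uK1: "u \<in> K1" using M1 ab by (auto simp: centr_def u_def)
    have ug3: "u \<in> gam3" using max_sub_centr[OF M1(1) gam_normal(2) subset_refl] ab by (auto simp: centr_def u_def)
    have uc: "u \<in> carrier G" using ug3 gam_subset by blast
    have ucen: "u \<in> centr L (carrier G)" using central[OF K1] uK1 ug3 by blast
    have wcen: "w \<in> centr L (carrier G)" using wP L(4) by blast
    \<comment> \<open>A normal subgroup containing \<open>u w\<close> and not \<open>w\<close> cannot contain \<open>u\<close>. Separating \<open>w\<close> from
      \<open>\<langle>u w\<rangle>L\<close> thus produces a maximal subgroup different from \<open>M1\<close>.\<close>
    have uw: "u \<otimes> w \<in> centr L (carrier G)"
      using subgroup.m_closed[OF centr_subgroup[OF L(1) subset_refl]] ucen wcen by blast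
    let ?N2 = "cyc_ext (u \<otimes> w) L"
    have uwc: "u \<otimes> w \<in> carrier G" using uc wc by simp
    have N2: "?N2 \<lhd> G" "L \<subseteq> ?N2" "u \<otimes> w \<in> ?N2"
      using cyc_ext_normal(1)[OF L(1) uw] cyc_ext_incl[OF Ls uwc] by auto
    have wN2: "w \<notin> ?N2"
    proof
      assume "w \<in> ?N2"
      then obtain i l where il: "w = (u \<otimes> w) [^] (i::int) \<otimes> l" "l \<in> L" by (auto simp: cyc_ext_def)
      \<comment> \<open>Modulo \<open>K1\<close> the element \<open>u\<close> is trivial and \<open>w\<close> is not, which forces \<open>p\<close> to divide \<open>i - 1\<close>;
        then \<open>u\<close> to the power \<open>i\<close> is trivial modulo \<open>L\<close>, which forces \<open>p\<close> to divide \<open>i\<close>,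
        as \<open>u\<close> is not even in \<open>?P\<close>.\<close>
      have wi1: "w [^] i = w [^] (i - 1) \<otimes> w" using int_pow_mult[OF wc, of "i - 1" 1] wc by simp
      have "cmt u w \<in> L" using ucen wc by (auto simp: centr_def)
      then obtain n where n: "n \<in> L" "(u \<otimes> w) [^] i = n \<otimes> (u [^] i \<otimes> w [^] i)"
        using power_mult_mod[OF L(1) uc wc] by blast
      have nc: "n \<in> carrier G" "l \<in> carrier G" using n il subgroup.mem_carrier[OF Ls] by auto
      have "w = n \<otimes> (u [^] i \<otimes> w [^] (i - 1)) \<otimes> (w \<otimes> l)"
        using il(1) n(2) wi1 uc wc nc by (simp add: m_assoc)
      then have "u [^] i \<otimes> w [^] (i - 1) = inv n \<otimes> (w \<otimes> inv (w \<otimes> l))"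
        using uc wc nc by (metis inv_solve_left inv_solve_right int_pow_closed m_assoc m_closed inv_closed)
      also have "\<dots> = inv n \<otimes> (w \<otimes> inv l \<otimes> inv w)" using wc nc by (simp add: inv_mult_group m_assoc)
      also have "\<dots> \<in> L"
        using n(1) il(2) conj_in_normal(1)[OF L(1) _ wc] subgroup.m_closed[OF Ls] subgroup.m_inv_closed[OF Ls] by blast
      finally have uw_i: "u [^] i \<otimes> w [^] (i - 1) \<in> L" .
      have wic: "w [^] (i - 1) \<in> carrier G" "u [^] i \<in> carrier G" using uc wc by auto
      have K1s: "subgroup K1 G" using K1(1) by (rule normal_imp_subgroup)
      have "inv (u [^] i) \<otimes> (u [^] i \<otimes> w [^] (i - 1)) \<in> K1"
        using uw_i K1(2) subgroup_int_pow_closed[OF K1s uK1] subgroup.m_closed[OF K1s] subgroup.m_inv_closed[OF K1s] by blast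
      then have "w [^] (i - 1) \<in> K1" using wic by (simp add: l_inv_cancel)
      then have wi: "w [^] (i - 1) \<in> L"
        using meet[OF K1] subgroup_int_pow_closed[OF normal_imp_subgroup[OF Pn] wP, of "i - 1"] by blast
      then have "int p dvd i - 1" using power_mem_or_prime_dvd[OF Ls wc wi] w by blast
      have "(u [^] i \<otimes> w [^] (i - 1)) \<otimes> inv (w [^] (i - 1)) \<in> L"
        using uw_i wi subgroup.m_closed[OF Ls] subgroup.m_inv_closed[OF Ls] by blast
      then have ui: "u [^] i \<in> ?P" using wic L(3) by (auto simp: m_assoc)
      have "int p dvd i" using power_mem_or_prime_dvd[OF normal_imp_subgroup[OF Pn] uc ui] ab(3) by (simp add: u_def)
      then have "int p dvd i - (i - 1)" using \<open>int p dvd i - 1\<close> by (rule dvd_diff)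
      then show False using p_gt_1 by simp
    qed
    obtain K2 M2 where K2: "K2 \<lhd> G" "?N2 \<subseteq> K2" "w \<notin> K2" and M2: "max_sub M2" "M2 \<subseteq> centr K2 M2"
      using sep[OF N2(1), of w] wN2 wc N2(2) L(2) by blast
    have LK2: "L \<subseteq> K2" using K2 N2 by blast
    have "M1 \<noteq> M2"
    proof
      assume "M1 = M2"
      then have "u \<in> K2" using M2 ab by (auto simp: centr_def u_def)
      moreover have "u \<otimes> w \<in> K2" using K2 N2 by blast
      ultimately have "inv u \<otimes> (u \<otimes> w) \<in> K2"
        using normal_imp_subgroup[OF K2(1)] by (simp add: subgroup.m_closed subgroup.m_inv_closed)
      then show False using K2(3) uc wc by (simp add: l_inv_cancel)
    qed
    have CL: "centr L (carrier G) \<lhd> G" by (rule centr_carrier_normal[OF L(1)])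
    have le: "M \<subseteq> centr (centr L (carrier G)) gam2"
      if M: "max_sub M" "M \<subseteq> centr K M" and K: "K \<lhd> G" "L \<subseteq> K" "w \<notin> K" for M K
    proof
      fix g assume g: "g \<in> M"
      have gc: "g \<in> carrier G" using g max_subD(6)[OF M(1)] by blast
      have "cmt g d \<in> centr L (carrier G)" if d: "d \<in> gam2" for d
      proof -
        have dc: "d \<in> carrier G" using d gam_subset by blast
        have "cmt g d \<in> K" using M g d max_subD(2)[OF M(1)] by (auto simp: centr_def)
        moreover have "cmt g d \<in> gam3"
          using bracket_mem[OF d gc] cmt_swap_mem[OF gam_subgroup(2) gc dc] by (simp add: gam3_def)
        ultimately show ?thesis using central[OF K] by blast
      qed
      then show "g \<in> centr (centr L (carrier G)) gam2" using gc by (auto simp: centr_def[of "centr L (carrier G)"])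
    qed
    have "centr (centr L (carrier G)) gam2 = carrier G"
      using max_sub_two[OF M1(1) M2(1) \<open>M1 \<noteq> M2\<close> centr_subgroup[OF CL gam_subset(1)]]
        le[OF M1 K1] le[OF M2 K2(1) LK2 K2(3)] by blast
    then have "gam2 \<subseteq> centr (centr L (carrier G)) (carrier G)"
      using centr_swap[OF normal_imp_subgroup[OF CL] gam_subset(1) subset_refl] by simp
    then have "gam3 \<subseteq> centr L (carrier G)" using gam3_centr_iff[OF CL] by blast
    then have "gam4 \<subseteq> L" using gam4_centr_iff[OF L(1)] by blast
    then show False using w by blast
  qed
  then show ?thesis by blast
qed

end

section \<open>The commutator form on a maximal subgroup\<close>

text \<open>The formula for the \<open>n\<close>-th difference of a sequence, written multiplicatively: row \<open>i\<close> of \<open>g\<close> is the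
  \<open>i\<close>-th difference of row \<open>0\<close>.\<close>
lemma iterated_quotient:
  fixes g :: "nat \<Rightarrow> nat \<Rightarrow> complex"
  assumes ne: "\<And>i j. g i j \<noteq> 0" and step: "\<And>i j. g (Suc i) j * g i j = g i (Suc j)"
  shows "g n j = (\<Prod>l\<le>n. g 0 (j + l) powi ((-1) ^ (n + l) * int (n choose l)))"
proof (induction n arbitrary: j)
  case 0
  show ?case by simp
next
  case (Suc n)
  define s where "s = (\<lambda>n l. (-1) ^ (n + l) * int (n choose l))"
  define f where "f = (\<lambda>l. g 0 (j + l))"
  have f: "f l \<noteq> 0" for l by (simp add: f_def ne)
  have s0: "s (Suc n) 0 = - s n 0" by (simp add: s_def)
  have sS: "s (Suc n) (Suc l) = s n l - s n (Suc l)" for l by (simp add: s_def algebra_simps)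
  have "g (Suc n) j = g n (Suc j) / g n j" using step[of n j] ne[of n j] by (simp add: field_simps)
  also have "g n (Suc j) = (\<Prod>l\<le>n. f (Suc l) powi s n l)"
    using Suc.IH[of "Suc j"] by (simp add: f_def s_def)
  also have "g n j = (\<Prod>l\<le>Suc n. f l powi s n l)"
    using Suc.IH[of j] by (simp add: f_def s_def binomial_eq_0)
  also have "\<dots> = f 0 powi s n 0 * (\<Prod>l\<le>n. f (Suc l) powi s n (Suc l))"
    by (rule prod.atMost_Suc_shift)
  also have "(\<Prod>l\<le>n. f (Suc l) powi s n l) / (f 0 powi s n 0 * (\<Prod>l\<le>n. f (Suc l) powi s n (Suc l)))
     = f 0 powi s (Suc n) 0 * (\<Prod>l\<le>n. f (Suc l) powi s (Suc n) (Suc l))"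
    using f by (simp add: s0 sS power_int_minus power_int_diff prod_dividef field_simps)
  also have "\<dots> = (\<Prod>l\<le>Suc n. f l powi s (Suc n) l)"
    by (rule prod.atMost_Suc_shift[symmetric])
  finally show ?case by (simp only: f_def s_def)
qed

text \<open>Since \<open>p\<close> divides the inner binomial coefficients, the \<open>p\<close>-th difference operator is
  \<open>(E - 1)\<^sup>p = E\<^sup>p - 1\<close> on \<open>p\<close>-torsion, where \<open>E\<close> is the shift.\<close>
lemma prime_fold_quotient_of_periodic:
  fixes g :: "nat \<Rightarrow> nat \<Rightarrow> complex"
  assumes ne: "\<And>i j. g i j \<noteq> 0" and step: "\<And>i j. g (Suc i) j * g i j = g i (Suc j)"
    and p: "prime p" "odd p" and tors: "\<And>j. g 0 j ^ p = 1" and per: "g 0 p = g 0 0"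
  shows "g p 0 = 1"
proof -
  let ?t = "\<lambda>l. g 0 l powi ((-1) ^ (p + l) * int (p choose l))"
  have p0: "p > 0" using p prime_gt_0_nat by blast
  have mid: "?t l = 1" if "l \<in> {..p} - {0, p}" for l
  proof -
    have "p dvd p choose l" using that p by (intro dvd_choose_prime) auto
    then obtain c where "p choose l = p * c" by (auto simp: dvd_def)
    then have "?t l = (g 0 l powi int p) powi ((-1) ^ (p + l) * int c)"
      by (simp only: power_int_mult[symmetric]) (simp add: algebra_simps)
    then show ?thesis using tors by simp
  qed
  have "g p 0 = (\<Prod>l\<le>p. ?t l)" using iterated_quotient[of g, OF ne step, of p 0] by simp
  also have "\<dots> = (\<Prod>l\<in>{0, p}. ?t l)" by (rule prod.mono_neutral_right) (use mid in auto)
  also have "\<dots> = ?t 0 * ?t p" using p0 by simp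
  also have "\<dots> = 1" using p ne by (simp add: per power_int_minus)
  finally show ?thesis .
qed

text \<open>The scalars by which \<open>Z\<close> acts in an irreducible representation with kernel \<open>K\<close>.\<close>
locale central_character = p_group_abelianization_square +
  fixes Z K :: "'a set" and \<chi> :: "'a \<Rightarrow> complex"
  assumes Z: "Z \<lhd> G" and K: "K \<lhd> G" and KZ: "K \<subseteq> Z" and Z_central: "Z \<subseteq> centr K (carrier G)"
    and chr_mult: "\<And>z w. z \<in> Z \<Longrightarrow> w \<in> Z \<Longrightarrow> \<chi> (z \<otimes> w) = \<chi> z * \<chi> w"
    and chr_ne: "\<And>z. z \<in> Z \<Longrightarrow> \<chi> z \<noteq> 0"
    and chr_pow: "\<And>z. z \<in> Z \<Longrightarrow> \<chi> z ^ p = 1"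
    and chr_kernel: "\<And>z. z \<in> Z \<Longrightarrow> \<chi> z = 1 \<longleftrightarrow> z \<in> K"
begin

lemma Zs: "subgroup Z G" and Ks: "subgroup K G"
  using Z K normal_imp_subgroup by auto

lemma Zc: "z \<in> Z \<Longrightarrow> z \<in> carrier G" using Zs subgroup.mem_carrier by metis

lemma chr_conj:
  assumes z: "z \<in> Z" and g: "g \<in> carrier G"
  shows "g \<otimes> z \<otimes> inv g \<in> Z" "\<chi> (g \<otimes> z \<otimes> inv g) = \<chi> z"
proof -
  show "g \<otimes> z \<otimes> inv g \<in> Z" by (rule conj_in_normal(1)[OF Z z g])
  have k: "cmt g z \<in> K" using z g Z_central cmt_swap_mem[OF Ks g Zc[OF z]] by (auto simp: centr_def)
  then have "\<chi> (cmt g z \<otimes> z) = \<chi> z" using chr_mult[of "cmt g z" z] chr_kernel[of "cmt g z"] KZ z by auto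
  then show "\<chi> (g \<otimes> z \<otimes> inv g) = \<chi> z" using conj_eq_cmt_mult[OF g Zc[OF z]] by simp
qed

lemma pairing_mult_left:
  assumes "a \<in> carrier G" "b \<in> carrier G" "c \<in> carrier G" "cmt a c \<in> Z" "cmt b c \<in> Z"
  shows "cmt (a \<otimes> b) c \<in> Z" "\<chi> (cmt (a \<otimes> b) c) = \<chi> (cmt a c) * \<chi> (cmt b c)"
  using assms chr_conj[of "cmt b c" a] subgroup.m_closed[OF Zs] chr_mult by (simp_all add: cmt_mult_left)

lemma pairing_mult_right:
  assumes "a \<in> carrier G" "b \<in> carrier G" "c \<in> carrier G" "cmt a b \<in> Z" "cmt a c \<in> Z"
  shows "cmt a (b \<otimes> c) \<in> Z" "\<chi> (cmt a (b \<otimes> c)) = \<chi> (cmt a b) * \<chi> (cmt a c)"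
  using assms chr_conj[of "cmt a c" b] subgroup.m_closed[OF Zs] chr_mult by (simp_all add: cmt_mult_right)

text \<open>For \<open>u \<in> \<gamma>\<^sub>3\<close> the map \<open>g \<mapsto> \<chi>([u, g])\<close> is a homomorphism into an abelian group, so it is trivial on
  \<open>\<gamma>\<^sub>2\<close>. Hence \<open>\<gamma>\<^sub>3\<close> is central in \<open>\<gamma>\<^sub>2\<close> modulo \<open>K\<close>, and \<open>\<gamma>\<^sub>2 / \<gamma>\<^sub>3\<close> is cyclic.\<close>
lemma gam2_abelian_mod:
  assumes g4: "gam4 \<subseteq> Z"
  shows "gam2 \<subseteq> centr K gam2"
proof -
  have g32: "cmt u d \<in> K" if u: "u \<in> gam3" and d: "d \<in> gam2" for u d
  proof -
    have uc: "u \<in> carrier G" using u gam_subset by blast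
    have uZ: "cmt u g \<in> Z" if "g \<in> carrier G" for g
      using g4 bracket_mem[OF u that] by (auto simp: gam4_def)
    have "cmt g h \<in> centr K {u}" if g: "g \<in> carrier G" and h: "h \<in> carrier G" for g h
    proof -
      have gh: "g \<otimes> h = cmt g h \<otimes> (h \<otimes> g)" by (rule mult_eq_cmt_mult[OF g h])
      have "\<chi> (cmt u g) * \<chi> (cmt u h) = \<chi> (cmt u (g \<otimes> h))"
        using pairing_mult_right(2)[OF uc g h] uZ g h by simp
      also have "\<dots> = \<chi> (cmt u (cmt g h)) * \<chi> (cmt u (h \<otimes> g))"
        unfolding gh using pairing_mult_right(2)[OF uc] uZ g h by simp
      also have "\<chi> (cmt u (h \<otimes> g)) = \<chi> (cmt u h) * \<chi> (cmt u g)"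
        using pairing_mult_right(2)[OF uc h g] uZ g h by simp
      finally have "\<chi> (cmt u (cmt g h)) = 1" using chr_ne uZ g h by simp
      then have "cmt u (cmt g h) \<in> K" using chr_kernel uZ g h by simp
      then show ?thesis using cmt_swap_mem[OF Ks uc, of "cmt g h"] g h by (simp add: centr_def)
    qed
    then have "gam2 \<subseteq> centr K {u}"
      unfolding gam2_def using uc by (intro bracket_least centr_subgroup[OF K]) auto
    then have "cmt d u \<in> K" using d by (auto simp: centr_def)
    then show ?thesis using cmt_swap_mem[OF Ks uc, of d] d gam_subset by blast
  qed
  obtain M where M: "max_sub M" using max_sub_exists by blast
  obtain s where s: "s \<in> M" "s \<notin> gam2" using max_sub_elem[OF M] .
  obtain x where x: "x \<in> carrier G" "x \<notin> M" using max_sub_outside[OF M] .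
  have sc: "s \<in> carrier G" using max_subD(6)[OF M] s by blast
  define c where "c = cmt s x"
  have cc: "c \<in> carrier G" using sc x by (simp add: c_def)
  have gen: "gam2 \<subseteq> cyc_ext c gam3" unfolding c_def by (rule gam2_le_cyc_ext[OF M s x])
  have c2: "c \<in> gam2" using bracket_mem[OF sc x(1)] by (simp add: gam2_def c_def)
  have g3: "gam3 \<subseteq> centr K gam2" using g32 gam_subset by (auto simp: centr_def)
  then have "gam3 \<subseteq> centr K {c}" using c2 centr_mono by blast
  moreover have "c \<in> centr K {c}" using cc subgroup.one_closed[OF Ks] by (simp add: centr_def)
  ultimately have "gam2 \<subseteq> centr K {c}"
    using gen cyc_ext_le_centr[OF K, of "{c}" c gam3] cc by blast
  then have "c \<in> centr K gam2" using centr_swap[OF Ks gam_subset(1), of "{c}"] cc by blast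
  then show ?thesis using gen cyc_ext_le_centr[OF K gam_subset(1) _ g3] by blast
qed

end

locale abelian_mod_maximal = central_character +
  fixes M :: "'a set" and x s :: 'a and k :: nat
  assumes M: "max_sub M" and MZ: "M \<subseteq> centr Z M" and x: "x \<in> carrier G" "x \<notin> M"
    and s: "s \<in> M" "s \<notin> gam2" and p_eq: "p = 2 * k + 1"
begin

lemma Ms: "subgroup M G" and Mc: "a \<in> M \<Longrightarrow> a \<in> carrier G" and g2M: "gam2 \<subseteq> M"
  using max_subD[OF M] by auto

lemma MM: "a \<in> M \<Longrightarrow> b \<in> M \<Longrightarrow> cmt a b \<in> Z"
  using MZ by (auto simp: centr_def)

lemma ZM: "z \<in> Z \<Longrightarrow> a \<in> M \<Longrightarrow> \<chi> (cmt z a) = 1" "z \<in> Z \<Longrightarrow> a \<in> M \<Longrightarrow> cmt z a \<in> Z"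
  "z \<in> Z \<Longrightarrow> a \<in> M \<Longrightarrow> \<chi> (cmt a z) = 1" "z \<in> Z \<Longrightarrow> a \<in> M \<Longrightarrow> cmt a z \<in> Z"
proof -
  assume z: "z \<in> Z" and a: "a \<in> M"
  have "cmt z a \<in> K" using z a Z_central Mc by (auto simp: centr_def)
  moreover then have "cmt a z \<in> K" using cmt_swap_mem[OF Ks Zc[OF z] Mc[OF a]] by simp
  ultimately show "\<chi> (cmt z a) = 1" "cmt z a \<in> Z" "\<chi> (cmt a z) = 1" "cmt a z \<in> Z"
    using chr_kernel KZ by auto
qed

text \<open>The commutator form. It is multiplicative in both arguments because \<open>[M, M]\<close> is central modulo \<open>K\<close>.\<close>
definition \<beta> where "\<beta> a b = \<chi> (cmt a b)"

lemma \<beta>_ne: "a \<in> M \<Longrightarrow> b \<in> M \<Longrightarrow> \<beta> a b \<noteq> 0"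
  by (simp add: \<beta>_def chr_ne MM)

lemma \<beta>_left: "a \<in> M \<Longrightarrow> b \<in> M \<Longrightarrow> c \<in> M \<Longrightarrow> \<beta> (a \<otimes> b) c = \<beta> a c * \<beta> b c"
  unfolding \<beta>_def by (rule pairing_mult_left(2)) (auto simp: Mc MM)

lemma \<beta>_right: "a \<in> M \<Longrightarrow> b \<in> M \<Longrightarrow> c \<in> M \<Longrightarrow> \<beta> a (b \<otimes> c) = \<beta> a b * \<beta> a c"
  unfolding \<beta>_def by (rule pairing_mult_right(2)) (auto simp: Mc MM)

text \<open>On \<open>M / Z\<close>, written additively, \<open>tau\<close> is the action of \<open>x\<close> and \<open>D\<close> is \<open>tau - 1\<close>.\<close>
definition D where "D a = cmt x a"
definition tau where "tau a = x \<otimes> a \<otimes> inv x"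

lemma D_closed: "a \<in> M \<Longrightarrow> D a \<in> M"
  using bracket_mem[OF x(1) Mc] g2M by (auto simp: D_def gam2_def)

lemma Di_closed: "a \<in> M \<Longrightarrow> (D ^^ i) a \<in> M"
  by (induction i) (auto intro: D_closed)

lemma tau_closed: "a \<in> M \<Longrightarrow> tau a \<in> M"
  unfolding tau_def using conj_in_normal(1)[OF max_subD(5)[OF M]] x by simp

lemma tau_eq: "a \<in> M \<Longrightarrow> tau a = D a \<otimes> a"
  by (simp add: tau_def D_def conj_eq_cmt_mult x Mc)

lemma tau_D: "a \<in> M \<Longrightarrow> tau (D a) = D (tau a)"
  unfolding tau_def D_def using conj_cmt[OF x(1) x(1) Mc] x by (simp add: word_simps)

lemma tau_Di: "a \<in> M \<Longrightarrow> tau ((D ^^ i) a) = (D ^^ i) (tau a)"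
  by (induction i) (auto simp: tau_D Di_closed)

lemma \<beta>_tau: "a \<in> M \<Longrightarrow> b \<in> M \<Longrightarrow> \<beta> (tau a) (tau b) = \<beta> a b"
  unfolding \<beta>_def tau_def using conj_cmt[OF x(1) Mc Mc] chr_conj(2)[OF MM x(1)] by simp

lemma tau_mult: "a \<in> M \<Longrightarrow> b \<in> M \<Longrightarrow> tau (a \<otimes> b) = tau a \<otimes> tau b"
  by (simp add: tau_def word_simps x Mc)

text \<open>The form is invariant under \<open>tau\<close>, so the adjoint of \<open>D = tau - 1\<close> is \<open>tau\<close> inverse minus \<open>1\<close>, which is
  \<open>- D\<close> composed with \<open>tau\<close> inverse.\<close>
lemma \<beta>_D: "a \<in> M \<Longrightarrow> b \<in> M \<Longrightarrow> \<beta> (D a) (tau b) * \<beta> a (D b) = 1"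
proof -
  assume ab: "a \<in> M" "b \<in> M"
  note cl = ab D_closed tau_closed \<beta>_ne
  have "\<beta> a b = \<beta> (D a \<otimes> a) (tau b)" using \<beta>_tau[OF ab] tau_eq[OF ab(1)] by simp
  also have "\<dots> = \<beta> (D a) (tau b) * \<beta> a (tau b)" by (simp add: \<beta>_left cl)
  also have "\<beta> a (tau b) = \<beta> a (D b) * \<beta> a b" by (simp add: tau_eq \<beta>_right cl)
  finally show ?thesis using \<beta>_ne[OF ab] by simp
qed

lemma tau_funpow: "a \<in> M \<Longrightarrow> (tau ^^ j) a = x [^] j \<otimes> a \<otimes> inv (x [^] j)"
proof (induction j)
  case 0
  then show ?case by (simp add: Mc)
next
  case (Suc j)
  have "x [^] Suc j = x \<otimes> x [^] j" using x(1) by (rule nat_pow_Suc2)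
  then show ?case using Suc x Mc[OF Suc.prems] by (simp add: tau_def word_simps del: nat_pow_Suc)
qed

lemma tau_funpow_closed: "a \<in> M \<Longrightarrow> (tau ^^ j) a \<in> M"
  by (induction j) (auto intro: tau_closed)

lemma tau_funpow_mult: "a \<in> M \<Longrightarrow> b \<in> M \<Longrightarrow> (tau ^^ j) (a \<otimes> b) = (tau ^^ j) a \<otimes> (tau ^^ j) b"
  by (induction j) (auto simp: tau_mult tau_funpow_closed)

lemma xp: "x [^] p \<in> M"
  by (rule power_p_mem_of_index_p[OF max_subD(5)[OF M] subgroup_self])
    (use max_subD(3,6)[OF M] x in auto)

lemma sp: "s [^] p \<in> gam2"
  by (rule power_p_mem_of_index_p[OF gam_normal(1) Ms g2M max_subD(4)[OF M] s(1)])

text \<open>As \<open>x\<^sup>p \<in> M\<close> acts trivially on \<open>M / Z\<close>, the sequence \<open>j \<mapsto> \<beta> a (tau\<^sup>j b)\<close> is \<open>p\<close>-periodic.\<close>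
lemma \<beta>_Dp: 
  assumes a: "a \<in> M" and b: "b \<in> M"
  shows "\<beta> a ((D ^^ p) b) = 1"
proof -
  define g where "g i j = \<beta> a ((tau ^^ j) ((D ^^ i) b))" for i j
  have cl: "(tau ^^ j) ((D ^^ i) b) \<in> M" for i j using b by (simp add: Di_closed tau_funpow_closed)
  have "g p 0 = 1"
  proof (rule prime_fold_quotient_of_periodic)
    show "g i j \<noteq> 0" for i j using \<beta>_ne[OF a cl] by (simp add: g_def)
    show "g (Suc i) j * g i j = g i (Suc j)" for i j
    proof -
      have "(tau ^^ Suc j) ((D ^^ i) b) = (tau ^^ j) (D ((D ^^ i) b) \<otimes> (D ^^ i) b)"
        using b by (simp add: funpow_swap1 tau_eq Di_closed)
      also have "\<dots> = (tau ^^ j) ((D ^^ Suc i) b) \<otimes> (tau ^^ j) ((D ^^ i) b)"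
        using b by (simp add: tau_funpow_mult Di_closed D_closed)
      finally show ?thesis using \<beta>_right[OF a cl cl, of j "Suc i" j i] unfolding g_def by argo
    qed
    show "prime p" by (rule prime_p)
    show "odd p" by (simp add: p_eq)
    show "g 0 j ^ p = 1" for j unfolding g_def \<beta>_def by (rule chr_pow) (use a cl[of j 0] MM in auto)
    have "(tau ^^ p) b = cmt (x [^] p) b \<otimes> b"
      using b x by (simp add: tau_funpow conj_eq_cmt_mult Mc)
    moreover have "cmt (x [^] p) b \<in> Z" using xp b MM by simp
    ultimately show "g 0 p = g 0 0" unfolding g_def \<beta>_def
      using pairing_mult_right(2)[of a "cmt (x [^] p) b" b] ZM[of "cmt (x [^] p) b" a] a b MM Mc x by simp
  qed
  then show ?thesis by (simp add: g_def)
qed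

text \<open>Move the powers of \<open>D\<close> from the first argument to the second one by one.\<close>
lemma \<beta>_Dij: "i + j = p \<Longrightarrow> a \<in> M \<Longrightarrow> b \<in> M \<Longrightarrow> \<beta> ((D ^^ i) a) ((D ^^ j) b) = 1"
proof (induction i arbitrary: j a b)
  case 0
  then show ?case by (simp add: \<beta>_Dp)
next
  case (Suc i)
  define b' where "b' = inv x \<otimes> b \<otimes> x"
  have b': "b' \<in> M" unfolding b'_def using conj_in_normal(2)[OF max_subD(5)[OF M]] Suc.prems x by blast
  have "b = tau b'" using Suc.prems x by (simp add: b'_def tau_def word_simps Mc)
  then have "(D ^^ j) b = tau ((D ^^ j) b')" using tau_Di[OF b'] by simp
  moreover have "\<beta> ((D ^^ i) a) (D ((D ^^ j) b')) = 1"
    using Suc.IH[of "Suc j" a b'] Suc.prems b' by simp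
  ultimately show ?case
    using \<beta>_D[of "(D ^^ i) a" "(D ^^ j) b'"] Suc.prems b' by (simp add: Di_closed)
qed


interpretation QZ: group "G Mod Z"
  using Z by (rule normal.factorgroup_is_group)

interpretation hZ: group_hom G "G Mod Z" "(#>) Z"
  by (rule quotient_hom[OF Z])

definition eqZ where "eqZ a b \<longleftrightarrow> Z #> a = Z #> b"

lemma eqZ_mult: "a \<in> M \<Longrightarrow> b \<in> M \<Longrightarrow> a' \<in> M \<Longrightarrow> b' \<in> M \<Longrightarrow> eqZ a a' \<Longrightarrow> eqZ b b' \<Longrightarrow> eqZ (a \<otimes> b) (a' \<otimes> b')"
  unfolding eqZ_def using hZ.hom_mult Mc by presburger

lemma eqZ_trans: "eqZ a b \<Longrightarrow> eqZ b c \<Longrightarrow> eqZ a c" and eqZ_sym: "eqZ a b \<Longrightarrow> eqZ b a" and eqZ_refl: "eqZ a a"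
  by (simp_all add: eqZ_def)

lemma eqZ_D: assumes "a \<in> M" "b \<in> M" "eqZ a b" shows "eqZ (D a) (D b)"
proof -
  have 1: "Z #> D c = ((Z #> x) \<otimes>\<^bsub>G Mod Z\<^esub> (Z #> c)) \<otimes>\<^bsub>G Mod Z\<^esub> inv\<^bsub>G Mod Z\<^esub> (Z #> x) \<otimes>\<^bsub>G Mod Z\<^esub> inv\<^bsub>G Mod Z\<^esub> (Z #> c)"
    if "c \<in> M" for c
  proof -
    have cc: "c \<in> carrier G" using that Mc by blast
    show ?thesis unfolding D_def cmt_def
      using hZ.hom_mult[of "x \<otimes> c \<otimes> inv x" "inv c"] hZ.hom_mult[of "x \<otimes> c" "inv x"] hZ.hom_mult[of x c]
        hZ.hom_inv[of x] hZ.hom_inv[of c] x cc by (metis inv_closed m_closed)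
  qed
  show ?thesis using 1[OF assms(1)] 1[OF assms(2)] assms(3) unfolding eqZ_def by argo
qed

lemma eqZ_iff: assumes a: "a \<in> carrier G" and b: "b \<in> carrier G" shows "eqZ a b \<longleftrightarrow> (\<exists>z\<in>Z. a = z \<otimes> b)"
proof
  assume "eqZ a b"
  then have "a \<in> Z #> b" using rcos_self[OF a Zs] by (simp add: eqZ_def)
  then show "\<exists>z\<in>Z. a = z \<otimes> b" by (auto simp: r_coset_def)
next
  assume "\<exists>z\<in>Z. a = z \<otimes> b"
  then obtain z where z: "z \<in> Z" "a = z \<otimes> b" by blast
  then have "a \<in> Z #> b" by (auto simp: r_coset_def)
  then show "eqZ a b" using repr_independence[OF _ b Zs] by (simp add: eqZ_def)
qed

lemma D_mult: assumes "a \<in> M" "b \<in> M" shows "eqZ (D (a \<otimes> b)) (D a \<otimes> D b)"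
proof -
  have cl: "a \<in> carrier G" "b \<in> carrier G" "D a \<in> M" "D b \<in> M" "D a \<in> carrier G" "D b \<in> carrier G"
    using assms Mc D_closed by auto
  have "D (a \<otimes> b) = D a \<otimes> (cmt a (D b) \<otimes> D b)"
    using cmt_mult_right[OF x(1) cl(1,2)] conj_eq_cmt_mult[OF cl(1,6)] by (simp add: D_def)
  also have "\<dots> = (D a \<otimes> cmt a (D b) \<otimes> inv (D a)) \<otimes> (D a \<otimes> D b)" using cl by (simp add: word_simps)
  finally have 1: "D (a \<otimes> b) = (D a \<otimes> cmt a (D b) \<otimes> inv (D a)) \<otimes> (D a \<otimes> D b)" .
  have "D a \<otimes> cmt a (D b) \<otimes> inv (D a) \<in> Z" using chr_conj(1)[OF MM cl(5)] assms cl by blast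
  moreover have "D (a \<otimes> b) \<in> carrier G" using x cl by (simp add: D_def)
  ultimately show ?thesis using 1 eqZ_iff cl by blast
qed

lemma M_mult: "a \<in> M \<Longrightarrow> b \<in> M \<Longrightarrow> a \<otimes> b \<in> M" using subgroup.m_closed[OF Ms] .

lemma eqZ_Di: "a \<in> M \<Longrightarrow> b \<in> M \<Longrightarrow> eqZ a b \<Longrightarrow> eqZ ((D ^^ i) a) ((D ^^ i) b)"
  by (induction i) (auto intro: eqZ_D Di_closed)

lemma Di_mult: "a \<in> M \<Longrightarrow> b \<in> M \<Longrightarrow> eqZ ((D ^^ i) (a \<otimes> b)) ((D ^^ i) a \<otimes> (D ^^ i) b)"
proof (induction i)
  case 0
  then show ?case by (simp add: eqZ_refl)
next
  case (Suc i)
  have "eqZ (D ((D ^^ i) (a \<otimes> b))) (D ((D ^^ i) a \<otimes> (D ^^ i) b))"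
    using Suc by (intro eqZ_D Di_closed M_mult) auto
  moreover have "eqZ (D ((D ^^ i) a \<otimes> (D ^^ i) b)) (D ((D ^^ i) a) \<otimes> D ((D ^^ i) b))"
    using Suc by (intro D_mult Di_closed) auto
  ultimately show ?case unfolding funpow.simps o_apply by (rule eqZ_trans)
qed

lemma Di_int_pow:
  assumes a: "a \<in> M"
  shows "eqZ ((D ^^ i) (a [^] (n::int))) (((D ^^ i) a) [^] n)"
proof -
  interpret T: group "G\<lparr>carrier := M\<rparr>" using Ms subgroup_imp_group by blast
  have "(\<lambda>a. Z #> (D ^^ i) a) \<in> hom (G\<lparr>carrier := M\<rparr>) (G Mod Z)"
  proof (rule homI)
    fix a b assume ab: "a \<in> carrier (G\<lparr>carrier := M\<rparr>)" "b \<in> carrier (G\<lparr>carrier := M\<rparr>)"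
    then show "Z #> (D ^^ i) a \<in> carrier (G Mod Z)" using hZ.hom_closed Mc Di_closed by auto
    have "Z #> (D ^^ i) (a \<otimes> b) = Z #> ((D ^^ i) a \<otimes> (D ^^ i) b)"
      using Di_mult ab by (simp add: eqZ_def)
    then show "Z #> (D ^^ i) (a \<otimes>\<^bsub>G\<lparr>carrier := M\<rparr>\<^esub> b) = (Z #> (D ^^ i) a) \<otimes>\<^bsub>G Mod Z\<^esub> (Z #> (D ^^ i) b)"
      using hZ.hom_mult[of "(D ^^ i) a" "(D ^^ i) b"] ab Mc Di_closed by simp
  qed
  then interpret h: group_hom "G\<lparr>carrier := M\<rparr>" "G Mod Z" "\<lambda>a. Z #> (D ^^ i) a"
    by (intro group_hom.intro T.is_group QZ.is_group group_hom_axioms.intro)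
  have "Z #> (D ^^ i) (a [^] n) = (Z #> (D ^^ i) a) [^]\<^bsub>G Mod Z\<^esub> n"
    using h.hom_int_pow[of a n] a int_pow_consistent[OF Ms a] by simp
  also have "\<dots> = Z #> ((D ^^ i) a) [^] n"
    using hZ.hom_int_pow[of "(D ^^ i) a" n] Di_closed[OF a] Mc by simp
  finally show ?thesis by (simp add: eqZ_def)
qed

text \<open>The preimage in \<open>M\<close> of the image of the \<open>i\<close>-th power of \<open>D\<close> on \<open>M / Z\<close>.\<close>
definition layer where "layer i = {a \<in> M. \<exists>m\<in>M. eqZ a ((D ^^ i) m)}"

lemma layer_subgroup: "subgroup (layer i) G"
proof (rule finite_closed_subgroup[OF finite_carrier])
  show "layer i \<subseteq> carrier G" using Mc by (auto simp: layer_def)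
  have "(D ^^ i) s \<in> layer i" using s Di_closed eqZ_refl by (auto simp: layer_def)
  then show "layer i \<noteq> {}" by blast
  fix a b assume "a \<in> layer i" "b \<in> layer i"
  then obtain m n where mn: "a \<in> M" "b \<in> M" "m \<in> M" "n \<in> M" "eqZ a ((D ^^ i) m)" "eqZ b ((D ^^ i) n)"
    by (auto simp: layer_def)
  then have "eqZ (a \<otimes> b) ((D ^^ i) (m \<otimes> n))"
    using eqZ_mult[of a b "(D ^^ i) m" "(D ^^ i) n"] Di_mult[of m n i] eqZ_trans eqZ_sym Di_closed by blast
  then show "a \<otimes> b \<in> layer i" using mn M_mult by (auto simp: layer_def)
qed

lemma Di_layer: "a \<in> M \<Longrightarrow> (D ^^ i) a \<in> layer i"
  using Di_closed eqZ_refl by (auto simp: layer_def)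

lemma Z_layer: "z \<in> Z \<Longrightarrow> z \<in> M \<Longrightarrow> z \<in> layer i"
proof -
  assume z: "z \<in> Z" "z \<in> M"
  have 1: "(D ^^ i) \<one> = \<one>" using x by (induction i) (auto simp: D_def)
  have "eqZ z \<one>" using eqZ_iff[OF Zc one_closed] z Zc by auto
  then show "z \<in> layer i" using z 1 subgroup.one_closed[OF Ms] by (auto simp: layer_def intro!: bexI[of _ \<one>])
qed

text \<open>Modulo \<open>D(M)Z\<close> the element \<open>x\<close> centralizes \<open>M\<close>, and \<open>M\<close> is abelian, so the quotient is abelian.\<close>
lemma gam2_layer: "gam2 \<subseteq> layer 1"
proof -
  let ?A = "layer 1"
  have A: "subgroup ?A G" by (rule layer_subgroup)
  have AM: "?A \<subseteq> M" by (auto simp: layer_def)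
  let ?T = "{g \<in> carrier G. \<forall>a\<in>M. cmt g a \<in> ?A}"
  have "subgroup ?T G"
  proof (rule finite_closed_subgroup[OF finite_carrier])
    have "\<one> \<in> ?T" using subgroup.one_closed[OF A] Mc by (auto simp: cmt_def)
    then show "?T \<noteq> {}" by blast
    fix g h assume gh: "g \<in> ?T" "h \<in> ?T"
    have "cmt (g \<otimes> h) a \<in> ?A" if a: "a \<in> M" for a
    proof -
      have "cmt (g \<otimes> h) a = g \<otimes> cmt h a \<otimes> inv g \<otimes> cmt g a"
        using gh a Mc by (simp add: cmt_mult_left)
      also have "g \<otimes> cmt h a \<otimes> inv g = cmt g (cmt h a) \<otimes> cmt h a"
        using gh a Mc by (intro conj_eq_cmt_mult) auto
      finally show ?thesis using gh a AM A by (auto intro!: subgroup.m_closed)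
    qed
    then show "g \<otimes> h \<in> ?T" using gh by auto
  qed auto
  moreover have "M \<subseteq> ?T" using MM Mc M_mult subgroup.m_inv_closed[OF Ms] Z_layer
    by (auto simp: cmt_def)
  moreover have "x \<in> ?T" using x Di_layer[of _ 1] by (auto simp: D_def)
  ultimately have T: "?T = carrier G" using max_sub_maximal[OF M] x by blast
  have An: "?A \<lhd> G"
  proof (rule normal_invI[OF A])
    fix g a assume g: "g \<in> carrier G" and a: "a \<in> ?A"
    have "cmt g a \<in> ?A" using g a T AM by blast
    then show "g \<otimes> a \<otimes> inv g \<in> ?A"
      using conj_eq_cmt_mult[OF g, of a] a AM Mc subgroup.m_closed[OF A] by auto
  qed
  have "carrier G \<subseteq> centr ?A M" using T by (auto simp: centr_def)
  then have MA: "M \<subseteq> centr ?A (carrier G)" using centr_swap[OF A subset_refl max_subD(6)[OF M]] by blast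
  have "M \<subseteq> centr ?A {x}" using MA centr_mono[of ?A ?A "{x}" "carrier G"] x by blast
  moreover have "x \<in> centr ?A {x}" using x subgroup.one_closed[OF A] by (auto simp: centr_def)
  ultimately have "centr ?A {x} = carrier G"
    using max_sub_maximal[OF M centr_subgroup[OF An]] x by blast
  then have "x \<in> centr ?A (carrier G)" using centr_swap[OF A subset_refl, of "{x}"] x by auto
  then have "centr ?A (carrier G) = carrier G"
    using max_sub_maximal[OF M centr_subgroup[OF An subset_refl]] MA x by blast
  then show ?thesis using gam2_centr_iff[OF An] by simp
qed

text \<open>As \<open>M = \<langle>s\<rangle>\<gamma>\<^sub>2\<close> and \<open>\<gamma>\<^sub>2\<close> lies in the first layer, each layer is generated by one element and the next
  layer.\<close>
lemma Di_decompose: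
  assumes r: "r \<in> M"
  obtains i :: int and n where "n \<in> M" "eqZ ((D ^^ l) r) (((D ^^ l) s) [^] i \<otimes> (D ^^ Suc l) n)"
proof -
  have "r \<in> cyc_ext s gam2" using max_sub_eq_cyc_ext[OF M s] r by simp
  then obtain i d where id: "r = s [^] (i::int) \<otimes> d" "d \<in> gam2" by (auto simp: cyc_ext_def)
  then obtain n where n: "n \<in> M" "eqZ d (D n)" "d \<in> M" using gam2_layer by (auto simp: layer_def)
  have si: "s [^] i \<in> M" using s Ms subgroup_int_pow_closed by blast
  have pi: "((D ^^ l) s) [^] i \<in> M" using Di_closed s Ms subgroup_int_pow_closed by blast
  have "eqZ ((D ^^ l) r) ((D ^^ l) (s [^] i) \<otimes> (D ^^ l) d)" using Di_mult[OF si n(3)] id by simp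
  moreover have "eqZ ((D ^^ l) (s [^] i) \<otimes> (D ^^ l) d) (((D ^^ l) s) [^] i \<otimes> (D ^^ l) (D n))"
    by (intro eqZ_mult Di_int_pow eqZ_Di Di_closed D_closed si pi n s)
  ultimately have "eqZ ((D ^^ l) r) (((D ^^ l) s) [^] i \<otimes> (D ^^ Suc l) n)"
    using eqZ_trans by (simp add: funpow_swap1)
  then show thesis using that n by blast
qed

lemma card_layer: "card (layer l) \<le> p * card (layer (Suc l))"
proof -
  define y where "y = (D ^^ l) s"
  have y: "y \<in> M" using s Di_closed by (simp add: y_def)
  let ?A = "layer (Suc l)"
  have "layer l \<subseteq> cyc_ext y ?A"
  proof
    fix a assume "a \<in> layer l"
    then obtain m where m: "a \<in> M" "m \<in> M" "eqZ a ((D ^^ l) m)" by (auto simp: layer_def)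
    obtain i :: int and n where n: "n \<in> M" "eqZ ((D ^^ l) m) (y [^] i \<otimes> (D ^^ Suc l) n)"
      using Di_decompose[OF m(2)] y_def by blast
    have yi0: "y [^] i \<in> M" by (rule subgroup_int_pow_closed[OF Ms y])
    have yi: "y [^] i \<in> M" "inv (y [^] i) \<in> M" using yi0 subgroup.m_inv_closed[OF Ms yi0] by auto
    define b where "b = inv (y [^] i) \<otimes> a"
    have b: "b \<in> M" using yi m M_mult by (simp add: b_def)
    have "eqZ b (inv (y [^] i) \<otimes> (y [^] i \<otimes> (D ^^ Suc l) n))"
      unfolding b_def using yi m n Di_closed M_mult eqZ_trans
      by (intro eqZ_mult eqZ_refl) blast+
    also have "inv (y [^] i) \<otimes> (y [^] i \<otimes> (D ^^ Suc l) n) = (D ^^ Suc l) n"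
      using yi n Di_closed[of n "Suc l"] Mc by (intro l_inv_cancel) auto
    finally have "b \<in> ?A" using b n by (auto simp: layer_def)
    moreover have "a = y [^] i \<otimes> b" unfolding b_def using yi m Mc by (simp add: r_inv_cancel)
    ultimately show "a \<in> cyc_ext y ?A" by (auto simp: cyc_ext_def)
  qed
  moreover have fin: "finite ?A" by (rule finite_sub[OF subgroup.subset[OF layer_subgroup]])
  moreover have "y [^] p \<in> ?A"
  proof -
    have "s [^] p \<in> layer 1" using sp gam2_layer by blast
    then obtain n where n: "n \<in> M" "s [^] p \<in> M" "eqZ (s [^] p) (D n)" by (auto simp: layer_def)
    have "eqZ ((D ^^ l) (s [^] p)) (y [^] p)" using Di_int_pow[OF s(1), of l "int p"] by (simp add: y_def int_pow_int)
    moreover have "eqZ ((D ^^ l) (s [^] p)) ((D ^^ l) (D n))" using n by (intro eqZ_Di D_closed)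
    ultimately have "eqZ (y [^] p) ((D ^^ Suc l) n)" using eqZ_trans eqZ_sym by (metis funpow_swap1 funpow.simps(2) o_apply)
    moreover have "y [^] p \<in> M" using y Ms subgroup_int_pow_closed by (metis int_pow_int)
    ultimately show ?thesis using n by (auto simp: layer_def)
  qed
  moreover have "finite (cyc_ext y ?A)"
  proof -
    have "?A \<subseteq> M" by (auto simp: layer_def)
    then show ?thesis using cyc_ext_least[OF Ms y, of ?A] max_subD(6)[OF M] finite_sub by blast
  qed
  ultimately show ?thesis
    using card_cyc_ext_le[OF layer_subgroup fin Mc[OF y], of p] p_gt_1 card_mono[of "cyc_ext y ?A" "layer l"] by linarith
qed

lemma layer_0: "layer 0 = M"
  using eqZ_refl by (auto simp: layer_def)

lemma card_M_le: "card M \<le> p ^ l * card (layer l)"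
proof (induction l)
  case 0
  then show ?case by (simp add: layer_0)
next
  case (Suc l)
  also have "p ^ l * card (layer l) \<le> p ^ l * (p * card (layer (Suc l)))" using card_layer by simp
  finally show ?case by (simp add: ac_simps)
qed

lemma \<beta>_eqZ: assumes "a \<in> M" "a' \<in> M" "b \<in> M" "eqZ a a'" shows "\<beta> a b = \<beta> a' b" "\<beta> b a = \<beta> b a'"
proof -
  obtain z where z: "z \<in> Z" "a = z \<otimes> a'" using assms eqZ_iff Mc by blast
  show "\<beta> a b = \<beta> a' b" unfolding \<beta>_def z(2)
    using pairing_mult_left(2)[OF Zc[OF z(1)] Mc Mc ZM(2) MM, of a' b] ZM(1) z assms by simp
  show "\<beta> b a = \<beta> b a'" unfolding \<beta>_def z(2)
    using pairing_mult_right(2)[OF Mc Zc[OF z(1)] Mc ZM(4) MM, of b a'] ZM(3) z assms by simp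
qed

text \<open>Layers \<open>k\<close> and \<open>k + 1\<close> are orthogonal since \<open>k + (k + 1) = p\<close>. What remains on layer \<open>k\<close> is an
  alternating form on the group generated by the single element \<open>y\<close>.\<close>
lemma layer_isotropic:
  assumes a: "a \<in> layer k" and b: "b \<in> layer k"
  shows "cmt a b \<in> K"
proof -
  define y where "y = (D ^^ k) s"
  have y: "y \<in> M" using s Di_closed by (simp add: y_def)
  have dec: "\<exists>(i::int) n. n \<in> M \<and> eqZ e (y [^] i \<otimes> (D ^^ Suc k) n)" if e: "e \<in> layer k" for e
  proof -
    obtain r where r: "r \<in> M" "eqZ e ((D ^^ k) r)" using e unfolding layer_def by blast
    obtain i :: int and n where n: "n \<in> M" "eqZ ((D ^^ k) r) (y [^] i \<otimes> (D ^^ Suc k) n)"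
      unfolding y_def by (rule Di_decompose[OF r(1), of k])
    show ?thesis using n(1) eqZ_trans[OF r(2) n(2)] by blast
  qed
  have ab: "a \<in> M" "b \<in> M" using a b unfolding layer_def by blast+
  obtain i :: int and n where a': "a \<in> M" "n \<in> M" "eqZ a (y [^] i \<otimes> (D ^^ Suc k) n)"
    using dec[OF a] ab by blast
  obtain j :: int and q where b': "b \<in> M" "q \<in> M" "eqZ b (y [^] j \<otimes> (D ^^ Suc k) q)"
    using dec[OF b] ab by blast
  define u where "u = (D ^^ Suc k) n"
  define v where "v = (D ^^ Suc k) q"
  have uv: "u \<in> M" "v \<in> M" using a' b' Di_closed unfolding u_def v_def by blast+
  have yp: "y [^] (t::int) \<in> M" for t using y Ms subgroup_int_pow_closed by blast
  have sp': "s [^] (t::int) \<in> M" for t using s Ms subgroup_int_pow_closed by blast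
  have pk: "k + Suc k = p" "Suc k + k = p" by (simp_all add: p_eq)
  have 1: "\<beta> (y [^] t) ((D ^^ Suc k) r) = 1" if "r \<in> M" for t :: int and r
    using \<beta>_eqZ(1)[OF Di_closed[OF sp'] yp Di_closed[OF that], of k t t "Suc k"] Di_int_pow[OF s(1), of k t]
      \<beta>_Dij[OF pk(1) sp' that] by (simp only: y_def)
  have 2: "\<beta> ((D ^^ Suc k) r) (y [^] t) = 1" if "r \<in> M" for t :: int and r
    using \<beta>_eqZ(2)[OF Di_closed[OF sp'] yp Di_closed[OF that], of k t t "Suc k"] Di_int_pow[OF s(1), of k t]
      \<beta>_Dij[OF pk(2) that sp'] by (simp only: y_def)
  have 3: "\<beta> (y [^] i) (y [^] j) = 1"
  proof -
    have "cmt (y [^] i) (y [^] j) = \<one>" unfolding cmt_def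
      using Mc[OF y] by (simp flip: int_pow_mult int_pow_neg)
    then show ?thesis using chr_kernel[OF subgroup.one_closed[OF Zs]] subgroup.one_closed[OF Ks] by (simp add: \<beta>_def)
  qed
  have 4: "\<beta> u v = 1"
    using \<beta>_Dij[OF pk(2) a'(2) D_closed[OF b'(2)]] by (simp add: u_def v_def funpow_swap1)
  have "\<beta> a b = \<beta> (y [^] i \<otimes> u) b" using \<beta>_eqZ(1)[of a _ b] a' b' uv yp M_mult by (simp add: u_def)
  also have "\<dots> = \<beta> (y [^] i \<otimes> u) (y [^] j \<otimes> v)" using \<beta>_eqZ(2)[of b _ "y [^] i \<otimes> u"] b' uv yp M_mult by (simp add: v_def)
  also have "\<dots> = 1"
    using uv yp M_mult 1[OF b'(2), of i] 2[OF a'(2), of j] 3 4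
    by (simp add: \<beta>_left \<beta>_right flip: u_def v_def del: funpow.simps)
  finally show ?thesis using chr_kernel MM a' b' by (simp add: \<beta>_def)
qed

theorem large_abelian_subgroup:
  "\<exists>B. subgroup B G \<and> card (carrier G) \<le> p ^ Suc k * card B \<and> B \<subseteq> centr K B"
proof -
  have "card (carrier G) = p * card M" using max_subD(3)[OF M] by simp
  also have "\<dots> \<le> p * (p ^ k * card (layer k))" using card_M_le by simp
  finally show ?thesis
    using layer_isotropic subgroup.subset[OF layer_subgroup] layer_subgroup
    by (intro exI[of _ "layer k"]) (auto simp: centr_def mult.assoc)
qed

end

section \<open>Two-groups whose abelianization has order four\<close>

context group
begin

text \<open>Write \<open>C = [X, Y]\<close>. Expanding \<open>[X\<^sup>2, Y]\<close> in two ways shows that the inverse of \<open>U\<close> is trivial or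
  \<open>V\<close>, and \<open>[X, Y\<^sup>2]\<close> shows that \<open>V\<close> is trivial or \<open>U\<close>. If \<open>U = V\<close> were not trivial, both squares would
  have the form \<open>C\<close> times a central element. Then so would the square of \<open>W = X Y\<close>, and
  \<open>[W\<^sup>2, Y] = [W, C]\<close> would be \<open>V\<close> on one side and trivial on the other.\<close>
lemma two_generator_squares:
  assumes X: "X \<in> carrier G" and Y: "Y \<in> carrier G"
    and C: "C = cmt X Y" and CC: "C \<otimes> C = \<one>"
    and U: "U = cmt C X" "\<And>g. g \<in> carrier G \<Longrightarrow> g \<otimes> U = U \<otimes> g"
    and V: "V = cmt C Y" "\<And>g. g \<in> carrier G \<Longrightarrow> g \<otimes> V = V \<otimes> g"
    and u: "u \<in> carrier G" "\<And>g. g \<in> carrier G \<Longrightarrow> g \<otimes> u = u \<otimes> g"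
    and v: "v \<in> carrier G" "\<And>g. g \<in> carrier G \<Longrightarrow> g \<otimes> v = v \<otimes> g"
    and XX: "X \<otimes> X = u \<or> X \<otimes> X = C \<otimes> u" and YY: "Y \<otimes> Y = v \<or> Y \<otimes> Y = C \<otimes> v"
  shows "U = \<one> \<and> V = \<one>"
proof -
  have Cc: "C \<in> carrier G" and Uc: "U \<in> carrier G" and Vc: "V \<in> carrier G" using X Y C U V by auto
  have iC: "inv C = C" using CC Cc by (metis inv_equality)
  have u1: "cmt u g = \<one>" "cmt g u = \<one>" if "g \<in> carrier G" for g
    using that u cmt_one_iff by auto
  have v1: "cmt g v = \<one>" if "g \<in> carrier G" for g
    using that v cmt_one_iff by auto
  have XC: "cmt X C = inv U" "cmt Y C = inv V" using inv_cmt X Y Cc U V by auto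
  have sq: "cmt (W \<otimes> W) Y = cmt W C" if W: "W \<in> carrier G" "cmt W Y = C" for W
  proof -
    have "cmt (W \<otimes> W) Y = W \<otimes> C \<otimes> inv W \<otimes> C" using cmt_mult_left[OF W(1) W(1) Y] W(2) by simp
    also have "\<dots> = cmt W C \<otimes> C \<otimes> C" using conj_eq_cmt_mult[OF W(1) Cc] by simp
    finally show ?thesis using W Cc CC by (simp add: m_assoc)
  qed
  have CuY: "cmt (C \<otimes> w) Y = V" if w: "w \<in> carrier G" "\<And>g. g \<in> carrier G \<Longrightarrow> g \<otimes> w = w \<otimes> g" for w
    using cmt_mult_left[OF Cc w(1) Y] cmt_one_iff[OF w(1) Y] w Y Cc V(1) Vc by simp
  have 1: "inv U = (if X \<otimes> X = u then \<one> else V)"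
    using sq[OF X C[symmetric]] XC XX CuY[OF u] u1[OF Y] by auto
  have 2: "inv V = (if Y \<otimes> Y = v then \<one> else inv U)"
  proof -
    have "cmt X (Y \<otimes> Y) = C \<otimes> (Y \<otimes> C \<otimes> inv Y)" using cmt_mult_right[OF X Y Y] C by simp
    also have "\<dots> = C \<otimes> (inv V \<otimes> C)" using conj_eq_cmt_mult[OF Y Cc] XC by simp
    also have "inv V \<otimes> C = C \<otimes> inv V" using V(2)[OF Cc] Vc Cc by (metis inv_closed inv_mult_group iC)
    finally have "cmt X (Y \<otimes> Y) = inv V" using Cc Vc CC by (simp flip: m_assoc)
    moreover have "cmt X (C \<otimes> v) = inv U"
      using cmt_mult_right[OF X Cc v(1)] v1[OF X] XC Cc Uc by simp
    ultimately show ?thesis using YY v1[OF X] by auto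
  qed
  show ?thesis
  proof (cases "X \<otimes> X = u \<or> Y \<otimes> Y = v")
    case True
    have "V = inv (inv V)" "U = inv (inv U)" using Uc Vc by auto
    then show ?thesis using 1 2 True by (metis inv_one)
  next
    case False
    then have XX': "X \<otimes> X = C \<otimes> u" and YY': "Y \<otimes> Y = C \<otimes> v" and UV: "inv U = V" "inv V = inv U"
      using XX YY 1 2 by auto
    have UVeq: "U = V" using UV Uc Vc by (metis inv_inv)
    define W where "W = X \<otimes> Y"
    have W: "W \<in> carrier G" "cmt W Y = C"
      using X Y C by (auto simp: W_def cmt_mult_left word_simps)
    have "W \<otimes> W = (X \<otimes> inv C \<otimes> inv X) \<otimes> ((X \<otimes> X) \<otimes> (Y \<otimes> Y))"
      using X Y by (simp add: W_def C cmt_def word_simps)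
    also have "X \<otimes> inv C \<otimes> inv X = V \<otimes> C" using conj_eq_cmt_mult[OF X Cc] XC UV by (simp add: iC)
    also have "V \<otimes> C \<otimes> ((X \<otimes> X) \<otimes> (Y \<otimes> Y)) = V \<otimes> C \<otimes> ((C \<otimes> u) \<otimes> (C \<otimes> v))"
      by (simp add: XX' YY')
    also have "\<dots> = V \<otimes> (C \<otimes> C) \<otimes> (u \<otimes> C) \<otimes> v"
      using Vc Cc u(1) v(1) by (simp add: m_assoc)
    also have "\<dots> = (V \<otimes> C) \<otimes> u \<otimes> v"
      unfolding CC u(2)[OF Cc, symmetric] using Vc Cc u(1) v(1) by (simp add: m_assoc)
    also have "\<dots> = C \<otimes> (V \<otimes> u \<otimes> v)"
      unfolding V(2)[OF Cc, symmetric] using Vc Cc u(1) v(1) by (simp add: m_assoc)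
    finally have WW: "W \<otimes> W = C \<otimes> (V \<otimes> u \<otimes> v)" .
    have cen: "g \<otimes> (V \<otimes> u \<otimes> v) = (V \<otimes> u \<otimes> v) \<otimes> g" if "g \<in> carrier G" for g
    proof -
      have "g \<otimes> (V \<otimes> u \<otimes> v) = (g \<otimes> V) \<otimes> u \<otimes> v" using that Vc u(1) v(1) by (simp add: m_assoc)
      also have "\<dots> = V \<otimes> (g \<otimes> u) \<otimes> v" unfolding V(2)[OF that] using that Vc u(1) v(1) by (simp add: m_assoc)
      also have "\<dots> = V \<otimes> u \<otimes> (g \<otimes> v)" unfolding u(2)[OF that] using that Vc u(1) v(1) by (simp add: m_assoc)
      also have "\<dots> = (V \<otimes> u \<otimes> v) \<otimes> g" unfolding v(2)[OF that] using that Vc u(1) v(1) by (simp add: m_assoc)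
      finally show ?thesis .
    qed
    have "V \<otimes> u \<otimes> v \<in> carrier G" using Vc u(1) v(1) by simp
    then have "V = cmt (W \<otimes> W) Y" unfolding WW by (rule CuY[symmetric, OF _ cen])
    also have "\<dots> = cmt W C" using sq[OF W] .
    also have "\<dots> = X \<otimes> inv V \<otimes> inv X \<otimes> inv U" unfolding W_def using cmt_mult_left[OF X Y Cc] XC by simp
    also have "X \<otimes> inv V \<otimes> inv X = V"
    proof -
      have "X \<otimes> inv V \<otimes> inv X = (X \<otimes> V) \<otimes> inv X" using UV by simp
      also have "\<dots> = V" unfolding V(2)[OF X] using X Vc by (simp add: m_assoc)
      finally show ?thesis .
    qed
    also have "V \<otimes> inv U = \<one>" unfolding UVeq using Vc by simp
    finally show ?thesis using UVeq by simp
  qed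
qed

end

context p_group_abelianization_square
begin

lemma triv_normal: "{\<one>} \<lhd> G"
  by (rule one_is_normal)

text \<open>Modulo a subgroup for which \<open>\<gamma>\<^sub>2\<close> is central, \<open>G\<close> would be abelian.\<close>
lemma gam2_trivial_if_cyclic:
  assumes g: "g \<in> carrier G" and gen: "carrier G \<subseteq> cyc_ext g gam2"
  shows "gam2 \<subseteq> {\<one>}"
proof (rule ccontr)
  assume "\<not> gam2 \<subseteq> {\<one>}"
  from not_subset_central_quotient[OF gam_normal(1) triv_normal this]
  obtain L where L: "L \<lhd> G" "\<not> gam2 \<subseteq> L" "gam2 \<subseteq> centr L (carrier G)" by metis
  have Ls: "subgroup L G" using L(1) by (rule normal_imp_subgroup)
  have "gam2 \<subseteq> centr L {g}" using L(3) g centr_mono[of L L "{g}" "carrier G"] by blast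
  moreover have "g \<in> centr L {g}" using g subgroup.one_closed[OF Ls] by (auto simp: centr_def)
  ultimately have "carrier G \<subseteq> centr L {g}"
    using gen cyc_ext_le_centr[OF L(1), of "{g}" g gam2] g by blast
  then have "g \<in> centr L (carrier G)" using centr_swap[OF Ls subset_refl, of "{g}"] g by blast
  then have "carrier G \<subseteq> centr L (carrier G)"
    using gen cyc_ext_le_centr[OF L(1) subset_refl _ L(3)] by blast
  then show False using L gam2_centr_iff by blast
qed

lemma max_sub_cyc_ext:
  assumes nt: "\<not> gam2 \<subseteq> {\<one>}" and g: "g \<in> carrier G" "g \<notin> gam2"
  shows "max_sub (cyc_ext g gam2)"
proof -
  let ?T = "cyc_ext g gam2"
  have T: "subgroup ?T G" by (rule cyc_ext_subgroup[OF gam_normal(1) g(1)])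
  have inc: "gam2 \<subseteq> ?T" "g \<in> ?T" using cyc_ext_incl[OF gam_subgroup(1) g(1)] by auto
  have "?T \<subset> carrier G" using gam2_trivial_if_cyclic[OF g(1)] nt subgroup.subset[OF T] by blast
  from proper_subgroup_card[OF T subgroup_self this]
  have "card ?T dvd p * card gam2" using p_gt_1 by (simp add: card_gam2 power2_eq_square mult.assoc)
  moreover have "gam2 \<subset> ?T" using inc g by blast
  from proper_subgroup_card[OF gam_subgroup(1) T this] have "p * card gam2 dvd card ?T" .
  ultimately have "card ?T = p * card gam2" by (rule dvd_antisym)
  then show ?thesis using T inc by (simp add: max_sub_def card_gam2 power2_eq_square)
qed

lemma power_p_mem_gam2:
  assumes nt: "\<not> gam2 \<subseteq> {\<one>}" and g: "g \<in> carrier G"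
  shows "g [^] p \<in> gam2"
proof (cases "g \<in> gam2")
  case True
  then show ?thesis using gam_subgroup(1) by (metis int_pow_int subgroup_int_pow_closed)
next
  case False
  note T = max_subD[OF max_sub_cyc_ext[OF nt g False]]
  show ?thesis
    by (rule power_p_mem_of_index_p[OF gam_normal(1) T(1,2,4)])
      (rule cyc_ext_incl(2)[OF gam_subgroup(1) g])
qed

definition squares where "squares = generate G {d \<otimes> d | d. d \<in> gam2}"

lemma squares_normal: "squares \<lhd> G"
  unfolding squares_def
proof (rule normal_generateI)
  show "{d \<otimes> d | d. d \<in> gam2} \<subseteq> carrier G" using gam_subset by blast
  fix h g assume "h \<in> {d \<otimes> d | d. d \<in> gam2}" and g: "g \<in> carrier G"
  then obtain d where d: "d \<in> gam2" "h = d \<otimes> d" by blast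
  have dc: "d \<in> carrier G" using d gam_subset by blast
  have "g \<otimes> h \<otimes> inv g = (g \<otimes> d \<otimes> inv g) \<otimes> (g \<otimes> d \<otimes> inv g)" using d g dc by (simp add: word_simps)
  moreover have "g \<otimes> d \<otimes> inv g \<in> gam2" by (rule conj_in_normal(1)[OF gam_normal(1) d(1) g])
  ultimately show "g \<otimes> h \<otimes> inv g \<in> {d \<otimes> d | d. d \<in> gam2}" by blast
qed

lemma square_mem: "d \<in> gam2 \<Longrightarrow> d \<otimes> d \<in> squares"
  unfolding squares_def by (rule generate.incl) blast

end

text \<open>Here \<open>\<gamma>\<^sub>2\<close> turns out to be cyclic, generated by \<open>c\<close>: its Frattini quotient is generated by \<open>c\<close>
  because \<open>\<gamma>\<^sub>3\<close> consists of products of squares.\<close>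
locale two_group = p_group_abelianization_square +
  fixes M :: "'a set" and s x c :: 'a
  assumes p2: "p = 2" and nt: "\<not> gam2 \<subseteq> {\<one>}"
    and M: "max_sub M" and s: "s \<in> M" "s \<notin> gam2" and x: "x \<in> carrier G" "x \<notin> M"
    and c_def: "c = cmt s x"
begin

lemma sc: "s \<in> carrier G" and cc: "c \<in> carrier G" and c2: "c \<in> gam2"
  using max_subD(6)[OF M] s x bracket_mem[of s "carrier G" x] by (auto simp: c_def gam2_def)

lemma sq_gam2: "g \<in> carrier G \<Longrightarrow> g \<otimes> g \<in> gam2"
  using power_p_mem_gam2[OF nt] by (simp add: p2 numeral_2_eq_2)

lemma gam2_gen3: "gam2 \<subseteq> cyc_ext c gam3"
  unfolding c_def by (rule gam2_le_cyc_ext[OF M s x])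

text \<open>Otherwise there is a quotient in which \<open>\<gamma>\<^sub>3\<close> is nontrivial and central and the squares in \<open>\<gamma>\<^sub>2\<close> are
  trivial. There \<open>two_generator_squares\<close> makes \<open>c\<close> commute with \<open>s\<close> and \<open>x\<close>, so \<open>\<gamma>\<^sub>2 = \<langle>c\<rangle>\<gamma>\<^sub>3\<close> is central.\<close>
lemma gam3_squares: "gam3 \<subseteq> squares"
proof (rule ccontr)
  assume "\<not> gam3 \<subseteq> squares"
  from not_subset_central_quotient[OF gam_normal(2) squares_normal this]
  obtain L where L: "L \<lhd> G" "squares \<subseteq> L" "\<not> gam3 \<subseteq> L" "gam3 \<subseteq> centr L (carrier G)" by metis
  have Ls: "subgroup L G" using L(1) by (rule normal_imp_subgroup)
  interpret Q: group "G Mod L" using L(1) by (rule normal.factorgroup_is_group)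
  interpret h: group_hom G "G Mod L" "(#>) L"
    by (rule quotient_hom[OF L(1)])
  have hcmt: "L #> cmt a b = Q.cmt (L #> a) (L #> b)" if "a \<in> carrier G" "b \<in> carrier G" for a b
    using that h.hom_mult h.hom_inv by (metis Q.cmt_def cmt_def inv_closed m_closed)
  have one: "L #> g = \<one>\<^bsub>G Mod L\<^esub>" if "g \<in> L" for g
    using coset_join2[OF _ Ls that] subgroup.mem_carrier[OF Ls that] by simp
  have ker: "g \<in> L" if "L #> g = \<one>\<^bsub>G Mod L\<^esub>" "g \<in> carrier G" for g
    using rcos_self[OF that(2) Ls] that by simp
  have cen: "g \<otimes>\<^bsub>G Mod L\<^esub> (L #> z) = (L #> z) \<otimes>\<^bsub>G Mod L\<^esub> g"
    if z: "z \<in> gam3" and g: "g \<in> carrier (G Mod L)" for z g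
  proof -
    obtain g0 where g0: "g0 \<in> carrier G" "g = L #> g0" using g by (auto simp: carrier_FactGroup)
    have zc: "z \<in> carrier G" using z gam_subset by blast
    have "cmt z g0 \<in> L" using L(4) z g0 by (auto simp: centr_def)
    from one[OF this] have "Q.cmt (L #> z) (L #> g0) = \<one>\<^bsub>G Mod L\<^esub>"
      unfolding hcmt[OF zc g0(1)] .
    then have "(L #> z) \<otimes>\<^bsub>G Mod L\<^esub> (L #> g0) = (L #> g0) \<otimes>\<^bsub>G Mod L\<^esub> (L #> z)"
      using Q.cmt_one_iff[OF h.hom_closed[OF zc] h.hom_closed[OF g0(1)]] by blast
    then show ?thesis unfolding g0(2) by (rule sym)
  qed
  have CC: "(L #> c) \<otimes>\<^bsub>G Mod L\<^esub> (L #> c) = \<one>\<^bsub>G Mod L\<^esub>"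
    using h.hom_mult[OF cc cc] one[of "c \<otimes> c"] square_mem[OF c2] L(2) by (metis subsetD)
  have gsq: "\<exists>u\<in>gam3. (L #> g) \<otimes>\<^bsub>G Mod L\<^esub> (L #> g) = L #> u
       \<or> (L #> g) \<otimes>\<^bsub>G Mod L\<^esub> (L #> g) = (L #> c) \<otimes>\<^bsub>G Mod L\<^esub> (L #> u)" if g: "g \<in> carrier G" for g
  proof -
    have "g \<otimes> g \<in> cyc_ext c gam3" using gam2_gen3 sq_gam2[OF g] by blast
    then obtain i u where u: "g \<otimes> g = c [^] (i::int) \<otimes> u" "u \<in> gam3" by (auto simp: cyc_ext_def)
    have uc: "u \<in> carrier G" using u gam_subset by blast
    have C: "L #> c \<in> carrier (G Mod L)" "L #> u \<in> carrier (G Mod L)"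
      by (rule h.hom_closed[OF cc], rule h.hom_closed[OF uc])
    have e: "(L #> g) \<otimes>\<^bsub>G Mod L\<^esub> (L #> g) = (L #> c) [^]\<^bsub>G Mod L\<^esub> i \<otimes>\<^bsub>G Mod L\<^esub> (L #> u)"
      using h.hom_mult[OF g g] h.hom_mult[OF int_pow_closed[OF cc, of i] uc] h.hom_int_pow[OF cc, of i] u(1) by argo
    have C2: "(L #> c) [^]\<^bsub>G Mod L\<^esub> (2 * n :: int) = \<one>\<^bsub>G Mod L\<^esub>" for n
    proof -
      have "(L #> c) [^]\<^bsub>G Mod L\<^esub> (2 :: int) = \<one>\<^bsub>G Mod L\<^esub>"
        using CC Q.int_pow_mult[OF C(1), of 1 1] Q.int_pow_1[OF C(1)] by simp
      then show ?thesis using Q.int_pow_pow[OF C(1), of 2 n] Q.int_pow_one[of n] by argo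
    qed
    show ?thesis
    proof (cases "even i")
      case True
      then obtain n where "i = 2 * n" by blast
      then have "(L #> g) \<otimes>\<^bsub>G Mod L\<^esub> (L #> g) = L #> u" using e C2[of n] Q.l_one[OF C(2)] by argo
      then show ?thesis using u by blast
    next
      case False
      then obtain n where "i = 2 * n + 1" by (blast elim: oddE)
      then have "(L #> c) [^]\<^bsub>G Mod L\<^esub> i = L #> c"
        using Q.int_pow_mult[OF C(1), of "2 * n" 1] C2[of n] Q.l_one[OF C(1)] Q.int_pow_1[OF C(1)] by argo
      then show ?thesis using e u by metis
    qed
  qed
  obtain u where u: "u \<in> gam3" "(L #> s) \<otimes>\<^bsub>G Mod L\<^esub> (L #> s) = L #> u
       \<or> (L #> s) \<otimes>\<^bsub>G Mod L\<^esub> (L #> s) = (L #> c) \<otimes>\<^bsub>G Mod L\<^esub> (L #> u)" using gsq[OF sc] by blast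
  obtain v where v: "v \<in> gam3" "(L #> x) \<otimes>\<^bsub>G Mod L\<^esub> (L #> x) = L #> v
       \<or> (L #> x) \<otimes>\<^bsub>G Mod L\<^esub> (L #> x) = (L #> c) \<otimes>\<^bsub>G Mod L\<^esub> (L #> v)" using gsq[OF x(1)] by blast
  have g3: "cmt c g \<in> gam3" if "g \<in> carrier G" for g using bracket_mem[OF c2 that] by (simp add: gam3_def)
  have uvc: "u \<in> carrier G" "v \<in> carrier G" using u v gam_subset by auto
  have "L #> cmt c s = \<one>\<^bsub>G Mod L\<^esub> \<and> L #> cmt c x = \<one>\<^bsub>G Mod L\<^esub>"
    by (rule Q.two_generator_squares[of "L #> s" "L #> x" "L #> c" _ _ "L #> u" "L #> v",
          OF h.hom_closed[OF sc] h.hom_closed[OF x(1)] _ CC hcmt[OF cc sc] cen[OF g3[OF sc]]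
          hcmt[OF cc x(1)] cen[OF g3[OF x(1)]] h.hom_closed[OF uvc(1)] cen[OF u(1)]
          h.hom_closed[OF uvc(2)] cen[OF v(1)] u(2) v(2)])
      (unfold c_def, rule hcmt[OF sc x(1)])
  then have cL: "cmt c s \<in> L" "cmt c x \<in> L" using ker cc sc x by auto
  have cg: "cmt c d \<in> L" if d: "d \<in> gam2" for d
  proof -
    have dc: "d \<in> carrier G" using d gam_subset by blast
    have "gam3 \<subseteq> centr L {c}" using L(4) cc centr_mono[of L L "{c}" "carrier G"] by blast
    moreover have "c \<in> centr L {c}" using cc subgroup.one_closed[OF Ls] by (auto simp: centr_def)
    ultimately have "gam2 \<subseteq> centr L {c}" using gam2_gen3 cyc_ext_le_centr[OF L(1), of "{c}" c gam3] cc by blast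
    then show ?thesis using d cmt_swap_mem[OF Ls cc dc] by (auto simp: centr_def)
  qed
  have S: "subgroup (centr L {c}) G" using centr_subgroup[OF L(1)] cc by blast
  have "gam2 \<subseteq> centr L {c}"
    using cg subsetD[OF gam_subset(1)] cmt_swap_mem[OF Ls cc] by (auto simp: centr_def)
  moreover have "s \<in> centr L {c}" "x \<in> centr L {c}" using cL sc x cmt_swap_mem[OF Ls cc] by (auto simp: centr_def)
  ultimately have "centr L {c} = carrier G"
    using max_sub_maximal[OF M S] cyc_ext_least[OF S, of s gam2] max_sub_eq_cyc_ext[OF M s] x by blast
  then have "c \<in> centr L (carrier G)" using centr_swap[OF Ls subset_refl, of "{c}"] cc by blast
  then have "gam2 \<subseteq> centr L (carrier G)"
    using gam2_gen3 cyc_ext_le_centr[OF L(1) subset_refl _ L(4)] by blast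
  then show False using gam3_centr_iff[OF L(1)] L(3) by blast
qed

lemma gam2_gen_squares: "gam2 \<subseteq> cyc_ext c squares"
  using gam2_gen3 gam3_squares unfolding cyc_ext_def by blast

text \<open>Otherwise there is a quotient in which \<open>[\<gamma>\<^sub>2, \<gamma>\<^sub>2]\<close> is nontrivial, central and of exponent \<open>2\<close>. In it the
  squares of elements of \<open>\<gamma>\<^sub>2\<close> are central in \<open>\<gamma>\<^sub>2\<close>, and \<open>\<gamma>\<^sub>2\<close> is generated by them and \<open>c\<close>.\<close>
lemma gam2_abelian:
  assumes ab: "a \<in> gam2" "b \<in> gam2"
  shows "a \<otimes> b = b \<otimes> a"
proof (rule ccontr)
  assume ne: "a \<otimes> b \<noteq> b \<otimes> a"
  define dd where "dd = generate G {cmt d e | d e. d \<in> gam2 \<and> e \<in> gam2}"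
  have dd: "dd \<lhd> G"
    unfolding dd_def
  proof (rule normal_generateI)
    show "{cmt d e | d e. d \<in> gam2 \<and> e \<in> gam2} \<subseteq> carrier G" using gam_subset by blast
    fix h g assume "h \<in> {cmt d e | d e. d \<in> gam2 \<and> e \<in> gam2}" and g: "g \<in> carrier G"
    then obtain d e where de: "d \<in> gam2" "e \<in> gam2" "h = cmt d e" by blast
    then have "g \<otimes> h \<otimes> inv g = cmt (g \<otimes> d \<otimes> inv g) (g \<otimes> e \<otimes> inv g)"
      using conj_cmt[OF g] gam_subset by blast
    then show "g \<otimes> h \<otimes> inv g \<in> {cmt d e | d e. d \<in> gam2 \<and> e \<in> gam2}"
      using conj_in_normal(1)[OF gam_normal(1) _ g] de by blast
  qed
  have inc: "cmt d e \<in> dd" if "d \<in> gam2" "e \<in> gam2" for d e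
    using that unfolding dd_def by (intro generate.incl) blast
  have abc: "a \<in> carrier G" "b \<in> carrier G" using ab gam_subset by auto
  have "\<not> dd \<subseteq> {\<one>}" using inc[OF ab] ne cmt_one_iff[OF abc] by auto
  from not_subset_central_quotient[OF dd triv_normal this]
  obtain L where L: "L \<lhd> G" "\<not> dd \<subseteq> L" "dd \<subseteq> centr L (carrier G)" "\<And>z. z \<in> dd \<Longrightarrow> z [^] p \<in> L"
    by metis
  have Ls: "subgroup L G" using L(1) by (rule normal_imp_subgroup)
  have S: "subgroup (centr L gam2) G" by (rule centr_subgroup[OF L(1) gam_subset(1)])
  have "d \<otimes> d \<in> centr L gam2" if d: "d \<in> gam2" for d
  proof -
    have dc: "d \<in> carrier G" using d gam_subset by blast
    have "cmt (d \<otimes> d) e \<in> L" if e: "e \<in> gam2" for e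
    proof -
      have ec: "e \<in> carrier G" using e gam_subset by blast
      have "cmt (d \<otimes> d) e = cmt d (cmt d e) \<otimes> (cmt d e \<otimes> cmt d e)"
        unfolding cmt_mult_left[OF dc dc ec] conj_eq_cmt_mult[OF dc cmt_closed[OF dc ec]]
        using dc ec by (simp add: m_assoc)
      moreover have "cmt (cmt d e) d \<in> L" using L(3) inc[OF d e] dc by (auto simp: centr_def)
      then have "cmt d (cmt d e) \<in> L" using cmt_swap_mem[OF Ls] dc ec by blast
      moreover have "cmt d e \<otimes> cmt d e \<in> L" using L(4)[OF inc[OF d e]] dc ec by (simp add: p2 numeral_2_eq_2)
      ultimately show ?thesis using subgroup.m_closed[OF Ls] by simp
    qed
    then show ?thesis using dc by (auto simp: centr_def)
  qed
  then have sq: "squares \<subseteq> centr L gam2" unfolding squares_def by (intro generate_subgroup_incl S) blast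
  have "squares \<subseteq> centr L {c}" using sq c2 centr_mono[of L L "{c}" gam2] by blast
  moreover have "c \<in> centr L {c}" using cc subgroup.one_closed[OF Ls] by (auto simp: centr_def)
  ultimately have "gam2 \<subseteq> centr L {c}"
    using gam2_gen_squares cyc_ext_le_centr[OF L(1), of "{c}" c squares] cc by blast
  then have "c \<in> centr L gam2" using centr_swap[OF Ls gam_subset(1), of "{c}"] cc by blast
  then have "gam2 \<subseteq> centr L gam2"
    using gam2_gen_squares cyc_ext_le_centr[OF L(1) gam_subset(1) _ sq] by blast
  then have "dd \<subseteq> L" unfolding dd_def by (intro generate_subgroup_incl Ls) (auto simp: centr_def)
  then show False using L by blast
qed

lemma squares_eq: "squares \<subseteq> {d \<otimes> d | d. d \<in> gam2}"
  unfolding squares_def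
proof (rule generate_subgroup_incl[OF subset_refl])
  note g2 = subgroup.m_closed[OF gam_subgroup(1)]
  show "subgroup {d \<otimes> d | d. d \<in> gam2} G"
  proof (rule finite_closed_subgroup[OF finite_carrier])
    show "{d \<otimes> d | d. d \<in> gam2} \<subseteq> carrier G" using gam_subset by blast
    show "{d \<otimes> d | d. d \<in> gam2} \<noteq> {}" using c2 by blast
    fix a b assume "a \<in> {d \<otimes> d | d. d \<in> gam2}" "b \<in> {d \<otimes> d | d. d \<in> gam2}"
    then obtain d e where de: "d \<in> gam2" "e \<in> gam2" "a = d \<otimes> d" "b = e \<otimes> e" by blast
    have dc: "d \<in> carrier G" "e \<in> carrier G" using de gam_subset by auto
    have "a \<otimes> b = d \<otimes> (d \<otimes> e) \<otimes> e" using de dc by (simp add: m_assoc)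
    also have "d \<otimes> e = e \<otimes> d" by (rule gam2_abelian[OF de(1,2)])
    finally have "a \<otimes> b = (d \<otimes> e) \<otimes> (d \<otimes> e)" using dc by (simp add: m_assoc)
    then show "a \<otimes> b \<in> {d \<otimes> d | d. d \<in> gam2}" using g2[OF de(1,2)] by blast
  qed
qed

lemma gam2_power:
  assumes "g \<in> gam2"
  shows "\<exists>i::int. g = c [^] i"
proof -
  \<comment> \<open>Every element is a power of \<open>c\<close> times a square; iterating makes the second factor a high power.\<close>
  have "\<exists>i h. g = c [^] (i::int) \<otimes> h [^] (2 ^ k :: nat) \<and> h \<in> gam2" for k
  proof (induction k)
    case 0
    have "g = c [^] (0::int) \<otimes> g [^] (2 ^ 0 :: nat)" using assms gam_subset by auto
    then show ?case using assms by blast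
  next
    case (Suc k)
    then obtain i h where ih: "g = c [^] (i::int) \<otimes> h [^] (2 ^ k :: nat)" "h \<in> gam2" by blast
    have "h \<in> cyc_ext c squares" using ih gam2_gen_squares by blast
    then obtain j q where jq: "h = c [^] (j::int) \<otimes> q" "q \<in> squares" by (auto simp: cyc_ext_def)
    then obtain d where d: "d \<in> gam2" "q = d \<otimes> d" using squares_eq by blast
    have dc: "d \<in> carrier G" using d gam_subset by blast
    have cj: "c [^] j \<in> gam2" by (rule subgroup_int_pow_closed[OF gam_subgroup(1) c2])
    have ddg: "d \<otimes> d \<in> gam2" using d subgroup.m_closed[OF gam_subgroup(1)] by blast
    have "h [^] (2 ^ k :: nat) = (c [^] j) [^] (2 ^ k :: nat) \<otimes> (d \<otimes> d) [^] (2 ^ k :: nat)"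
      unfolding jq(1) d(2) using cc dc gam2_abelian[OF cj ddg] by (intro pow_mult_distrib) auto
    also have "(d \<otimes> d) [^] (2 ^ k :: nat) = d [^] (2 ^ Suc k :: nat)"
      using dc nat_pow_pow[OF dc, of 2 "2 ^ k"] by (simp add: numeral_2_eq_2)
    also have "(c [^] j) [^] (2 ^ k :: nat) = c [^] (j * 2 ^ k)"
      using int_pow_pow[OF cc, of j "int (2 ^ k)"] by (simp add: int_pow_int[symmetric])
    finally have "g = c [^] (i + j * 2 ^ k) \<otimes> d [^] (2 ^ Suc k :: nat)"
      using ih(1) cc dc by (simp add: int_pow_mult m_assoc)
    then show ?case using d by blast
  qed
  then obtain i h where "g = c [^] (i::int) \<otimes> h [^] (2 ^ m :: nat)" "h \<in> gam2" by blast
  moreover then have "h [^] (2 ^ m :: nat) = \<one>" using pow_order_eq_1[of h] order_eq gam_subset by (auto simp: p2)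
  ultimately show ?thesis using cc by auto
qed

text \<open>Let \<open>X\<^sup>2 = C\<^sup>i\<close>. If \<open>i\<close> is odd, \<open>C\<close> is a power of \<open>X\<^sup>2\<close>. If \<open>i\<close> is even, comparing the two values
  \<open>C\<^bsup>a+1\<^esup>\<close> and \<open>C\<^bsup>i(1-b)\<^esup>\<close> of \<open>[X\<^sup>2, Y]\<close> modulo \<open>4\<close> shows \<open>C\<^sup>2 = 1\<close>.\<close>
lemma commutes_if_1_mod_4:
  assumes X: "X \<in> carrier G" and Y: "Y \<in> carrier G" and C: "C = cmt X Y" and CG: "C \<in> carrier G"
    and gen: "\<And>g. g \<in> gam2 \<Longrightarrow> \<exists>i::int. g = C [^] i"
    and Xa: "X \<otimes> C \<otimes> inv X = C [^] (a::int)" and a: "a mod 4 = 1"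
    and Yb: "Y \<otimes> C \<otimes> inv Y = C [^] (b::int)" and b: "odd b"
  shows "X \<otimes> C = C \<otimes> X"
proof -
  obtain i :: int where i: "X \<otimes> X = C [^] i" using gen sq_gam2[OF X] by blast
  have "C [^] (a + 1) = X \<otimes> C \<otimes> inv X \<otimes> C" using CG by (simp add: int_pow_mult Xa)
  also have "\<dots> = cmt (X \<otimes> X) Y" using cmt_mult_left[OF X X Y] C by simp
  also have "\<dots> = C [^] i \<otimes> (Y \<otimes> C [^] (- i) \<otimes> inv Y)" unfolding i using CG Y by (simp add: cmt_def word_simps int_pow_neg)
  also have "Y \<otimes> C [^] (- i) \<otimes> inv Y = (Y \<otimes> C \<otimes> inv Y) [^] (- i)"
    using group_hom.hom_int_pow[of G G "\<lambda>g. Y \<otimes> g \<otimes> inv Y" C "- i"] CG Y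
    by (simp add: group_hom_def group_hom_axioms_def is_group hom_def word_simps)
  also have "\<dots> = C [^] (b * (- i))" unfolding Yb using CG by (simp add: int_pow_pow)
  also have "C [^] i \<otimes> C [^] (b * (- i)) = C [^] (i - b * i)" using CG by (simp add: int_pow_mult[symmetric])
  finally have eq: "C [^] (a + 1) = C [^] (i - b * i)" .
  have "C [^] (a + 1 - (i - b * i)) = C [^] (a + 1) \<otimes> inv (C [^] (i - b * i))" by (rule int_pow_diff[OF CG])
  then have one: "C [^] (a + 1 - (i - b * i)) = \<one>" using eq CG by simp
  show ?thesis
  proof (cases "even i")
    case True
    then obtain i' where i': "i = 2 * i'" by blast
    obtain b' where b': "b = 2 * b' + 1" using b by (blast elim: oddE)
    obtain a' where a': "a = 4 * a' + 1" using a by (metis mult_div_mod_eq)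
    have "a + 1 - (i - b * i) = 2 * (2 * a' + 1 + 2 * (b' * i'))" by (simp add: i' b' a' algebra_simps)
    then have "(C [^] (2::int)) [^] (2 * a' + 1 + 2 * (b' * i')) = \<one>"
      using one int_pow_pow[OF CG, of 2 "2 * a' + 1 + 2 * (b' * i')"] by presburger
    then have "C [^] (2::int) \<in> {\<one>} \<or> int p dvd 2 * a' + 1 + 2 * (b' * i')"
      using CG by (intro power_mem_or_prime_dvd triv_subgroup) auto
    moreover have "\<not> int p dvd 2 * a' + 1 + 2 * (b' * i')" by (simp add: p2)
    ultimately have C2: "C [^] (2::int) = \<one>" by blast
    have "C [^] a = (C [^] (2::int)) [^] (2 * a') \<otimes> C" using CG by (simp add: a' int_pow_pow int_pow_mult)
    then have "X \<otimes> C \<otimes> inv X = C" using Xa C2 CG by simp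
    then show ?thesis using X CG by (metis inv_solve_right' m_closed)
  next
    case False
    have "X \<otimes> C [^] i = C [^] i \<otimes> X" using X by (simp add: m_assoc flip: i)
    then have "C [^] i \<in> centr {\<one>} {X}" using X CG cmt_one_iff[of "C [^] i" X] by (simp add: centr_def)
    then have "C \<in> centr {\<one>} {X} \<or> int p dvd i"
      using X CG by (intro power_mem_or_prime_dvd centr_subgroup triv_normal) auto
    then have "cmt C X = \<one>" using False p2 by (auto simp: centr_def)
    then show ?thesis using cmt_one_iff X CG by auto
  qed
qed

text \<open>An even power would send the element of order two in \<open>\<langle>C\<rangle>\<close> to \<open>\<one>\<close>.\<close>
lemma odd_conj_exponent:
  assumes Y: "Y \<in> carrier G" and C: "C \<in> carrier G" "C \<noteq> \<one>" and Yb: "Y \<otimes> C \<otimes> inv Y = C [^] (b::int)"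
  shows "odd b"
proof
  assume "even b"
  then obtain b' where b': "b = 2 * b'" by blast
  obtain j :: nat where j: "C [^] j \<notin> {\<one>}" "(C [^] j) [^] p \<in> {\<one>}"
    using power_of_order_p_mod[OF triv_subgroup C(1)] C(2) by blast
  have "Y \<otimes> C [^] j \<otimes> inv Y = (Y \<otimes> C \<otimes> inv Y) [^] j"
    using group_hom.hom_nat_pow[of G G "\<lambda>g. Y \<otimes> g \<otimes> inv Y" C j] C Y
    by (simp add: group_hom_def group_hom_axioms_def is_group hom_def word_simps)
  also have "\<dots> = C [^] (int j * 2 * b')" unfolding Yb b' using C
    by (simp add: int_pow_int[symmetric] int_pow_pow ac_simps)
  also have "\<dots> = ((C [^] j) [^] p) [^] b'" using C by (simp add: p2 int_pow_int[symmetric] int_pow_pow)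
  also have "\<dots> = \<one>" using j by simp
  finally have 1: "Y \<otimes> C [^] j \<otimes> inv Y = \<one>" .
  have "C [^] j = inv Y \<otimes> (Y \<otimes> C [^] j \<otimes> inv Y) \<otimes> Y" using Y C by (simp add: word_simps)
  then have "C [^] j = \<one>" unfolding 1 using Y by simp
  then show False using j by simp
qed

text \<open>Conjugation by \<open>s\<close>, \<open>x\<close> and \<open>s x\<close> raises \<open>c\<close> to odd powers \<open>a\<close>, \<open>b\<close> and \<open>a b\<close>, and one of these is \<open>1\<close>
  modulo \<open>4\<close>. Moreover \<open>[s, x]\<close>, \<open>[x, s]\<close> and \<open>[s x, x]\<close> are \<open>c\<close>, its inverse, and \<open>c\<close> again.\<close>
lemma some_element_centralizes: "\<exists>g\<in>carrier G. g \<notin> gam2 \<and> g \<otimes> c = c \<otimes> g"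
proof (cases "c = \<one>")
  case True
  then show ?thesis using s sc by auto
next
  case False
  have conj: "\<exists>a::int. g \<otimes> c \<otimes> inv g = c [^] a" if "g \<in> carrier G" for g
    using gam2_power conj_in_normal(1)[OF gam_normal(1) c2 that] by blast
  obtain a :: int where a: "s \<otimes> c \<otimes> inv s = c [^] a" using conj[OF sc] by blast
  obtain b :: int where b: "x \<otimes> c \<otimes> inv x = c [^] b" using conj[OF x(1)] by blast
  have oa: "odd a" by (rule odd_conj_exponent[OF sc cc False a])
  have ob: "odd b" by (rule odd_conj_exponent[OF x(1) cc False b])
  have x2: "x \<notin> gam2" using x max_subD(2)[OF M] by blast
  consider "a mod 4 = 1" | "b mod 4 = 1" | "a mod 4 = 3" "b mod 4 = 3"
  proof -
    have "a mod 4 = 1 \<or> a mod 4 = 3" "b mod 4 = 1 \<or> b mod 4 = 3" using oa ob by presburger+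
    then show thesis using that by blast
  qed
  then show ?thesis
  proof cases
    case 1
    then have "s \<otimes> c = c \<otimes> s" by (intro commutes_if_1_mod_4[OF sc x(1) c_def cc gam2_power a _ b ob])
    then show ?thesis using s sc by blast
  next
    case 2
    let ?C = "inv c"
    have C: "?C = cmt x s" using inv_cmt[OF sc x(1)] by (simp add: c_def)
    have pw: "?C [^] (n::int) = inv (c [^] n)" for n using cc by (simp add: int_pow_inv)
    have "\<exists>i::int. g = ?C [^] i" if g: "g \<in> gam2" for g
    proof -
      obtain i :: int where "g = c [^] i" using gam2_power[OF g] by blast
      then have "g = ?C [^] (- i)" using cc by (simp add: int_pow_neg int_pow_inv)
      then show ?thesis by blast
    qed
    moreover have "x \<otimes> ?C \<otimes> inv x = ?C [^] b" "s \<otimes> ?C \<otimes> inv s = ?C [^] a"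
      unfolding pw a[symmetric] b[symmetric] using x sc cc by (simp_all add: word_simps)
    ultimately have "x \<otimes> ?C = ?C \<otimes> x"
      using commutes_if_1_mod_4[OF x(1) sc C _ _ _ 2 _ oa] cc by blast
    then have "inv (x \<otimes> ?C) = inv (?C \<otimes> x)" by simp
    then have "c \<otimes> inv x = inv x \<otimes> c" using x cc by (simp add: inv_mult_group)
    then have "x \<otimes> (c \<otimes> inv x) \<otimes> x = x \<otimes> (inv x \<otimes> c) \<otimes> x" by simp
    then have "x \<otimes> c = c \<otimes> x" using x cc by (simp add: word_simps)
    then show ?thesis using x x2 by blast
  next
    case 3
    let ?X = "s \<otimes> x"
    have X: "?X \<in> carrier G" using sc x by simp
    have C: "c = cmt ?X x" using sc x by (simp add: cmt_mult_left c_def word_simps cmt_def)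
    have "?X \<otimes> c \<otimes> inv ?X = s \<otimes> (x \<otimes> c \<otimes> inv x) \<otimes> inv s" using sc x cc by (simp add: word_simps)
    also have "\<dots> = s \<otimes> c [^] b \<otimes> inv s" by (simp add: b)
    also have "\<dots> = (s \<otimes> c \<otimes> inv s) [^] b"
      using group_hom.hom_int_pow[of G G "\<lambda>g. s \<otimes> g \<otimes> inv s" c b] cc sc
      by (simp add: group_hom_def group_hom_axioms_def is_group hom_def word_simps)
    also have "\<dots> = c [^] (a * b)" using cc by (simp add: a int_pow_pow)
    finally have e: "?X \<otimes> c \<otimes> inv ?X = c [^] (a * b)" .
    have "a * b mod 4 = 1" using 3 mod_mult_eq[of a 4 b] by simp
    then have "?X \<otimes> c = c \<otimes> ?X"
      by (intro commutes_if_1_mod_4[OF X x(1) C cc gam2_power e _ b ob])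
    moreover have "?X \<notin> gam2"
    proof
      assume "?X \<in> gam2"
      then have "?X \<in> M" using max_subD(2)[OF M] by blast
      then have "inv s \<otimes> ?X \<in> M" using s max_subD(1)[OF M] by (meson subgroup.m_closed subgroup.m_inv_closed)
      then show False using x sc by (simp add: l_inv_cancel)
    qed
    ultimately show ?thesis using X by blast
  qed
qed

end

context p_group_abelianization_square
begin

theorem two_group_abelian_maximal:
  assumes p2: "p = 2"
  shows "\<exists>M. max_sub M \<and> M \<subseteq> centr {\<one>} M"
proof -
  obtain M where M: "max_sub M" using max_sub_exists by blast
  show ?thesis
  proof (cases "gam2 \<subseteq> {\<one>}")
    case True
    then show ?thesis using max_sub_centr[OF M triv_normal] gam_decreasing M by blast
  next
    case False
    obtain s where s: "s \<in> M" "s \<notin> gam2" using max_sub_elem[OF M] .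
    obtain x where x: "x \<in> carrier G" "x \<notin> M" using max_sub_outside[OF M] .
    interpret two_group G p m M s x "cmt s x"
      by unfold_locales (use p2 False M s x in auto)
    obtain g where g: "g \<in> carrier G" "g \<notin> gam2" "g \<otimes> cmt s x = cmt s x \<otimes> g"
      using some_element_centralizes by blast
    let ?c = "cmt s x" and ?T = "cyc_ext g gam2"
    have T: "max_sub ?T" by (rule max_sub_cyc_ext[OF False g(1,2)])
    have S: "subgroup (centr {\<one>} {g}) G" using centr_subgroup[OF triv_normal] g by blast
    have "?c \<in> centr {\<one>} {g}" using cmt_one_iff[OF cc g(1)] g cc by (auto simp: centr_def)
    then have gg: "gam2 \<subseteq> centr {\<one>} {g}"
      using gam2_power subgroup_int_pow_closed[OF S] by blast
    have "g \<in> centr {\<one>} {g}" using g by (simp add: centr_def)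
    then have "?T \<subseteq> centr {\<one>} {g}" using cyc_ext_le_centr[OF triv_normal _ _ gg] g by blast
    then have gT: "g \<in> centr {\<one>} ?T"
      using centr_swap[OF triv_subgroup max_subD(6)[OF T], of "{g}"] g by blast
    have "gam2 \<subseteq> centr {\<one>} gam2"
      using gam2_abelian cmt_one_iff gam_subset by (auto simp: centr_def subset_iff)
    moreover have "g \<in> centr {\<one>} gam2" using gT max_subD(2)[OF T] centr_mono[of "{\<one>}" "{\<one>}" gam2 ?T] by blast
    ultimately have "?T \<subseteq> centr {\<one>} gam2"
      using cyc_ext_le_centr[OF triv_normal gam_subset(1)] by blast
    then have "gam2 \<subseteq> centr {\<one>} ?T"
      using centr_swap[OF triv_subgroup max_subD(6)[OF T] gam_subset(1)] by blast
    then have "?T \<subseteq> centr {\<one>} ?T"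
      using cyc_ext_le_centr[OF triv_normal max_subD(6)[OF T] gT] by blast
    then show ?thesis using T by blast
  qed
qed

end

section \<open>Linear actions of finite groups\<close>

lemma roots_of_unity_sum:
  fixes N j :: nat
  assumes "0 < j" "j < N"
  shows "(\<Sum>k<N. (cis (2 * pi / N)) ^ (k * j)) = 0"
proof -
  let ?z = "cis (2 * pi / N) ^ j"
  have z: "?z = cis (2 * pi * j / N)" by (simp add: DeMoivre mult.commute)
  have "?z \<noteq> 1"
  proof
    assume "?z = 1"
    then have "cos (2 * pi * j / N) = 1" unfolding z by (simp add: complex_eq_iff)
    then obtain n :: int where n: "2 * pi * j / N = of_int n * 2 * pi" using cos_one_2pi_int by blast
    then have "real j = of_int n * real N" using assms by (simp add: field_simps)
    then have "int j = n * int N" by (metis of_int_eq_iff of_int_mult of_int_of_nat_eq)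
    then have "int N dvd int j" by simp
    then show False using assms by (auto dest: dvd_imp_le)
  qed
  moreover have "?z ^ N = 1"
  proof -
    have "?z ^ N = cis (real N * (2 * pi * j / N))" unfolding z by (rule DeMoivre)
    also have "real N * (2 * pi * j / N) = 2 * pi * real j" using assms by simp
    also have "cis \<dots> = 1" by (rule cis_multiple_2pi) simp
    finally show ?thesis .
  qed
  ultimately have "(\<Sum>k<N. ?z ^ k) = 0" by (simp add: geometric_sum)
  then show ?thesis by (simp add: mult.commute flip: power_mult)
qed

text \<open>A representation on a finite-dimensional subspace \<open>V\<close> of an arbitrary complex vector space. Both
  matrix representations (acting on coordinate functions) and spaces of functions on the group are
  instances.\<close>
locale linear_action = group G + vs: vector_space scale
  for G :: "('a, 'b) monoid_scheme" (structure)
    and scale :: "complex \<Rightarrow> 'v::ab_group_add \<Rightarrow> 'v" (infixr \<open>*s\<close> 75) +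
  fixes V :: "'v set" and act :: "'a \<Rightarrow> 'v \<Rightarrow> 'v"
  assumes finite_G: "finite (carrier G)"
    and V_subspace: "vs.subspace V"
    and V_finite: "\<exists>B. finite B \<and> V \<subseteq> vs.span B"
    and act_closed: "\<And>g v. g \<in> carrier G \<Longrightarrow> v \<in> V \<Longrightarrow> act g v \<in> V"
    and act_add: "\<And>g v w. g \<in> carrier G \<Longrightarrow> v \<in> V \<Longrightarrow> w \<in> V \<Longrightarrow> act g (v + w) = act g v + act g w"
    and act_scale: "\<And>g c v. g \<in> carrier G \<Longrightarrow> v \<in> V \<Longrightarrow> act g (c *s v) = c *s act g v"
    and act_one: "\<And>v. v \<in> V \<Longrightarrow> act \<one> v = v"
    and act_mult: "\<And>g h v. g \<in> carrier G \<Longrightarrow> h \<in> carrier G \<Longrightarrow> v \<in> V \<Longrightarrow> act (g \<otimes> h) v = act g (act h v)"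
begin

lemma act_zero: "g \<in> carrier G \<Longrightarrow> act g 0 = 0"
  using act_scale[of g 0 0] vs.subspace_0[OF V_subspace] by simp

lemma act_diff: "g \<in> carrier G \<Longrightarrow> v \<in> V \<Longrightarrow> w \<in> V \<Longrightarrow> act g (v - w) = act g v - act g w"
  using act_add[of g "v - w" w] vs.subspace_diff[OF V_subspace] by (simp add: eq_diff_eq)

lemma act_sum: "g \<in> carrier G \<Longrightarrow> (\<And>i. i \<in> I \<Longrightarrow> f i \<in> V) \<Longrightarrow> act g (\<Sum>i\<in>I. f i) = (\<Sum>i\<in>I. act g (f i))"
  by (induction I rule: infinite_finite_induct)
    (auto simp: act_zero act_add vs.subspace_sum[OF V_subspace])

lemma act_inv: "g \<in> carrier G \<Longrightarrow> v \<in> V \<Longrightarrow> act (inv g) (act g v) = v" "g \<in> carrier G \<Longrightarrow> v \<in> V \<Longrightarrow> act g (act (inv g) v) = v"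
  using act_mult[of "inv g" g v] act_mult[of g "inv g" v] act_one by auto

lemma act_nonzero: "g \<in> carrier G \<Longrightarrow> v \<in> V \<Longrightarrow> v \<noteq> 0 \<Longrightarrow> act g v \<noteq> 0"
  using act_inv(1)[of g v] act_zero[of "inv g"] by force

lemma act_span:
  assumes g: "g \<in> carrier G" and S: "S \<subseteq> V" "\<And>x. x \<in> S \<Longrightarrow> act g x \<in> vs.span T" and z: "z \<in> vs.span S"
  shows "act g z \<in> vs.span T"
proof -
  have "z \<in> V \<and> act g z \<in> vs.span T"
    using z
  proof (induction rule: vs.span_induct_alt)
    case base
    then show ?case using act_zero[OF g] vs.span_zero vs.subspace_0[OF V_subspace] by simp
  next
    case (step c x y)
    have x: "x \<in> V" "c *s x \<in> V" using step S vs.subspace_scale[OF V_subspace] by auto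
    then have "act g (c *s x + y) = c *s act g x + act g y"
      using step by (simp add: act_add[OF g] act_scale[OF g])
    moreover have "c *s x + y \<in> V" using x step vs.subspace_add[OF V_subspace] by blast
    ultimately show ?case using step S vs.span_add vs.span_scale by simp
  qed
  then show ?thesis ..
qed

definition invariant :: "'v set \<Rightarrow> bool" where
  "invariant W \<longleftrightarrow> vs.subspace W \<and> W \<subseteq> V \<and> (\<forall>g\<in>carrier G. \<forall>w\<in>W. act g w \<in> W)"

definition irreducible :: bool where
  "irreducible \<longleftrightarrow> V \<noteq> {0} \<and> (\<forall>W. invariant W \<longrightarrow> W = {0} \<or> W = V)"

definition ker :: "'a set" where
  "ker = {g \<in> carrier G. \<forall>v\<in>V. act g v = v}"

lemma irreducibleD: "irreducible \<Longrightarrow> invariant W \<Longrightarrow> v \<in> W \<Longrightarrow> v \<noteq> 0 \<Longrightarrow> W = V"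
  unfolding irreducible_def by blast

lemma ker_normal: "ker \<lhd> G"
proof (rule normal_invI)
  show "subgroup ker G"
  proof (rule finite_closed_subgroup[OF finite_G])
    show "ker \<noteq> {}" using act_one unfolding ker_def by blast
  qed (auto simp: ker_def act_mult)
  fix x h assume x: "x \<in> carrier G" and h: "h \<in> ker"
  then show "x \<otimes> h \<otimes> inv x \<in> ker"
    by (auto simp: ker_def act_mult act_closed act_inv)
qed

lemma cmt_mem_ker_iff:
  assumes a: "a \<in> carrier G" and b: "b \<in> carrier G"
  shows "cmt a b \<in> ker \<longleftrightarrow> (\<forall>v\<in>V. act a (act b v) = act b (act a v))"
proof
  assume k: "cmt a b \<in> ker"
  show "\<forall>v\<in>V. act a (act b v) = act b (act a v)"
  proof
    fix v assume v: "v \<in> V"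
    have "act a (act b v) = act (cmt a b \<otimes> (b \<otimes> a)) v"
      using mult_eq_cmt_mult[OF a b] act_mult[OF a b v] by simp
    also have "\<dots> = act (b \<otimes> a) v" using k a b v by (simp add: ker_def act_mult act_closed)
    finally show "act a (act b v) = act b (act a v)" using a b v by (simp add: act_mult)
  qed
next
  assume c: "\<forall>v\<in>V. act a (act b v) = act b (act a v)"
  have "act (cmt a b) v = v" if v: "v \<in> V" for v
    using c a b v by (simp add: cmt_def act_mult act_closed act_inv)
  then show "cmt a b \<in> ker" using a b by (simp add: ker_def)
qed

text \<open>The operator has finite order \<open>N\<close>, so a vector is the sum of its projections to the eigenspaces of
  the \<open>N\<close>-th roots of unity, and one of them is not zero.\<close>
lemma eigenvector_exists:
  assumes g: "g \<in> carrier G" and U: "vs.subspace U" "U \<subseteq> V" "U \<noteq> {0}"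
    and inv: "\<And>u. u \<in> U \<Longrightarrow> act g u \<in> U"
  obtains u c where "u \<in> U" "u \<noteq> 0" "act g u = c *s u"
proof -
  define N where "N = Coset.order G"
  have N: "N > 0" "g [^] N = \<one>" using finite_G order_gt_0_iff_finite pow_order_eq_1[OF g] by (auto simp: N_def)
  define \<zeta> where "\<zeta> = cis (2 * pi / N)"
  have zN: "\<zeta> ^ N = 1" using N by (simp add: \<zeta>_def DeMoivre)
  obtain w where w: "w \<in> U" "w \<noteq> 0" using U vs.subspace_0 by blast
  have pow: "act (g [^] j) w \<in> U" for j :: nat
  proof (induction j)
    case 0
    then show ?case using w U act_one by auto
  next
    case (Suc j)
    have "act (g [^] Suc j) w = act g (act (g [^] j) w)"
      using g w U by (subst nat_pow_Suc2) (auto simp: act_mult)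
    then show ?case using inv[OF Suc] by simp
  qed
  define t where "t k j = \<zeta> ^ (k * j) *s act (g [^] j) w" for k j :: nat
  define u where "u k = (\<Sum>j<N. t k j)" for k :: nat
  have tU: "t k j \<in> U" for k j unfolding t_def by (rule vs.subspace_scale[OF U(1) pow])
  have uU: "u k \<in> U" for k unfolding u_def by (rule vs.subspace_sum[OF U(1) tU])
  have eig: "act g (u k) = inverse (\<zeta> ^ k) *s u k" for k
  proof -
    have zk: "\<zeta> ^ k \<noteq> 0" using zN N(1) by (simp add: \<zeta>_def)
    have t1: "\<zeta> ^ k *s act g (t k j) = t k (Suc j)" for j
    proof -
      have "act g (t k j) = \<zeta> ^ (k * j) *s act g (act (g [^] j) w)"
        unfolding t_def using act_scale[OF g] pow U(2) by blast
      also have "act g (act (g [^] j) w) = act (g [^] Suc j) w"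
        using g w U by (subst nat_pow_Suc2) (auto simp: act_mult)
      finally show ?thesis by (simp add: t_def power_add)
    qed
    have "act g (u k) = (\<Sum>j<N. act g (t k j))"
      unfolding u_def using tU U(2) by (intro act_sum[OF g]) blast
    then have "\<zeta> ^ k *s act g (u k) = (\<Sum>j<N. t k (Suc j))"
      by (simp add: vs.scale_sum_right t1)
    also have "\<dots> = u k"
    proof -
      have "t k N = t k 0" using N(2) zN by (simp add: t_def power_mult mult.commute[of k])
      moreover have "(\<Sum>j<N. t k (Suc j)) + t k 0 = u k + t k N"
        unfolding u_def using sum.lessThan_Suc_shift[of "t k" N] sum.lessThan_Suc[of "t k" N] by (simp add: add.commute)
      ultimately show ?thesis by simp
    qed
    finally have "\<zeta> ^ k *s act g (u k) = u k" .
    then have "inverse (\<zeta> ^ k) *s u k = inverse (\<zeta> ^ k) *s \<zeta> ^ k *s act g (u k)" by simp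
    then show ?thesis using zk by simp
  qed
  have "(\<Sum>k<N. u k) = (\<Sum>j<N. (\<Sum>k<N. \<zeta> ^ (k * j)) *s act (g [^] j) w)"
    unfolding u_def t_def by (subst sum.swap) (simp add: vs.scale_sum_left)
  also have "\<dots> = (\<Sum>j<N. if j = 0 then of_nat N *s w else 0)"
  proof (rule sum.cong)
    fix j assume j: "j \<in> {..<N}"
    show "(\<Sum>k<N. \<zeta> ^ (k * j)) *s act (g [^] j) w = (if j = 0 then of_nat N *s w else 0)"
      using roots_of_unity_sum[of j N] j w U act_one by (auto simp: \<zeta>_def)
  qed simp
  also have "\<dots> = of_nat N *s w" using N(1) by simp
  finally have "(\<Sum>k<N. u k) \<noteq> 0" using N(1) w by simp
  then obtain k where "u k \<noteq> 0" by (metis sum.neutral)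
  then show thesis using that uU eig by blast
qed

text \<open>Each operator has an eigenvector in a common eigenspace of the previous ones, since it leaves that
  space invariant.\<close>
lemma common_eigenvector:
  assumes V: "V \<noteq> {0}" and B: "B \<subseteq> carrier G"
    and com: "\<And>a b v. a \<in> B \<Longrightarrow> b \<in> B \<Longrightarrow> v \<in> V \<Longrightarrow> act a (act b v) = act b (act a v)"
  obtains v where "v \<in> V" "v \<noteq> 0" "\<And>b. b \<in> B \<Longrightarrow> \<exists>c. act b v = c *s v"
proof -
  have "finite B" using B finite_G finite_subset by blast
  then have "\<exists>\<chi>. {v \<in> V. \<forall>b\<in>B. act b v = \<chi> b *s v} \<noteq> {0}"
    using B com
  proof (induction B)
    case empty
    then show ?case using V by simp
  next
    case (insert b F)
    then obtain \<chi> where \<chi>: "{v \<in> V. \<forall>b\<in>F. act b v = \<chi> b *s v} \<noteq> {0}" by auto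
    let ?E = "{v \<in> V. \<forall>b\<in>F. act b v = \<chi> b *s v}"
    have bc: "b \<in> carrier G" and Fc: "F \<subseteq> carrier G" using insert by auto
    have E: "vs.subspace ?E"
      using V_subspace Fc
      by (intro vs.subspaceI) (auto simp: act_zero act_add act_scale vs.scale_right_distrib vs.scale_left_commute
          intro: vs.subspace_0 vs.subspace_add vs.subspace_scale)
    have "act b v \<in> ?E" if v: "v \<in> ?E" for v
    proof -
      have "act a (act b v) = \<chi> a *s act b v" if a: "a \<in> F" for a
      proof -
        have "act a (act b v) = act b (act a v)" using insert.prems(2)[of a b v] a v by simp
        then show ?thesis using a v bc by (simp add: act_scale)
      qed
      then show ?thesis using v act_closed[OF bc] by simp
    qed
    from eigenvector_exists[OF bc E _ \<chi> this]
    obtain u c where u: "u \<in> ?E" "u \<noteq> 0" "act b u = c *s u" by auto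
    then have "u \<in> {v \<in> V. \<forall>a\<in>insert b F. act a v = (\<chi>(b := c)) a *s v}"
      using insert.hyps by auto
    then show ?case using u(2) by blast
  qed
  then obtain \<chi> where \<chi>: "{v \<in> V. \<forall>b\<in>B. act b v = \<chi> b *s v} \<noteq> {0}" by blast
  moreover have "0 \<in> {v \<in> V. \<forall>b\<in>B. act b v = \<chi> b *s v}"
    using vs.subspace_0[OF V_subspace] B act_zero by auto
  ultimately obtain v where "v \<in> V" "v \<noteq> 0" "\<And>b. b \<in> B \<Longrightarrow> act b v = \<chi> b *s v" by blast
  then show thesis using that by blast
qed

text \<open>If \<open>v\<close> is a common eigenvector of \<open>B\<close>, the space is spanned by the images of \<open>v\<close> under coset
  representatives of \<open>B\<close>.\<close>
theorem dim_le_index: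
  assumes irr: irreducible and B: "subgroup B G" and ab: "B \<subseteq> centr ker B"
  shows "vs.dim V * card B \<le> card (carrier G)"
proof -
  have Bc: "B \<subseteq> carrier G" by (rule subgroup.subset[OF B])
  have "act a (act b v) = act b (act a v)" if "a \<in> B" "b \<in> B" "v \<in> V" for a b v
    using cmt_mem_ker_iff[of a b] that ab Bc by (auto simp: centr_def)
  then obtain v where v: "v \<in> V" "v \<noteq> 0" "\<And>b. b \<in> B \<Longrightarrow> \<exists>c. act b v = c *s v"
    using common_eigenvector[OF _ Bc] irr unfolding irreducible_def by metis
  let ?O = "(\<lambda>g. act g v) ` carrier G"
  let ?W = "vs.span ?O"
  have OV: "?O \<subseteq> V" using v act_closed by auto
  have WV: "?W \<subseteq> V" by (rule vs.span_minimal[OF OV V_subspace])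
  have "act g w \<in> ?W" if g: "g \<in> carrier G" and w: "w \<in> ?W" for g w
  proof (rule act_span[OF g OV _ w])
    fix x assume "x \<in> ?O"
    then obtain h where h: "h \<in> carrier G" "x = act h v" by blast
    have "act g x = act (g \<otimes> h) v" using g h v by (simp add: act_mult)
    then show "act g x \<in> ?W" using g h by (intro vs.span_base) auto
  qed
  then have "invariant ?W" using WV by (simp add: invariant_def)
  moreover have "v \<in> ?W" using act_one[OF v(1)] by (metis image_eqI one_closed vs.span_base)
  ultimately have W: "?W = V" using irreducibleD[OF irr] v by blast
  define r where "r C = (SOME g. g \<in> C)" for C :: "'a set"
  have r: "r C \<in> C" if C: "C \<in> rcosets B" for C
  proof -
    obtain g where "g \<in> carrier G" "C = B #> g" using C by (auto simp: RCOSETS_def)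
    then have "C \<noteq> {}" using rcos_self[OF _ B] by blast
    then show ?thesis unfolding r_def by (simp add: some_in_eq)
  qed
  let ?R = "(\<lambda>C. act (inv (r C)) v) ` (rcosets B)"
  have fin: "finite (rcosets B)" using cosets_finite finite_G rcosets_part_G[OF B] by (metis finite_UnionD)
  have "?O \<subseteq> vs.span ?R"
  proof
    fix w assume "w \<in> ?O"
    then obtain g where g: "g \<in> carrier G" "w = act g v" by blast
    define C where "C = B #> inv g"
    have C: "C \<in> rcosets B" using g Bc by (auto simp: C_def RCOSETS_def)
    obtain b where b: "b \<in> B" "r C = b \<otimes> inv g" using r[OF C] by (auto simp: C_def r_coset_def)
    have bc: "b \<in> carrier G" using b Bc by blast
    obtain c where c: "act (inv b) v = c *s v" using v(3) subgroup.m_inv_closed[OF B b(1)] by blast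
    obtain d where d: "act b v = d *s v" using v(3)[OF b(1)] by blast
    have rc: "r C \<in> carrier G" using b bc g by simp
    have "g = inv (r C) \<otimes> b" using g b bc by (simp add: word_simps)
    then have "w = act (inv (r C) \<otimes> b) v" using g by simp
    then have "w = act (inv (r C)) (act b v)" using act_mult[OF inv_closed[OF rc] bc v(1)] by simp
    also have "\<dots> = d *s act (inv (r C)) v" using d v b bc g by (simp add: act_scale)
    finally show "w \<in> vs.span ?R"
      using vs.span_scale[OF vs.span_base, of "act (inv (r C)) v" ?R d] C by blast
  qed
  then have "V \<subseteq> vs.span ?R" using W vs.span_minimal[OF _ vs.subspace_span] by blast
  then have "vs.dim V \<le> card ?R" using fin by (intro vs.dim_le_card) auto
  also have "\<dots> \<le> card (rcosets B)" using fin by (rule card_image_le)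
  finally have "vs.dim V * card B \<le> card (rcosets B) * card B" by simp
  then show ?thesis using lagrange[OF B] by (simp add: Coset.order_def)
qed

lemma schur:
  assumes irr: irreducible and z: "z \<in> carrier G" and cen: "\<And>g. g \<in> carrier G \<Longrightarrow> cmt z g \<in> ker"
  obtains c where "\<And>v. v \<in> V \<Longrightarrow> act z v = c *s v"
proof -
  have "V \<noteq> {0}" using irr by (simp add: irreducible_def)
  from eigenvector_exists[OF z V_subspace subset_refl this act_closed[OF z]]
  obtain u c where u: "u \<in> V" "u \<noteq> 0" "act z u = c *s u" by blast
  let ?W = "{v \<in> V. act z v = c *s v}"
  have com: "act z (act g v) = act g (act z v)" if "g \<in> carrier G" "v \<in> V" for g v
    using cmt_mem_ker_iff[OF z that(1)] cen[OF that(1)] that by blast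
  have "vs.subspace ?W"
    using V_subspace z
    by (intro vs.subspaceI) (auto simp: act_zero act_add act_scale vs.scale_right_distrib vs.scale_left_commute
        intro: vs.subspace_0 vs.subspace_add vs.subspace_scale)
  then have "invariant ?W" by (auto simp: invariant_def com act_closed act_scale)
  then have "?W = V" using irreducibleD[OF irr] u by blast
  then show thesis using that by blast
qed

lemma finite_card_independent:
  assumes "S \<subseteq> V" "vs.independent S"
  shows "finite S" "card S \<le> vs.dim V"
proof -
  obtain B where B: "B \<subseteq> V" "vs.independent B" "V \<subseteq> vs.span B" "card B = vs.dim V"
    using vs.basis_exists by blast
  obtain F where F: "finite F" "V \<subseteq> vs.span F" using V_finite by blast
  have "finite B" using vs.independent_span_bound[OF F(1) B(2)] B(1) F(2) by blast
  from vs.independent_span_bound[OF this assms(2)] show "finite S" "card S \<le> vs.dim V"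
    using assms(1) B by auto
qed

text \<open>An eigenvector for \<open>\<xi>\<close> is not in the span of eigenvectors for other values: applying \<open>a - \<beta>\<close> removes one
  of them at a time.\<close>
lemma eigenvectors_other_span:
  assumes a: "a \<in> carrier G" and fin: "finite S" and SV: "S \<subseteq> V"
    and S: "\<And>b. b \<in> S \<Longrightarrow> \<exists>\<beta>. \<beta> \<noteq> \<xi> \<and> act a b = \<beta> *s b"
    and y: "y \<in> vs.span S" "act a y = \<xi> *s y"
  shows "y = 0"
  using fin SV S y
proof (induction S arbitrary: y)
  case empty
  then show ?case by simp
next
  case (insert b S)
  obtain \<beta> where \<beta>: "\<beta> \<noteq> \<xi>" "act a b = \<beta> *s b" using insert.prems(2) by blast
  obtain k where k: "y - k *s b \<in> vs.span S" using insert.prems(3) vs.span_breakdown_eq by blast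
  have bV: "b \<in> V" and SV: "S \<subseteq> V" using insert.prems by auto
  have yV: "y \<in> V" using insert.prems vs.span_minimal[OF _ V_subspace] by blast
  have stab: "act a z \<in> vs.span S" if "z \<in> vs.span S" for z
  proof (rule act_span[OF a SV _ that])
    fix x assume x: "x \<in> S"
    then obtain \<gamma> where g: "act a x = \<gamma> *s x" using insert.prems(2) by blast
    then show "act a x \<in> vs.span S" using x by (simp add: vs.span_scale vs.span_base)
  qed
  have "act a (y - k *s b) = \<xi> *s y - k *s \<beta> *s b"
    using a yV bV insert.prems(4) \<beta> vs.subspace_scale[OF V_subspace] by (simp add: act_diff act_scale)
  then have "\<xi> *s y - k *s \<beta> *s b - \<beta> *s (y - k *s b) \<in> vs.span S"
    using stab[OF k] vs.span_diff vs.span_scale[OF k] by metis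
  also have "\<xi> *s y - k *s \<beta> *s b - \<beta> *s (y - k *s b) = (\<xi> - \<beta>) *s y"
    by (simp add: vs.scale_right_diff_distrib vs.scale_left_diff_distrib mult.commute)
  finally have "inverse (\<xi> - \<beta>) *s (\<xi> - \<beta>) *s y \<in> vs.span S" by (rule vs.span_scale)
  then have "y \<in> vs.span S" using \<beta> by simp
  then show ?case using insert by auto
qed

lemma independent_eigenvectors:
  assumes a: "a \<in> carrier G" and R: "R \<subseteq> V" "vs.independent R" "\<And>b. b \<in> R \<Longrightarrow> act a b = \<xi> *s b"
    and J: "finite J" "w ` J \<subseteq> V" "\<And>i. i \<in> J \<Longrightarrow> w i \<noteq> 0" "\<And>i. i \<in> J \<Longrightarrow> act a (w i) = \<alpha> i *s w i"
      "inj_on \<alpha> J" "\<xi> \<notin> \<alpha> ` J"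
  shows "card R + card J \<le> vs.dim V"
proof -
  have finR: "finite R" by (rule finite_card_independent(1)[OF R(1,2)])
  have "vs.independent (R \<union> w ` J) \<and> card (R \<union> w ` J) = card R + card J"
    using J
  proof (induction J)
    case empty
    then show ?case using R by simp
  next
    case (insert i J)
    let ?S = "R \<union> w ` J"
    have ih: "vs.independent ?S" "card ?S = card R + card J" using insert by auto
    have "w i \<notin> vs.span ?S"
    proof
      assume sp: "w i \<in> vs.span ?S"
      have "w i = 0"
      proof (rule eigenvectors_other_span[OF a _ _ _ sp])
        show "finite ?S" using finR insert by simp
        show "?S \<subseteq> V" using R insert by auto
        show "act a (w i) = \<alpha> i *s w i" using insert by simp
        fix b assume "b \<in> ?S"
        then show "\<exists>\<beta>. \<beta> \<noteq> \<alpha> i \<and> act a b = \<beta> *s b"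
        proof
          assume "b \<in> R"
          then show ?thesis using R(3) insert.prems(5) by (intro exI[of _ \<xi>]) auto
        next
          assume "b \<in> w ` J"
          then obtain j where "j \<in> J" "b = w j" by blast
          then show ?thesis using insert.prems(3,4) insert.hyps(2) by (intro exI[of _ "\<alpha> j"]) (auto simp: inj_on_def)
        qed
      qed
      then show False using insert.prems(2) by blast
    qed
    then have "vs.independent (insert (w i) ?S)" "w i \<notin> ?S"
      using vs.independent_insertI[OF _ ih(1)] vs.span_superset[of ?S] by auto
    moreover have "R \<union> w ` insert i J = insert (w i) ?S" by auto
    moreover have "finite ?S" using finR insert.hyps by blast
    moreover have "card (insert (w i) ?S) = Suc (card ?S)"
      using \<open>finite ?S\<close> \<open>w i \<notin> ?S\<close> by (rule card_insert_disjoint)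
    moreover have "card (insert i J) = Suc (card J)"
      using insert.hyps by (rule card_insert_disjoint)
    ultimately show ?case using ih(2) by presburger
  qed
  moreover have "R \<union> w ` J \<subseteq> V" using R J by auto
  ultimately show ?thesis using finite_card_independent(2) by metis
qed

end

section \<open>Irreducible representations of degree at most p\<close>

context p_group
begin

text \<open>Choose \<open>a\<close> noncentral, but with all commutators \<open>[a, g]\<close> central, modulo the kernel. By Schur's lemma
  \<open>[a, g]\<close> acts as a scalar \<open>\<mu>(g)\<close>, and \<open>\<mu>\<close> is a homomorphism with kernel \<open>T\<close>. An element \<open>g\<close> maps the
  eigenspace of \<open>a\<close> for \<open>\<alpha>\<close> to the one for \<open>\<alpha> \<mu>(g)\<close>, so there are \<open>|G : T| \<ge> p\<close> nonzero eigenspaces. In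
  dimension at most \<open>p\<close> they are lines and their number is \<open>p\<close>. The normal subgroup \<open>T\<close> fixes these
  lines, so it acts by commuting operators.\<close>
lemma commuting_maximal_of_small_degree:
  assumes act: "linear_action G scale V act"
    and irr: "linear_action.irreducible G scale V act"
    and dim: "vector_space.dim scale V \<le> p"
    and nab: "\<not> gam2 \<subseteq> linear_action.ker G V act"
  shows "\<exists>T. subgroup T G \<and> gam2 \<subseteq> T \<and> p * card T = card (carrier G) \<and>
           T \<subseteq> centr (linear_action.ker G V act) T"
proof -
  interpret linear_action G scale V act by fact
  have kn: "ker \<lhd> G" by (rule ker_normal)
  let ?C = "centr ker (carrier G)"
  have Cn: "?C \<lhd> G" by (rule centr_carrier_normal[OF kn])
  have "?C \<subset> carrier G" using gam2_centr_iff[OF kn] nab by (auto simp: centr_def)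
  from central_mod_exists[OF Cn carrier_normal this]
  obtain a where a: "a \<in> carrier G" "a \<notin> ?C" "a \<in> centr ?C (carrier G)" by blast
  have "\<exists>c. \<forall>v\<in>V. act (cmt a g) v = scale c v" if g: "g \<in> carrier G" for g
  proof -
    have c: "cmt a g \<in> ?C" using a g by (auto simp: centr_def[of ?C])
    show ?thesis
      by (rule schur[OF irr, of "cmt a g"]) (use a g c in \<open>auto simp: centr_def\<close>)
  qed
  then obtain \<mu> where \<mu>: "\<And>g v. g \<in> carrier G \<Longrightarrow> v \<in> V \<Longrightarrow> act (cmt a g) v = scale (\<mu> g) v" by metis
  have V0: "V \<noteq> {0}" using irr by (simp add: irreducible_def)
  obtain v \<alpha> where v: "v \<in> V" "v \<noteq> 0" "act a v = scale \<alpha> v"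
    using eigenvector_exists[OF a(1) V_subspace subset_refl V0 act_closed[OF a(1)]] by blast
  have \<alpha>0: "\<alpha> \<noteq> 0" using act_nonzero[OF a(1) v(1,2)] v(3) by auto
  have shift: "act a (act g w) = scale (\<alpha> * \<mu> g) (act g w)"
    if g: "g \<in> carrier G" and w: "w \<in> V" "act a w = scale \<alpha> w" for g w
  proof -
    have "act a (act g w) = act (cmt a g) (act g (act a w))"
    proof -
      have "act (a \<otimes> g) w = act (cmt a g \<otimes> (g \<otimes> a)) w" using mult_eq_cmt_mult[OF a(1) g] by simp
      then show ?thesis using a g w by (simp add: act_mult act_closed)
    qed
    also have "\<dots> = scale (\<alpha> * \<mu> g) (act g w)"
      using g w by (simp add: act_scale act_closed \<mu> vs.subspace_scale[OF V_subspace] mult.commute)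
    finally show ?thesis .
  qed
  have \<mu>_mult: "\<mu> (g \<otimes> h) = \<mu> g * \<mu> h" if g: "g \<in> carrier G" and h: "h \<in> carrier G" for g h
  proof -
    have "scale (\<mu> (g \<otimes> h)) v = act (cmt a g \<otimes> (g \<otimes> cmt a h \<otimes> inv g)) v"
      using \<mu>[of "g \<otimes> h" v] cmt_mult_right[OF a(1) g h] g h v by simp
    also have "\<dots> = act (cmt a g) (act g (act (cmt a h) (act (inv g) v)))"
      using a g h v by (simp add: act_mult act_closed)
    also have "\<dots> = scale (\<mu> g * \<mu> h) v"
      using g h v by (simp add: \<mu> act_closed act_scale act_inv vs.subspace_scale[OF V_subspace])
    finally show ?thesis using v by simp
  qed
  have \<mu>_one: "\<mu> \<one> = 1"
  proof -
    have "scale (\<mu> \<one>) v = v" using \<mu>[of \<one> v] a v act_one by simp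
    then have "scale (\<mu> \<one>) v = scale 1 v" by simp
    then show ?thesis using v(2) vs.scale_right_imp_eq by blast
  qed
  have \<mu>_ne: "\<mu> g \<noteq> 0" if "g \<in> carrier G" for g
    using \<mu>_mult[OF that inv_closed[OF that]] \<mu>_one that by auto
  define T where "T = {g \<in> carrier G. \<mu> g = 1}"
  have T: "subgroup T G"
  proof (rule finite_closed_subgroup[OF finite_carrier])
    show "T \<noteq> {}" using \<mu>_one by (auto simp: T_def)
  qed (auto simp: T_def \<mu>_mult)
  have "cmt g h \<in> T" if g: "g \<in> carrier G" and h: "h \<in> carrier G" for g h
  proof -
    have "\<mu> g * \<mu> h = \<mu> (cmt g h) * (\<mu> h * \<mu> g)"
      using g h \<mu>_mult mult_eq_cmt_mult[OF g h] by (metis cmt_closed m_closed)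
    then have "\<mu> (cmt g h) = 1" using \<mu>_ne g h by simp
    then show ?thesis using g h by (simp add: T_def)
  qed
  then have gT: "gam2 \<subseteq> T" unfolding gam2_def by (intro bracket_least[OF T])
  have "T \<noteq> carrier G"
  proof
    assume "T = carrier G"
    have "cmt a g \<in> ker" if g: "g \<in> carrier G" for g
    proof -
      have "\<mu> g = 1" using g \<open>T = carrier G\<close> unfolding T_def by blast
      then show ?thesis using g a(1) \<mu>[OF g] by (simp add: ker_def)
    qed
    then show False using a by (simp add: centr_def)
  qed
  then have "T \<subset> carrier G" using subgroup.subset[OF T] by blast
  from proper_subgroup_card[OF T subgroup_self this]
  have pT: "p * card T dvd card (carrier G)" .
  let ?q = "card (rcosets T)"
  have lag: "?q * card T = card (carrier G)" using lagrange[OF T] by (simp add: Coset.order_def)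
  have T0: "card T > 0" by (rule card_subgroup_pos[OF T])
  have pq: "p \<le> ?q"
  proof -
    have "card (carrier G) > 0" using finite_carrier card_gt_0_iff by blast
    then have "p * card T \<le> ?q * card T" using pT lag dvd_imp_le by metis
    then show ?thesis using T0 by simp
  qed
  define r where "r C = (SOME g. g \<in> C)" for C :: "'a set"
  have r: "r C \<in> carrier G \<and> C = T #> r C" if C: "C \<in> rcosets T" for C
  proof -
    obtain g where g: "g \<in> carrier G" "C = T #> g" using C by (auto simp: RCOSETS_def)
    then have "C \<noteq> {}" using rcos_self[OF _ T] by blast
    then have rC: "r C \<in> C" unfolding r_def by (simp add: some_in_eq)
    then have "r C \<in> carrier G"
      using g r_coset_subset_G[OF subgroup.subset[OF T]] by blast
    moreover have "C = T #> r C" using rC g repr_independence[OF _ g(1) T] by simp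
    ultimately show ?thesis ..
  qed
  have \<mu>_inj: "C = D" if CD: "C \<in> rcosets T" "D \<in> rcosets T" and eq: "\<mu> (r C) = \<mu> (r D)" for C D
  proof -
    have rc: "r C \<in> carrier G" "r D \<in> carrier G" using r CD by auto
    have "\<mu> (r C \<otimes> inv (r D)) * \<mu> (r D) = \<mu> (r C)"
      using rc \<mu>_mult[of "r C \<otimes> inv (r D)" "r D"] by (simp add: m_assoc)
    then have "r C \<otimes> inv (r D) \<in> T" using eq \<mu>_ne rc by (simp add: T_def)
    then have "r C \<in> T #> r D" using rc by (auto simp: r_coset_def m_assoc intro!: bexI[of _ "r C \<otimes> inv (r D)"])
    then have "T #> r D = T #> r C" using repr_independence[OF _ rc(2) T] by blast
    then show ?thesis using r CD by metis
  qed
  have TR: "T \<in> rcosets T" by (rule subgroup.subgroup_in_rcosets[OF T is_group])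
  have \<mu>T: "\<mu> (r T) = 1"
  proof -
    have "r T \<in> T" using r[OF TR] rcos_self[OF _ T, of "r T"] by auto
    then show ?thesis by (simp add: T_def)
  qed
  define J where "J = rcosets T - {T}"
  define w where "w C = act (r C) v" for C
  have finR: "finite (rcosets T)"
    using lag finite_carrier T0 by (metis card.infinite card_gt_0_iff empty_iff mult_0 neq0_conv one_closed)
  have J: "finite J" "card J = ?q - 1" using finR TR by (auto simp: J_def)
  have bound: "card R + (?q - 1) \<le> vs.dim V"
    if R: "R \<subseteq> V" "vs.independent R" "\<And>b. b \<in> R \<Longrightarrow> act a b = scale \<alpha> b" for R
    unfolding J(2)[symmetric]
  proof (rule independent_eigenvectors[OF a(1) R J(1)])
    show "w ` J \<subseteq> V" using r v act_closed by (auto simp: w_def J_def)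
    show "w i \<noteq> 0" if "i \<in> J" for i using that r v act_nonzero by (auto simp: w_def J_def)
    show "act a (w i) = scale (\<alpha> * \<mu> (r i)) (w i)" if "i \<in> J" for i
      using that r v shift by (auto simp: w_def J_def)
    show "inj_on (\<lambda>i. \<alpha> * \<mu> (r i)) J"
      using \<mu>_inj \<alpha>0 by (auto simp: inj_on_def J_def)
    show "\<alpha> \<notin> (\<lambda>i. \<alpha> * \<mu> (r i)) ` J"
    proof
      assume "\<alpha> \<in> (\<lambda>i. \<alpha> * \<mu> (r i)) ` J"
      then obtain C where C: "C \<in> J" "\<alpha> = \<alpha> * \<mu> (r C)" by blast
      then have "\<mu> (r C) = \<mu> (r T)" using \<alpha>0 \<mu>T by simp
      then show False using \<mu>_inj[of C T] C TR by (auto simp: J_def)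
    qed
  qed
  have "card {v} + (?q - 1) \<le> vs.dim V" by (rule bound) (use v in auto)
  then have q: "?q = p" using pq dim p_gt_1 by simp
  have line: "u \<in> vs.span {v}" if u: "u \<in> V" "act a u = scale \<alpha> u" for u
  proof (rule ccontr)
    assume nu: "u \<notin> vs.span {v}"
    have "vs.independent {v}" using v(2) by simp
    then have "vs.independent {u, v}" by (rule vs.independent_insertI[OF nu])
    then have "card {u, v} + (?q - 1) \<le> vs.dim V" by (intro bound) (use u v in auto)
    moreover have "u \<noteq> v" using nu vs.span_base by blast
    ultimately show False using q dim p_gt_1 by simp
  qed
  have Tv: "\<exists>c. act t v = scale c v" if t: "t \<in> T" for t
  proof -
    have "t \<in> carrier G" "\<mu> t = 1" using t by (auto simp: T_def)
    then have "act t v \<in> vs.span {v}" using v shift[of t v] by (intro line) (auto simp: act_closed)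
    then show ?thesis by (auto simp: vs.span_singleton)
  qed
  have Tn: "T \<lhd> G" by (rule subgroup_above_gam2_normal[OF T gT])
  have Tc: "t \<in> carrier G" if "t \<in> T" for t using that by (simp add: T_def)
  let ?W = "{u \<in> V. \<forall>s\<in>T. \<forall>t\<in>T. act s (act t u) = act t (act s u)}"
  have "vs.subspace ?W"
    using V_subspace
    by (intro vs.subspaceI)
      (auto simp: act_zero act_add act_scale act_closed Tc
        intro: vs.subspace_0 vs.subspace_add vs.subspace_scale)
  moreover have "act g u \<in> ?W" if g: "g \<in> carrier G" and u: "u \<in> ?W" for g u
  proof -
    have "act s (act t (act g u)) = act g (act (inv g \<otimes> s \<otimes> g) (act (inv g \<otimes> t \<otimes> g) u))"
      if "s \<in> T" "t \<in> T" for s t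
      using that g u by (simp add: act_mult act_closed act_inv Tc)
    moreover have "inv g \<otimes> t \<otimes> g \<in> T" if "t \<in> T" for t
      using conj_in_normal(2)[OF Tn that g] .
    ultimately show ?thesis using g u by (simp add: act_closed)
  qed
  ultimately have "invariant ?W" by (auto simp: invariant_def)
  moreover have "v \<in> ?W"
  proof -
    have "act s (act t v) = act t (act s v)" if st: "s \<in> T" "t \<in> T" for s t
    proof -
      obtain c d where "act s v = scale c v" "act t v = scale d v" using Tv st by blast
      then show ?thesis using st v by (simp add: act_scale Tc mult.commute)
    qed
    then show ?thesis using v by simp
  qed
  ultimately have W: "?W = V" using irreducibleD[OF irr] v by blast
  have "T \<subseteq> centr ker T"
  proof
    fix s assume s: "s \<in> T"
    have "cmt s t \<in> ker" if t: "t \<in> T" for t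
      using cmt_mem_ker_iff[OF Tc[OF s] Tc[OF t]] W s t by blast
    then show "s \<in> centr ker T" using Tc[OF s] by (simp add: centr_def)
  qed
  moreover have "p * card T = card (carrier G)" using lag q by simp
  ultimately show ?thesis using T gT by blast
qed

end

section \<open>Matrix representations and linear actions\<close>

definition fun_scale :: "complex \<Rightarrow> ('i \<Rightarrow> complex) \<Rightarrow> 'i \<Rightarrow> complex" where
  "fun_scale c v = (\<lambda>i. c * v i)"

lemma fun_scale_apply [simp]: "fun_scale c v i = c * v i"
  by (simp add: fun_scale_def)

interpretation fun_vs: vector_space fun_scale
  by unfold_locales (auto simp: fun_eq_iff algebra_simps)

lemma vec_subspace_iff:
  "VectorSpace.subspace class_ring W (module_vec TYPE(complex) n) \<longleftrightarrow>
    W \<subseteq> carrier_vec n \<and> 0\<^sub>v n \<in> W \<and> (\<forall>v\<in>W. \<forall>w\<in>W. v + w \<in> W) \<and> (\<forall>c. \<forall>v\<in>W. c \<cdot>\<^sub>v v \<in> W)"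
  unfolding VectorSpace.subspace_def submodule_def
  using vec_vs vec_module by (auto simp: module_vec_simps)

text \<open>A vector of dimension \<open>n\<close> as a function on all natural numbers that vanishes from \<open>n\<close> on. In this form
  the vectors live in one complex vector space for all \<open>n\<close>.\<close>
definition coord_space :: "nat \<Rightarrow> (nat \<Rightarrow> complex) set" where
  "coord_space n = {v. \<forall>i\<ge>n. v i = 0}"

definition mat_action :: "nat \<Rightarrow> ('a \<Rightarrow> complex mat) \<Rightarrow> 'a \<Rightarrow> (nat \<Rightarrow> complex) \<Rightarrow> nat \<Rightarrow> complex" where
  "mat_action n \<rho> g v = (\<lambda>i. if i < n then \<Sum>j<n. \<rho> g $$ (i, j) * v j else 0)"

definition delta :: "'i \<Rightarrow> 'i \<Rightarrow> complex" where
  "delta i = (\<lambda>j. if j = i then 1 else 0)"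

lemma sum_fun_apply: "(\<Sum>i\<in>I. f i) x = (\<Sum>i\<in>I. f i x)" for f :: "'j \<Rightarrow> 'i \<Rightarrow> complex"
  by (induction I rule: infinite_finite_induct) auto

lemma finite_support_in_span:
  assumes "finite S" "\<And>x. x \<notin> S \<Longrightarrow> f x = 0"
  shows "f \<in> fun_vs.span (delta ` S)"
proof -
  have "f = (\<Sum>i\<in>S. fun_scale (f i) (delta i))"
    using assms by (auto simp: fun_eq_iff sum_fun_apply delta_def if_distrib cong: if_cong)
  also have "\<dots> \<in> fun_vs.span (delta ` S)"
    by (intro fun_vs.span_sum fun_vs.span_scale fun_vs.span_base) auto
  finally show ?thesis .
qed

lemma coord_space_subspace: "fun_vs.subspace (coord_space n)"
  by (intro fun_vs.subspaceI) (auto simp: coord_space_def)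

lemma coord_space_span: "coord_space n \<subseteq> fun_vs.span (delta ` {..<n})"
proof
  fix v assume "v \<in> coord_space n"
  then show "v \<in> fun_vs.span (delta ` {..<n})"
    by (intro finite_support_in_span) (simp_all add: coord_space_def)
qed

lemma dim_coord_space: "fun_vs.dim (coord_space n) = n"
proof -
  have "fun_vs.independent (delta ` {..<n})"
  proof (rule fun_vs.independent_if_scalars_zero)
    fix f :: "(nat \<Rightarrow> complex) \<Rightarrow> complex" and x
    assume s: "(\<Sum>x\<in>delta ` {..<n}. fun_scale (f x) x) = 0" and x: "x \<in> delta ` {..<n}"
    then obtain i where i: "i < n" "x = delta i" by auto
    have inj: "inj_on (delta :: nat \<Rightarrow> nat \<Rightarrow> complex) {..<n}"
      by (auto simp: inj_on_def delta_def fun_eq_iff)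
    have "0 = (\<Sum>x\<in>delta ` {..<n}. fun_scale (f x) x) i" using s by simp
    also have "\<dots> = (\<Sum>j<n. f (delta j) * delta j i)"
      unfolding sum_fun_apply by (subst sum.reindex[OF inj]) simp
    also have "\<dots> = f (delta i)" using i by (simp add: delta_def if_distrib cong: if_cong)
    finally show "f x = 0" using i by simp
  qed simp
  moreover note coord_space_span[of n]
  moreover have "delta ` {..<n} \<subseteq> coord_space n" by (auto simp: coord_space_def delta_def)
  ultimately have "fun_vs.dim (coord_space n) = card (delta ` {..<n} :: (nat \<Rightarrow> complex) set)"
    using fun_vs.basis_card_eq_dim by metis
  also have "\<dots> = n"
    by (subst card_image) (auto simp: inj_on_def delta_def fun_eq_iff)
  finally show ?thesis .
qed

lemma complex_representationD:
  assumes G: "group G" and \<rho>: "complex_representation G n \<rho>"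
  shows "\<And>g. g \<in> carrier G \<Longrightarrow> \<rho> g \<in> carrier_mat n n"
    and "\<And>g h. g \<in> carrier G \<Longrightarrow> h \<in> carrier G \<Longrightarrow> \<rho> (g \<otimes>\<^bsub>G\<^esub> h) = \<rho> g * \<rho> h"
    and "\<rho> \<one>\<^bsub>G\<^esub> = 1\<^sub>m n"
proof -
  interpret G: group G by fact
  interpret R: ring "ring_mat TYPE(complex) n ()" by (rule ring_mat)
  have hom: "\<rho> \<in> hom G (units_of (ring_mat TYPE(complex) n ()))"
    using \<rho> by (simp add: complex_representation_def)
  have "\<rho> g \<in> Units (ring_mat TYPE(complex) n ())" if "g \<in> carrier G" for g
    using hom_in_carrier[OF hom that] by (simp add: units_of_carrier)
  then show "\<And>g. g \<in> carrier G \<Longrightarrow> \<rho> g \<in> carrier_mat n n"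
    using R.Units_closed by (auto simp: ring_mat_simps)
  show "\<And>g h. g \<in> carrier G \<Longrightarrow> h \<in> carrier G \<Longrightarrow> \<rho> (g \<otimes>\<^bsub>G\<^esub> h) = \<rho> g * \<rho> h"
    using hom_mult[OF hom] by (simp add: units_of_mult ring_mat_simps)
  show "\<rho> \<one>\<^bsub>G\<^esub> = 1\<^sub>m n"
    using hom_one[OF hom G R.units_group] by (simp add: units_of_one ring_mat_simps)
qed

lemma mult_mat_vec_eq_mat_action:
  assumes "\<rho> g \<in> carrier_mat n n"
  shows "\<rho> g *\<^sub>v vec n v = vec n (mat_action n \<rho> g v)"
  using assms by (auto simp: mat_action_def scalar_prod_def lessThan_atLeast0 intro!: eq_vecI sum.cong)

lemma vec_coord_inj: "v \<in> coord_space n \<Longrightarrow> w \<in> coord_space n \<Longrightarrow> vec n v = vec n w \<Longrightarrow> v = w"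
proof
  fix i
  assume vw: "v \<in> coord_space n" "w \<in> coord_space n" "vec n v = vec n w"
  show "v i = w i"
  proof (cases "i < n")
    case True
    then show ?thesis using arg_cong[OF vw(3), of "\<lambda>u. u $ i"] by simp
  qed (use vw in \<open>auto simp: coord_space_def\<close>)
qed

lemma linear_action_mat:
  assumes G: "group G" and fin: "finite (carrier G)" and \<rho>: "complex_representation G n \<rho>"
  shows "linear_action G fun_scale (coord_space n) (mat_action n \<rho>)"
proof -
  interpret G: group G by fact
  note rep = complex_representationD[OF G \<rho>]
  have closed: "mat_action n \<rho> g v \<in> coord_space n" for g v by (auto simp: coord_space_def mat_action_def)
  show ?thesis
  proof unfold_locales
    show "finite (carrier G)" by fact
    show "fun_vs.subspace (coord_space n)" by (rule coord_space_subspace)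
    show "\<exists>B. finite B \<and> coord_space n \<subseteq> fun_vs.span B"
      using coord_space_span[of n] by blast
    show "mat_action n \<rho> g v \<in> coord_space n" for g v by (rule closed)
    fix v assume v: "v \<in> coord_space n"
    show "mat_action n \<rho> \<one>\<^bsub>G\<^esub> v = v"
      using v by (auto simp: fun_eq_iff mat_action_def rep(3) coord_space_def if_distrib if_distribR cong: if_cong)
    fix g h assume gh: "g \<in> carrier G" "h \<in> carrier G"
    have "vec n (mat_action n \<rho> (g \<otimes>\<^bsub>G\<^esub> h) v) = vec n (mat_action n \<rho> g (mat_action n \<rho> h v))"
      using gh rep(1)[OF gh(1)] rep(1)[OF gh(2)] rep(1)[of "g \<otimes>\<^bsub>G\<^esub> h"] rep(2)[OF gh]
      by (simp flip: mult_mat_vec_eq_mat_action)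
    then show "mat_action n \<rho> (g \<otimes>\<^bsub>G\<^esub> h) v = mat_action n \<rho> g (mat_action n \<rho> h v)"
      using vec_coord_inj closed by blast
  qed (auto simp: closed mat_action_def fun_eq_iff sum.distrib sum_distrib_left algebra_simps)
qed

lemma ker_mat_action:
  assumes G: "group G" and fin: "finite (carrier G)" and \<rho>: "complex_representation G n \<rho>"
  shows "linear_action.ker G (coord_space n) (mat_action n \<rho>) = {g \<in> carrier G. \<rho> g = 1\<^sub>m n}"
proof -
  interpret linear_action G fun_scale "coord_space n" "mat_action n \<rho>"
    by (rule linear_action_mat[OF assms])
  note rep = complex_representationD[OF G \<rho>]
  have "(\<forall>v\<in>coord_space n. mat_action n \<rho> g v = v) \<longleftrightarrow> \<rho> g = 1\<^sub>m n" if g: "g \<in> carrier G" for g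
  proof
    assume a: "\<forall>v\<in>coord_space n. mat_action n \<rho> g v = v"
    show "\<rho> g = 1\<^sub>m n"
    proof (rule eq_matI)
      fix i j assume ij: "i < dim_row (1\<^sub>m n)" "j < dim_col (1\<^sub>m n)"
      have "delta j \<in> coord_space n" using ij by (auto simp: coord_space_def delta_def)
      then have "mat_action n \<rho> g (delta j) i = delta j i" using a by simp
      then show "\<rho> g $$ (i, j) = 1\<^sub>m n $$ (i, j)"
        using ij by (auto simp: mat_action_def delta_def if_distrib cong: if_cong)
    qed (use rep(1)[OF g] in auto)
  next
    assume one: "\<rho> g = 1\<^sub>m n"
    show "\<forall>v\<in>coord_space n. mat_action n \<rho> g v = v"
    proof
      fix v assume v: "v \<in> coord_space n"
      have "\<rho> g = \<rho> \<one>\<^bsub>G\<^esub>" using one rep(3) by metis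
      then have "mat_action n \<rho> g v = mat_action n \<rho> \<one>\<^bsub>G\<^esub> v" by (simp only: mat_action_def)
      then show "mat_action n \<rho> g v = v" using act_one[OF v] by simp
    qed
  qed
  then show ?thesis by (auto simp: ker_def)
qed

lemma irreducible_action_mat:
  assumes G: "group G" and fin: "finite (carrier G)" and irr: "irreducible_representation G n \<rho>"
  shows "linear_action.irreducible G fun_scale (coord_space n) (mat_action n \<rho>)"
proof -
  have \<rho>: "complex_representation G n \<rho>" and n: "n > 0"
    using irr by (auto simp: irreducible_representation_def)
  interpret linear_action G fun_scale "coord_space n" "mat_action n \<rho>"
    by (rule linear_action_mat[OF G fin \<rho>])
  note rep = complex_representationD[OF G \<rho>]
  have "W = {0} \<or> W = coord_space n" if W: "invariant W" for W
  proof -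
    have Ws: "fun_vs.subspace W" "W \<subseteq> coord_space n" using W by (auto simp: invariant_def)
    let ?W = "vec n ` W"
    have "VectorSpace.subspace class_ring ?W (module_vec TYPE(complex) n)"
      unfolding vec_subspace_iff
    proof (intro conjI ballI allI)
      show "?W \<subseteq> carrier_vec n" by auto
      have "0\<^sub>v n = vec n 0" by auto
      then show "0\<^sub>v n \<in> ?W" using fun_vs.subspace_0[OF Ws(1)] by blast
    next
      fix v w assume "v \<in> ?W" "w \<in> ?W"
      then obtain v' w' where "v' \<in> W" "w' \<in> W" "v = vec n v'" "w = vec n w'" by blast
      moreover have "vec n v' + vec n w' = vec n (v' + w')" by auto
      ultimately show "v + w \<in> ?W" using fun_vs.subspace_add[OF Ws(1)] by auto
    next
      fix c :: complex and v assume "v \<in> ?W"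
      then obtain v' where "v' \<in> W" "v = vec n v'" by blast
      moreover have "c \<cdot>\<^sub>v vec n v' = vec n (fun_scale c v')" by auto
      ultimately show "c \<cdot>\<^sub>v v \<in> ?W" using fun_vs.subspace_scale[OF Ws(1)] by auto
    qed
    moreover have "\<forall>g\<in>carrier G. \<forall>w\<in>?W. \<rho> g *\<^sub>v w \<in> ?W"
      using W rep(1) by (auto simp: mult_mat_vec_eq_mat_action invariant_def)
    ultimately have "?W = {0\<^sub>v n} \<or> ?W = carrier_vec n"
      using irr by (simp add: irreducible_representation_def)
    then show ?thesis
    proof
      assume z: "?W = {0\<^sub>v n}"
      have "w = 0" if "w \<in> W" for w
      proof -
        have "vec n w = 0\<^sub>v n" using z that by blast
        also have "0\<^sub>v n = vec n 0" by auto
        finally have "vec n w = vec n 0" .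
        then show ?thesis using that Ws(2) coord_space_subspace fun_vs.subspace_0 by (intro vec_coord_inj) blast+
      qed
      then show ?thesis using fun_vs.subspace_0[OF Ws(1)] by blast
    next
      assume f: "?W = carrier_vec n"
      have "v \<in> W" if v: "v \<in> coord_space n" for v
      proof -
        have "vec n v \<in> ?W" using f by simp
        then obtain w where "w \<in> W" "vec n w = vec n v" by auto
        then show ?thesis using vec_coord_inj v Ws(2) by blast
      qed
      then show ?thesis using Ws(2) by blast
    qed
  qed
  moreover have "coord_space n \<noteq> {0}"
  proof -
    have "delta 0 \<in> coord_space n" using n by (auto simp: coord_space_def delta_def)
    moreover have "delta 0 \<noteq> (0 :: nat \<Rightarrow> complex)" by (auto simp: delta_def fun_eq_iff intro: exI[of _ 0])
    ultimately show ?thesis by blast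
  qed
  ultimately show ?thesis by (auto simp: irreducible_def)
qed

context linear_action
begin

text \<open>Pass to coordinates: \<open>lin\<close> is the isomorphism from coordinates to \<open>V\<close> given by a basis, and it carries
  the matrices to the action.\<close>
lemma matrix_of_irreducible:
  assumes irr: irreducible
  shows "\<exists>n \<rho>. irreducible_representation G n \<rho> \<and> {g \<in> carrier G. \<rho> g = 1\<^sub>m n} = ker"
proof -
  obtain B where B: "B \<subseteq> V" "vs.independent B" "V \<subseteq> vs.span B" "card B = vs.dim V"
    using vs.basis_exists by blast
  have finB: "finite B" by (rule finite_card_independent(1)[OF B(1,2)])
  define n where "n = card B"
  obtain b where b: "bij_betw b {..<n} B"
    using ex_bij_betw_nat_finite[OF finB] by (auto simp: n_def lessThan_atLeast0)
  have bB: "b i \<in> B" if "i < n" for i using b that by (auto simp: bij_betw_def)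
  have bV: "b i \<in> V" if "i < n" for i using bB[OF that] B by blast
  define lin where "lin x = (\<Sum>i<n. scale (x i) (b i))" for x :: "nat \<Rightarrow> complex"
  have lin_inj: "x i = y i" if eq: "lin x = lin y" and i: "i < n" for x y i
  proof -
    let ?u = "\<lambda>v. x (inv_into {..<n} b v) - y (inv_into {..<n} b v)"
    have 1: "(\<Sum>i<n. scale (x i - y i) (b i)) = 0"
      using eq by (simp add: lin_def vs.scale_left_diff_distrib sum_subtractf)
    have "(\<Sum>v\<in>B. scale (?u v) v) = (\<Sum>i<n. scale (?u (b i)) (b i))"
      by (rule sum.reindex_bij_betw[OF b, symmetric])
    also have "\<dots> = (\<Sum>i<n. scale (x i - y i) (b i))"
      using b by (intro sum.cong) (auto simp: bij_betw_def inv_into_f_f)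
    finally have "(\<Sum>v\<in>B. scale (?u v) v) = 0" using 1 by simp
    from vs.independentD[OF B(2) finB subset_refl this bB[OF i]]
    have "x (inv_into {..<n} b (b i)) - y (inv_into {..<n} b (b i)) = 0" .
    then show ?thesis using b i by (simp add: bij_betw_def inv_into_f_f)
  qed
  have lin_surj: "\<exists>x. v = lin x" if v: "v \<in> V" for v
  proof -
    have "v \<in> vs.span B" using v B by blast
    then obtain u where "v = (\<Sum>w\<in>B. scale (u w) w)" using vs.span_finite[OF finB] by auto
    also have "\<dots> = lin (\<lambda>i. u (b i))" unfolding lin_def by (rule sum.reindex_bij_betw[OF b, symmetric])
    finally show ?thesis by blast
  qed
  have linV: "lin x \<in> V" for x
    unfolding lin_def using bV by (intro vs.subspace_sum[OF V_subspace] vs.subspace_scale[OF V_subspace]) auto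
  have "\<forall>g j. \<exists>x. g \<in> carrier G \<longrightarrow> j < n \<longrightarrow> act g (b j) = lin x"
    using lin_surj act_closed bV by metis
  then obtain c where c: "\<And>g j. g \<in> carrier G \<Longrightarrow> j < n \<Longrightarrow> act g (b j) = lin (c g j)" by metis
  define \<rho> where "\<rho> g = mat n n (\<lambda>(i, j). c g j i)" for g
  have act_lin: "act g (lin x) = lin (\<lambda>i. \<Sum>j<n. c g j i * x j)" if g: "g \<in> carrier G" for g x
  proof -
    have "act g (lin x) = (\<Sum>j<n. scale (x j) (act g (b j)))"
      unfolding lin_def using bV vs.subspace_scale[OF V_subspace] g by (subst act_sum) (auto simp: act_scale)
    also have "\<dots> = (\<Sum>j<n. \<Sum>i<n. scale (c g j i * x j) (b i))"
      by (intro sum.cong) (auto simp: c[OF g] lin_def vs.scale_sum_right mult.commute)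
    also have "\<dots> = lin (\<lambda>i. \<Sum>j<n. c g j i * x j)"
      unfolding lin_def by (subst sum.swap) (simp add: vs.scale_sum_left)
    finally show ?thesis .
  qed
  have dims: "\<rho> g \<in> carrier_mat n n" for g by (simp add: \<rho>_def)
  have act_vec: "act g (lin (\<lambda>i. v $ i)) = lin (\<lambda>i. (\<rho> g *\<^sub>v v) $ i)"
    if g: "g \<in> carrier G" and v: "v \<in> carrier_vec n" for g v
    unfolding act_lin[OF g] unfolding lin_def
    using v by (intro sum.cong) (auto simp: \<rho>_def scalar_prod_def lessThan_atLeast0)
  have lin_vec_inj: "v = w" if "v \<in> carrier_vec n" "w \<in> carrier_vec n" "lin (\<lambda>i. v $ i) = lin (\<lambda>i. w $ i)" for v w
    using lin_inj[OF that(3)] that(1,2) by (intro eq_vecI) auto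
  have mat_eq: "A = C" if "A \<in> carrier_mat n n" "C \<in> carrier_mat n n" "\<And>v. v \<in> carrier_vec n \<Longrightarrow> A *\<^sub>v v = C *\<^sub>v v"
    for A C :: "complex mat"
  proof (rule eq_matI)
    fix i j assume ij: "i < dim_row C" "j < dim_col C"
    have "A *\<^sub>v unit_vec n j = C *\<^sub>v unit_vec n j" by (rule that(3)) simp
    then have "(A *\<^sub>v unit_vec n j) $ i = (C *\<^sub>v unit_vec n j) $ i" by simp
    then show "A $$ (i, j) = C $$ (i, j)" using that(1,2) ij by (simp add: scalar_prod_right_unit)
  qed (use that in auto)
  have one: "\<rho> \<one> = 1\<^sub>m n"
  proof (rule mat_eq[OF dims])
    fix v :: "complex vec" assume v: "v \<in> carrier_vec n"
    have "\<rho> \<one> *\<^sub>v v = v"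
      using act_vec[OF one_closed v] act_one[OF linV] v dims
      by (intro lin_vec_inj) (auto intro: mult_mat_vec_carrier)
    then show "\<rho> \<one> *\<^sub>v v = 1\<^sub>m n *\<^sub>v v" using v by simp
  qed simp
  have mult: "\<rho> (g \<otimes> h) = \<rho> g * \<rho> h" if g: "g \<in> carrier G" and h: "h \<in> carrier G" for g h
  proof (rule mat_eq[OF dims])
    show "\<rho> g * \<rho> h \<in> carrier_mat n n" by (rule mult_carrier_mat[OF dims dims])
    fix v :: "complex vec" assume v: "v \<in> carrier_vec n"
    have hv: "\<rho> h *\<^sub>v v \<in> carrier_vec n" "\<rho> g *\<^sub>v (\<rho> h *\<^sub>v v) \<in> carrier_vec n" "\<rho> (g \<otimes> h) *\<^sub>v v \<in> carrier_vec n"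
      using dims v by (auto intro: mult_mat_vec_carrier)
    have "lin (\<lambda>i. (\<rho> (g \<otimes> h) *\<^sub>v v) $ i) = act g (act h (lin (\<lambda>i. v $ i)))"
      using act_vec[OF m_closed[OF g h] v] act_mult[OF g h linV] by simp
    also have "\<dots> = lin (\<lambda>i. (\<rho> g *\<^sub>v (\<rho> h *\<^sub>v v)) $ i)"
      using act_vec[OF h v] act_vec[OF g hv(1)] by simp
    finally have "\<rho> (g \<otimes> h) *\<^sub>v v = \<rho> g *\<^sub>v (\<rho> h *\<^sub>v v)" using lin_vec_inj hv by blast
    then show "\<rho> (g \<otimes> h) *\<^sub>v v = \<rho> g * \<rho> h *\<^sub>v v"
      using assoc_mult_mat_vec[OF dims dims v, of g h] by simp
  qed
  have units: "\<rho> g \<in> Units (ring_mat TYPE(complex) n ())" if g: "g \<in> carrier G" for g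
  proof -
    have "\<rho> (inv g) * \<rho> g = 1\<^sub>m n" "\<rho> g * \<rho> (inv g) = 1\<^sub>m n"
      using mult[of "inv g" g] mult[of g "inv g"] g one by auto
    then show ?thesis using dims by (auto simp: Units_def ring_mat_simps)
  qed
  have rep: "complex_representation G n \<rho>"
    unfolding complex_representation_def
    by (intro homI) (auto simp: units_of_carrier units_of_mult ring_mat_simps units mult)
  have n0: "n > 0"
  proof (rule ccontr)
    assume "\<not> n > 0"
    then have "B = {}" using finB by (simp add: n_def)
    then have "V \<subseteq> {0}" using B by simp
    then show False using irr vs.subspace_0[OF V_subspace] by (auto simp: irreducible_def)
  qed
  have lin_0: "lin (\<lambda>i. 0\<^sub>v n $ i) = 0" by (simp add: lin_def)
  have lin_add: "lin (\<lambda>i. (v + w) $ i) = lin (\<lambda>i. v $ i) + lin (\<lambda>i. w $ i)"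
    if "v \<in> carrier_vec n" "w \<in> carrier_vec n" for v w
    using that by (simp add: lin_def vs.scale_left_distrib sum.distrib)
  have lin_scale: "lin (\<lambda>i. (d \<cdot>\<^sub>v v) $ i) = scale d (lin (\<lambda>i. v $ i))" if "v \<in> carrier_vec n" for v d
    using that by (simp add: lin_def vs.scale_sum_right)
  have "W = {0\<^sub>v n} \<or> W = carrier_vec n"
    if W: "VectorSpace.subspace class_ring W (module_vec TYPE(complex) n)"
      and inv: "\<forall>g\<in>carrier G. \<forall>w\<in>W. \<rho> g *\<^sub>v w \<in> W" for W
  proof -
    note Ws = W[unfolded vec_subspace_iff]
    have Wc: "w \<in> carrier_vec n" if "w \<in> W" for w using Ws that by blast
    let ?W = "(\<lambda>v. lin (\<lambda>i. v $ i)) ` W"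
    have "vs.subspace ?W"
    proof (rule vs.subspaceI)
      show "0 \<in> ?W" using lin_0 Ws by (metis image_eqI)
    next
      fix x y assume "x \<in> ?W" "y \<in> ?W"
      then obtain v w where "v \<in> W" "w \<in> W" "x = lin (\<lambda>i. v $ i)" "y = lin (\<lambda>i. w $ i)" by blast
      then have "v + w \<in> W" "x + y = lin (\<lambda>i. (v + w) $ i)" using Ws lin_add Wc by auto
      then show "x + y \<in> ?W" by blast
    next
      fix d x assume "x \<in> ?W"
      then obtain v where "v \<in> W" "x = lin (\<lambda>i. v $ i)" by blast
      then have "d \<cdot>\<^sub>v v \<in> W" "scale d x = lin (\<lambda>i. (d \<cdot>\<^sub>v v) $ i)" using Ws lin_scale Wc by auto
      then show "scale d x \<in> ?W" by blast
    qed
    moreover have "act g x \<in> ?W" if g: "g \<in> carrier G" and x: "x \<in> ?W" for g x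
    proof -
      obtain v where v: "v \<in> W" "x = lin (\<lambda>i. v $ i)" using x by blast
      then have "act g x = lin (\<lambda>i. (\<rho> g *\<^sub>v v) $ i)" using act_vec[OF g Wc] by simp
      then show ?thesis using inv g v by blast
    qed
    ultimately have "invariant ?W" using linV by (auto simp: invariant_def)
    then consider "?W = {0}" | "?W = V" using irr by (auto simp: irreducible_def)
    then show ?thesis
    proof cases
      case 1
      have "w = 0\<^sub>v n" if w: "w \<in> W" for w
      proof -
        have "lin (\<lambda>i. w $ i) = 0" using 1 w by blast
        then show ?thesis using lin_vec_inj[OF Wc[OF w], of "0\<^sub>v n"] lin_0 by simp
      qed
      then show ?thesis using Ws by blast
    next
      case 2
      have "v \<in> W" if v: "v \<in> carrier_vec n" for v
      proof -
        have "lin (\<lambda>i. v $ i) \<in> ?W" using 2 linV by simp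
        then obtain w where w: "w \<in> W" "lin (\<lambda>i. v $ i) = lin (\<lambda>i. w $ i)" by blast
        then show ?thesis using lin_vec_inj[OF v Wc] by simp
      qed
      then show ?thesis using Ws by blast
    qed
  qed
  then have "irreducible_representation G n \<rho>"
    using rep n0 by (simp add: irreducible_representation_def)
  moreover have "\<rho> g = 1\<^sub>m n \<longleftrightarrow> (\<forall>v\<in>V. act g v = v)" if g: "g \<in> carrier G" for g
  proof
    assume r: "\<rho> g = 1\<^sub>m n"
    show "\<forall>v\<in>V. act g v = v"
    proof
      fix v assume "v \<in> V"
      then obtain x where x: "v = lin x" using lin_surj by blast
      have xv: "lin x = lin (\<lambda>i. vec n x $ i)" by (simp add: lin_def)
      show "act g v = v" unfolding x xv using act_vec[OF g, of "vec n x"] r by simp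
    qed
  next
    assume a: "\<forall>v\<in>V. act g v = v"
    show "\<rho> g = 1\<^sub>m n"
    proof (rule mat_eq[OF dims])
      fix v :: "complex vec" assume v: "v \<in> carrier_vec n"
      have "\<rho> g *\<^sub>v v = v" using act_vec[OF g v] a linV dims v by (intro lin_vec_inj) (auto intro: mult_mat_vec_carrier)
      then show "\<rho> g *\<^sub>v v = 1\<^sub>m n *\<^sub>v v" using v by simp
    qed simp
  qed
  then have "{g \<in> carrier G. \<rho> g = 1\<^sub>m n} = ker" by (auto simp: ker_def)
  ultimately show ?thesis by blast
qed

text \<open>An invariant subspace of least positive dimension.\<close>
lemma irreducible_invariant_exists:
  assumes V: "V \<noteq> {0}"
  obtains W where "W \<subseteq> V" "linear_action G scale W act" "linear_action.irreducible G scale W act"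
proof -
  let ?P = "\<lambda>W. invariant W \<and> W \<noteq> {0}"
  have "?P V" using V V_subspace act_closed by (auto simp: invariant_def)
  from ex_has_least_nat[of ?P V vs.dim, OF this]
  obtain W where W: "invariant W" "W \<noteq> {0}" and min: "\<And>U. invariant U \<Longrightarrow> U \<noteq> {0} \<Longrightarrow> vs.dim W \<le> vs.dim U"
    by blast
  have Ws: "vs.subspace W" "W \<subseteq> V" "\<And>g w. g \<in> carrier G \<Longrightarrow> w \<in> W \<Longrightarrow> act g w \<in> W"
    using W by (auto simp: invariant_def)
  have la: "linear_action G scale W act"
  proof unfold_locales
    show "finite (carrier G)" by (rule finite_G)
    show "\<exists>B. finite B \<and> W \<subseteq> vs.span B" using V_finite Ws(2) by blast
    show "vs.subspace W" by (rule Ws(1))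
    show "act g v \<in> W" if "g \<in> carrier G" "v \<in> W" for g v using Ws(3) that .
    show "act g (v + w) = act g v + act g w" if "g \<in> carrier G" "v \<in> W" "w \<in> W" for g v w
      using act_add that Ws(2) by auto
    show "act g (scale c v) = scale c (act g v)" if "g \<in> carrier G" "v \<in> W" for g c v
      using act_scale that Ws(2) by auto
    show "act \<one> v = v" if "v \<in> W" for v using act_one that Ws(2) by auto
    show "act (g \<otimes> h) v = act g (act h v)" if "g \<in> carrier G" "h \<in> carrier G" "v \<in> W" for g h v
      using act_mult that Ws(2) by auto
  qed
  interpret W: linear_action G scale W act by fact
  have "U = {0} \<or> U = W" if U: "W.invariant U" for U
  proof (rule disjCI)
    assume "U \<noteq> W"
    have Us: "vs.subspace U" "U \<subseteq> W" and Ui: "invariant U"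
      using U Ws by (auto simp: W.invariant_def invariant_def)
    then obtain w where w: "w \<in> W" "w \<notin> U" using \<open>U \<noteq> W\<close> by blast
    obtain B where B: "B \<subseteq> U" "vs.independent B" "U \<subseteq> vs.span B" "card B = vs.dim U"
      using vs.basis_exists by blast
    have "vs.span B \<subseteq> U" by (rule vs.span_minimal[OF B(1) Us(1)])
    then have nw: "w \<notin> vs.span B" using w by blast
    have "vs.independent (insert w B)" by (rule vs.independent_insertI[OF nw B(2)])
    then have "card (insert w B) \<le> vs.dim W" using W.finite_card_independent(2)[of "insert w B"] B Us w by blast
    moreover have "finite B" using W.finite_card_independent(1)[of B] B Us by blast
    moreover have "w \<notin> B" using nw vs.span_base by blast
    ultimately have "vs.dim U < vs.dim W" using B(4) by simp
    then show "U = {0}" using min[OF Ui] by force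
  qed
  then have "W.irreducible" using W by (auto simp: W.irreducible_def)
  then show thesis using that Ws la by blast
qed

end

context group
begin

text \<open>Let \<open>H\<close> be the normal closure of \<open>N\<close> and \<open>h\<close>, and let \<open>G\<close> act by translation on the functions on \<open>G\<close>
  that are constant on the cosets of \<open>N\<close> and have sum zero on the cosets of \<open>H\<close>. Then \<open>N\<close> acts trivially.
  On an irreducible invariant subspace \<open>h\<close> does not: otherwise \<open>H\<close> would, and functions constant on the
  cosets of \<open>H\<close> with sum zero on them vanish.\<close>
theorem separating_irreducible_representation:
  assumes fin: "finite (carrier G)" and N: "N \<lhd> G" and h: "h \<in> carrier G" "h \<notin> N"
  shows "\<exists>n \<rho>. irreducible_representation G n \<rho> \<and>
    N \<subseteq> {g \<in> carrier G. \<rho> g = 1\<^sub>m n} \<and> \<rho> h \<noteq> 1\<^sub>m n"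
proof -
  have Ns: "subgroup N G" using N by (rule normal_imp_subgroup)
  have Nc: "N \<subseteq> carrier G" using Ns by (rule subgroup.subset)
  let ?S = "N \<union> {g \<otimes> h \<otimes> inv g | g. g \<in> carrier G}"
  define H where "H = generate G ?S"
  have H: "H \<lhd> G"
    unfolding H_def
  proof (rule normal_generateI)
    show "?S \<subseteq> carrier G" using Nc h by auto
    fix s g assume s: "s \<in> ?S" and g: "g \<in> carrier G"
    show "g \<otimes> s \<otimes> inv g \<in> ?S"
      using s
    proof
      assume "s \<in> N"
      then show ?thesis using conj_in_normal(1)[OF N _ g] by blast
    next
      assume "s \<in> {g \<otimes> h \<otimes> inv g | g. g \<in> carrier G}"
      then obtain k where k: "k \<in> carrier G" "s = k \<otimes> h \<otimes> inv k" by blast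
      then have "g \<otimes> s \<otimes> inv g = (g \<otimes> k) \<otimes> h \<otimes> inv (g \<otimes> k)" using g h by (simp add: word_simps)
      then show ?thesis using g k by blast
    qed
  qed
  have Hs: "subgroup H G" using H by (rule normal_imp_subgroup)
  have Hc: "H \<subseteq> carrier G" using Hs by (rule subgroup.subset)
  have NH: "N \<subseteq> H" unfolding H_def by (auto intro: generate.incl)
  have finH: "finite H" using Hc fin finite_subset by blast
  have hH: "h \<in> H"
  proof -
    have "h = \<one> \<otimes> h \<otimes> inv \<one>" using h by simp
    then show ?thesis unfolding H_def by (intro generate.incl) blast
  qed
  define V where "V = {F :: 'a \<Rightarrow> complex. (\<forall>x. x \<notin> carrier G \<longrightarrow> F x = 0) \<and>
    (\<forall>x\<in>carrier G. \<forall>t\<in>N. F (x \<otimes> t) = F x) \<and> (\<forall>x\<in>carrier G. (\<Sum>t\<in>H. F (x \<otimes> t)) = 0)}"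
  define act where "act g F = (\<lambda>x. if x \<in> carrier G then F (inv g \<otimes> x) else 0)" for g and F :: "'a \<Rightarrow> complex"
  have la: "linear_action G fun_scale V act"
  proof unfold_locales
    show "finite (carrier G)" by fact
    show "fun_vs.subspace V"
      using Nc Hc by (intro fun_vs.subspaceI) (auto simp: V_def sum.distrib sum_distrib_left[symmetric])
    show "\<exists>B. finite B \<and> V \<subseteq> fun_vs.span B"
      using fin by (intro exI[of _ "delta ` carrier G"]) (auto simp: V_def intro!: finite_support_in_span)
    fix g F assume g: "g \<in> carrier G" and F: "F \<in> V"
    show "act g F \<in> V"
      using F g Nc Hc by (auto simp: V_def act_def m_assoc[symmetric] subset_iff)
  next
    fix F assume "F \<in> V"
    then show "act \<one> F = F" by (auto simp: V_def act_def fun_eq_iff)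
  qed (auto simp: act_def fun_eq_iff inv_mult_group m_assoc)
  interpret linear_action G fun_scale V act by fact
  \<comment> \<open>The difference of the indicator functions of \<open>N\<close> and \<open>h N\<close>; both cosets lie in \<open>H\<close>.\<close>
  have "V \<noteq> {0}"
  proof -
    define F where "F x = (if x \<in> N then 1 else 0) - (if inv h \<otimes> x \<in> N \<and> x \<in> carrier G then 1 else (0 :: complex))" for x
    have NxN: "x \<otimes> t \<in> N \<longleftrightarrow> x \<in> N" if "x \<in> carrier G" "t \<in> N" for x t
    proof
      assume "x \<otimes> t \<in> N"
      then have "x \<otimes> t \<otimes> inv t \<in> N" using that subgroup.m_closed[OF Ns] subgroup.m_inv_closed[OF Ns] by blast
      then show "x \<in> N" using that Nc by (simp add: m_assoc subset_iff)
    qed (use that subgroup.m_closed[OF Ns] in blast)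
    have count: "(\<Sum>t\<in>H. if y \<otimes> t \<in> N then 1 else (0::complex)) = (if y \<in> H then of_nat (card N) else 0)"
      if y: "y \<in> carrier G" for y
    proof (cases "y \<in> H")
      case True
      have "{t \<in> H. y \<otimes> t \<in> N} = (\<lambda>t. inv y \<otimes> t) ` N"
      proof safe
        fix t assume t: "t \<in> H" "y \<otimes> t \<in> N"
        then have "t = inv y \<otimes> (y \<otimes> t)" using y Hc by (simp add: l_inv_cancel subset_iff)
        then show "t \<in> (\<lambda>t. inv y \<otimes> t) ` N" using t by blast
      next
        fix t assume t: "t \<in> N"
        then show "inv y \<otimes> t \<in> H" using True NH subgroup.m_closed[OF Hs] subgroup.m_inv_closed[OF Hs] by blast
        show "y \<otimes> (inv y \<otimes> t) \<in> N" using t y Nc by (simp add: r_inv_cancel subset_iff)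
      qed
      moreover have "inj_on (\<lambda>t. inv y \<otimes> t) N" using y Nc by (auto simp: inj_on_def subset_iff)
      ultimately have "card {t \<in> H. y \<otimes> t \<in> N} = card N" by (simp add: card_image)
      then show ?thesis using True finH by (simp flip: sum.inter_filter)
    next
      case False
      have "y \<otimes> t \<notin> N" if t: "t \<in> H" for t
      proof
        assume "y \<otimes> t \<in> N"
        then have "y \<otimes> t \<otimes> inv t \<in> H" using NH t subgroup.m_closed[OF Hs] subgroup.m_inv_closed[OF Hs] by blast
        then show False using False t y Hc by (simp add: m_assoc subset_iff)
      qed
      then show ?thesis using False by simp
    qed
    have "F \<in> V"
    proof -
      have "F x = 0" if "x \<notin> carrier G" for x using that Nc by (auto simp: F_def)
      moreover have "F (x \<otimes> t) = F x" if x: "x \<in> carrier G" and t: "t \<in> N" for x t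
      proof -
        have "inv h \<otimes> (x \<otimes> t) \<in> N \<longleftrightarrow> inv h \<otimes> x \<in> N"
          using NxN[of "inv h \<otimes> x" t] x t h Nc by (simp add: m_assoc subset_iff)
        then show ?thesis using NxN[OF x t] x t Nc by (auto simp: F_def)
      qed
      moreover have "(\<Sum>t\<in>H. F (x \<otimes> t)) = 0" if x: "x \<in> carrier G" for x
      proof -
        have "(\<Sum>t\<in>H. F (x \<otimes> t)) = (\<Sum>t\<in>H. if x \<otimes> t \<in> N then 1 else (0::complex))
           - (\<Sum>t\<in>H. if (inv h \<otimes> x) \<otimes> t \<in> N then 1 else (0::complex))"
          unfolding sum_subtractf[symmetric] F_def
          using x h Hc by (intro sum.cong) (auto simp: m_assoc subset_iff)
        also have "\<dots> = (if x \<in> H then of_nat (card N) else 0) - (if inv h \<otimes> x \<in> H then of_nat (card N) else 0)"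
          using count[OF x] count[of "inv h \<otimes> x"] x h by simp
        also have "inv h \<otimes> x \<in> H \<longleftrightarrow> x \<in> H"
        proof
          assume "inv h \<otimes> x \<in> H"
          then have "h \<otimes> (inv h \<otimes> x) \<in> H" using hH subgroup.m_closed[OF Hs] by blast
          then show "x \<in> H" using h x by (simp add: r_inv_cancel)
        qed (use hH subgroup.m_closed[OF Hs] subgroup.m_inv_closed[OF Hs] in blast)
        finally show ?thesis by simp
      qed
      ultimately show ?thesis by (auto simp: V_def)
    qed
    moreover have "F \<one> \<noteq> 0"
    proof -
      have "inv h \<notin> N" using h subgroup.m_inv_closed[OF Ns, of "inv h"] by auto
      then show ?thesis using subgroup.one_closed[OF Ns] h by (simp add: F_def)
    qed
    ultimately show ?thesis by auto
  qed
  from irreducible_invariant_exists[OF this]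
  obtain W where W: "W \<subseteq> V" "linear_action G fun_scale W act" "linear_action.irreducible G fun_scale W act" .
  interpret W: linear_action G fun_scale W act by (rule W(2))
  have "N \<subseteq> W.ker"
  proof
    fix n assume n: "n \<in> N"
    have nc: "n \<in> carrier G" using n Nc by blast
    have "act n F = F" if F: "F \<in> W" for F
    proof
      fix x
      show "act n F x = F x"
      proof (cases "x \<in> carrier G")
        case True
        have "inv n \<otimes> x = x \<otimes> (inv x \<otimes> inv n \<otimes> x)" using True nc by (simp add: word_simps)
        moreover have "inv x \<otimes> inv n \<otimes> x \<in> N"
          using conj_in_normal(2)[OF N subgroup.m_inv_closed[OF Ns n] True] .
        ultimately show ?thesis using True F W(1) by (auto simp: act_def V_def)
      qed (use F W(1) in \<open>auto simp: act_def V_def\<close>)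
    qed
    then show "n \<in> W.ker" using nc by (simp add: W.ker_def)
  qed
  moreover have "h \<notin> W.ker"
  proof
    assume hk: "h \<in> W.ker"
    have "g \<otimes> h \<otimes> inv g \<in> W.ker" if "g \<in> carrier G" for g
      using conj_in_normal(1)[OF W.ker_normal hk that] .
    then have HK: "H \<subseteq> W.ker"
      unfolding H_def using \<open>N \<subseteq> W.ker\<close> by (intro generate_subgroup_incl normal_imp_subgroup[OF W.ker_normal]) auto
    have "F = 0" if F: "F \<in> W" for F
    proof
      fix x
      show "F x = 0 x"
      proof (cases "x \<in> carrier G")
        case True
        have "F (x \<otimes> t) = F x" if t: "t \<in> H" for t
        proof -
          have tc: "t \<in> carrier G" using t Hc by blast
          have "x \<otimes> inv t \<otimes> inv x \<in> W.ker"
            using HK conj_in_normal(1)[OF H subgroup.m_inv_closed[OF Hs t] True] by blast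
          then have "act (x \<otimes> inv t \<otimes> inv x) F x = F x" using F by (simp add: W.ker_def)
          then show ?thesis using True tc by (simp add: act_def word_simps)
        qed
        then have "(\<Sum>t\<in>H. F (x \<otimes> t)) = of_nat (card H) * F x" by simp
        moreover have "(\<Sum>t\<in>H. F (x \<otimes> t)) = 0" using F W(1) True by (auto simp: V_def)
        moreover have "card H > 0" using finH hH card_gt_0_iff by blast
        ultimately show ?thesis by simp
      qed (use F W(1) in \<open>auto simp: V_def\<close>)
    qed
    then have "W \<subseteq> {0}" by blast
    then show False using W.irreducible_def W(3) fun_vs.subspace_0[OF W.V_subspace] by blast
  qed
  ultimately show ?thesis using W.matrix_of_irreducible[OF W(3)] h by blast
qed

end

section \<open>The bound on the degree\<close>

lemma irreducible_character_of_representation: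
  assumes "group G" and "irreducible_representation G n \<rho>"
  shows "character_of G \<rho> \<in> irreducible_characters G"
    and "character_degree G (character_of G \<rho>) = real n"
proof -
  show "character_of G \<rho> \<in> irreducible_characters G"
    using assms(2) unfolding irreducible_characters_def by blast
  show "character_degree G (character_of G \<rho>) = real n"
    using character_degree_character_of[OF assms(1)] assms(2) by (simp add: irreducible_representation_def)
qed

context p_group_abelianization_square
begin

definition mat_ker :: "nat \<Rightarrow> ('a \<Rightarrow> complex mat) \<Rightarrow> 'a set" where
  "mat_ker n \<rho> = {g \<in> carrier G. \<rho> g = 1\<^sub>m n}"

lemma degree_le_index:
  assumes \<rho>: "irreducible_representation G n \<rho>" and B: "subgroup B G" "B \<subseteq> centr (mat_ker n \<rho>) B"
  shows "n * card B \<le> card (carrier G)"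
proof -
  have rep: "complex_representation G n \<rho>" using \<rho> by (simp add: irreducible_representation_def)
  interpret linear_action G fun_scale "coord_space n" "mat_action n \<rho>"
    by (rule linear_action_mat[OF is_group finite_carrier rep])
  have ker: "ker = mat_ker n \<rho>" using ker_mat_action[OF is_group finite_carrier rep] by (simp add: mat_ker_def)
  show ?thesis
    using dim_le_index[OF irreducible_action_mat[OF is_group finite_carrier \<rho>] B(1)] B(2)
    unfolding ker dim_coord_space by simp
qed

lemma mat_ker_normal:
  assumes \<rho>: "irreducible_representation G n \<rho>"
  shows "mat_ker n \<rho> \<lhd> G"
proof -
  have rep: "complex_representation G n \<rho>" using \<rho> by (simp add: irreducible_representation_def)
  interpret linear_action G fun_scale "coord_space n" "mat_action n \<rho>"
    by (rule linear_action_mat[OF is_group finite_carrier rep])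
  show ?thesis using ker_normal ker_mat_action[OF is_group finite_carrier rep] by (simp add: mat_ker_def)
qed

lemma max_sub_abelian_mod_kernel:
  assumes \<sigma>: "irreducible_representation G n \<sigma>" and n: "n \<le> p"
  shows "\<exists>M. max_sub M \<and> M \<subseteq> centr (mat_ker n \<sigma>) M"
proof (cases "gam2 \<subseteq> mat_ker n \<sigma>")
  case True
  obtain M where M: "max_sub M" using max_sub_exists by blast
  have "gam3 \<subseteq> mat_ker n \<sigma>" using True gam_decreasing by blast
  then show ?thesis using max_sub_centr[OF M mat_ker_normal[OF \<sigma>]] M by blast
next
  case False
  have rep: "complex_representation G n \<sigma>" using \<sigma> by (simp add: irreducible_representation_def)
  note la = linear_action_mat[OF is_group finite_carrier rep]
  have ker: "linear_action.ker G (coord_space n) (mat_action n \<sigma>) = mat_ker n \<sigma>"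
    using ker_mat_action[OF is_group finite_carrier rep] by (simp add: mat_ker_def)
  from commuting_maximal_of_small_degree[OF la irreducible_action_mat[OF is_group finite_carrier \<sigma>]]
  show ?thesis using False n unfolding ker dim_coord_space max_sub_def by blast
qed

text \<open>The hypothesis \<open>max\<close> is the choice of \<open>\<rho>\<close> with maximal kernel; it gives every irreducible representation
  trivial on the larger subgroup \<open>Z\<close> degree at most \<open>p\<close>. The subgroup \<open>B\<close> with abelian image comes from the
  dichotomy \<open>abelian_mod_or_gam4\<close>.\<close>
theorem degree_bound:
  assumes \<rho>: "irreducible_representation G n \<rho>" and n: "n > p"
    and max: "\<And>k \<sigma>. irreducible_representation G k \<sigma> \<Longrightarrow> k > p \<Longrightarrow> \<not> mat_ker n \<rho> \<subset> mat_ker k \<sigma>"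
  shows "\<exists>k. p = 2 * k + 1 \<and> n \<le> p ^ Suc k"
proof -
  let ?K = "mat_ker n \<rho>"
  have rep: "complex_representation G n \<rho>" using \<rho> by (simp add: irreducible_representation_def)
  interpret act: linear_action G fun_scale "coord_space n" "mat_action n \<rho>"
    by (rule linear_action_mat[OF is_group finite_carrier rep])
  have irr: act.irreducible by (rule irreducible_action_mat[OF is_group finite_carrier \<rho>])
  have ker: "act.ker = ?K" using ker_mat_action[OF is_group finite_carrier rep] by (simp add: mat_ker_def)
  have K: "?K \<lhd> G" by (rule mat_ker_normal[OF \<rho>])
  have Ks: "subgroup ?K G" using K by (rule normal_imp_subgroup)
  have bound: "n * card B \<le> card (carrier G)" if "subgroup B G" "B \<subseteq> centr ?K B" for B
    by (rule degree_le_index[OF \<rho> that])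
  have "?K \<noteq> carrier G"
  proof
    assume "?K = carrier G"
    then have "carrier G \<subseteq> centr ?K (carrier G)" by (auto simp: centr_def)
    then have "n * card (carrier G) \<le> card (carrier G)" by (rule bound[OF subgroup_self])
    then have "n \<le> 1" using card_subgroup_pos[OF subgroup_self] by simp
    then show False using n p_gt_1 by simp
  qed
  then have "?K \<subset> carrier G" using subgroup.subset[OF Ks] by blast
  from central_mod_exists[OF K carrier_normal this]
  obtain a where a: "a \<in> carrier G" "a \<notin> ?K" "a \<in> centr ?K (carrier G)" "a [^] p \<in> ?K" by blast
  define Z where "Z = cyc_ext a ?K"
  have Z: "Z \<lhd> G" "Z \<subseteq> centr ?K (carrier G)" using cyc_ext_normal[OF K a(3)] by (simp_all add: Z_def)
  have Zs: "subgroup Z G" using Z(1) by (rule normal_imp_subgroup)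
  have KZ: "?K \<subseteq> Z" "a \<in> Z" using cyc_ext_incl[OF Ks a(1)] by (simp_all add: Z_def)
  have cases: "(\<exists>M. max_sub M \<and> M \<subseteq> centr Z M) \<or> gam4 \<subseteq> Z"
  proof -
    have "\<exists>K' M. K' \<lhd> G \<and> N \<subseteq> K' \<and> h \<notin> K' \<and> max_sub M \<and> M \<subseteq> centr K' M"
      if N: "N \<lhd> G" "Z \<subseteq> N" "h \<in> carrier G - N" for N h
    proof -
      obtain k \<sigma> where \<sigma>: "irreducible_representation G k \<sigma>" "N \<subseteq> mat_ker k \<sigma>" "h \<notin> mat_ker k \<sigma>"
        using separating_irreducible_representation[OF finite_carrier N(1), of h] N(3)
        unfolding mat_ker_def by blast
      have "?K \<subset> mat_ker k \<sigma>" using KZ N(2) \<sigma>(2) a(2) by blast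
      then have "k \<le> p" using max[OF \<sigma>(1)] by (meson not_le)
      then show ?thesis using max_sub_abelian_mod_kernel[OF \<sigma>(1)] mat_ker_normal[OF \<sigma>(1)] \<sigma> by blast
    qed
    then show ?thesis by (rule abelian_mod_or_gam4[OF Z(1)])
  qed
  have Zp: "z [^] p \<in> ?K" if "z \<in> Z" for z
    using cyc_ext_power_mem[OF K a(1,4)] that by (simp add: Z_def)
  have "\<exists>c. \<forall>v\<in>coord_space n. mat_action n \<rho> z v = fun_scale c v" if z: "z \<in> Z" for z
  proof -
    have "z \<in> carrier G" "\<And>g. g \<in> carrier G \<Longrightarrow> cmt z g \<in> act.ker" using z Z(2) ker by (auto simp: centr_def)
    then show ?thesis by (rule act.schur[OF irr]) auto
  qed
  then obtain \<chi> where \<chi>: "\<And>z v. z \<in> Z \<Longrightarrow> v \<in> coord_space n \<Longrightarrow> mat_action n \<rho> z v = fun_scale (\<chi> z) v" by metis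
  have "coord_space n \<noteq> {0}" using irr by (simp add: act.irreducible_def)
  then obtain v where v: "v \<in> coord_space n" "v \<noteq> 0" using fun_vs.subspace_0[OF coord_space_subspace] by blast
  have Zc: "z \<in> carrier G" if "z \<in> Z" for z using that Zs subgroup.mem_carrier by metis
  have \<chi>_mult: "\<chi> (z \<otimes> w) = \<chi> z * \<chi> w" if zw: "z \<in> Z" "w \<in> Z" for z w
  proof -
    have "fun_scale (\<chi> (z \<otimes> w)) v = mat_action n \<rho> z (mat_action n \<rho> w v)"
      using \<chi>[OF subgroup.m_closed[OF Zs zw] v(1)] act.act_mult[OF Zc[OF zw(1)] Zc[OF zw(2)] v(1)] by simp
    also have "\<dots> = fun_scale (\<chi> z * \<chi> w) v"
      using \<chi> zw v fun_vs.subspace_scale[OF coord_space_subspace] by simp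
    finally show ?thesis using v(2) fun_vs.scale_right_imp_eq by blast
  qed
  have \<chi>_ker: "\<chi> z = 1 \<longleftrightarrow> z \<in> ?K" if z: "z \<in> Z" for z
  proof
    assume "\<chi> z = 1"
    then show "z \<in> ?K" using \<chi>[OF z] Zc[OF z] unfolding ker[symmetric] act.ker_def by simp
  next
    assume "z \<in> ?K"
    then have "fun_scale (\<chi> z) v = fun_scale 1 v"
      using \<chi>[OF z v(1)] v(1) unfolding ker[symmetric] act.ker_def by simp
    then show "\<chi> z = 1" using v(2) fun_vs.scale_right_imp_eq by blast
  qed
  have \<chi>_pow: "\<chi> z ^ p = 1" if z: "z \<in> Z" for z
  proof -
    have zk: "z [^] k \<in> Z" for k :: nat using subgroup_int_pow_closed[OF Zs z, of "int k"] by (simp add: int_pow_int)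
    have "\<chi> (z [^] k) = \<chi> z ^ k" for k :: nat
    proof (induction k)
      case 0
      then show ?case using \<chi>_ker[OF subgroup.one_closed[OF Zs]] subgroup.one_closed[OF Ks] by simp
    next
      case (Suc k)
      then show ?case using \<chi>_mult[OF zk z] by simp
    qed
    then show ?thesis using \<chi>_ker[OF zk] Zp[OF z] by metis
  qed
  have \<chi>_ne: "\<chi> z \<noteq> 0" if "z \<in> Z" for z using \<chi>_pow[OF that] p_gt_1 by (auto simp: power_0_left)
  interpret central_character G p m Z ?K \<chi>
    by (intro central_character.intro p_group_abelianization_square_axioms
        central_character_axioms.intro Z K KZ(1) \<chi>_mult \<chi>_ne \<chi>_pow \<chi>_ker)
  have "odd p"
  proof
    assume "even p"
    then have p2: "p = 2" using prime_p primes_dvd_imp_eq two_is_prime_nat by blast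
    obtain M where M: "max_sub M" "M \<subseteq> centr {\<one>} M" using two_group_abelian_maximal[OF p2] by blast
    have "M \<subseteq> centr ?K M" using M(2) centr_mono[of "{\<one>}" ?K M M] subgroup.one_closed[OF Ks] by blast
    then have "n * card M \<le> p * card M" using bound[OF max_subD(1)[OF M(1)]] max_subD(3)[OF M(1)] by simp
    then show False using n card_subgroup_pos[OF max_subD(1)[OF M(1)]] by simp
  qed
  then obtain k where k: "p = 2 * k + 1" by (blast elim: oddE)
  have "\<exists>B. subgroup B G \<and> card (carrier G) \<le> p ^ Suc k * card B \<and> B \<subseteq> centr ?K B"
    using cases
  proof
    assume "\<exists>M. max_sub M \<and> M \<subseteq> centr Z M"
    then obtain M where M: "max_sub M" "M \<subseteq> centr Z M" by blast
    obtain s where s: "s \<in> M" "s \<notin> gam2" using max_sub_elem[OF M(1)] .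
    obtain x where x: "x \<in> carrier G" "x \<notin> M" using max_sub_outside[OF M(1)] .
    interpret abelian_mod_maximal G p m Z ?K \<chi> M x s k
      by unfold_locales (use M s x k in auto)
    show ?thesis by (rule large_abelian_subgroup)
  next
    assume "gam4 \<subseteq> Z"
    then have "gam2 \<subseteq> centr ?K gam2" by (rule gam2_abelian_mod)
    moreover have "card (carrier G) \<le> p ^ Suc k * card gam2"
    proof -
      have "2 \<le> Suc k" using k p_gt_1 by simp
      then have "p ^ 2 \<le> p ^ Suc k" using p_gt_1 by (intro power_increasing) auto
      then show ?thesis unfolding card_gam2 by simp
    qed
    ultimately show ?thesis using gam_subgroup(1) by blast
  qed
  then obtain B where B: "subgroup B G" "card (carrier G) \<le> p ^ Suc k * card B" "B \<subseteq> centr ?K B" by blast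
  have "n * card B \<le> p ^ Suc k * card B" using bound[OF B(1,3)] B(2) by linarith
  then have "n \<le> p ^ Suc k" using card_subgroup_pos[OF B(1)] by simp
  then show ?thesis using k by blast
qed

end

theorem theorem1:
  fixes G :: "('a, 'b) monoid_scheme" and p :: nat
  assumes "prime p"
    and "group G" and "finite (carrier G)" and "\<exists>m. Coset.order G = p ^ m"
    and "card (rcosets\<^bsub>G\<^esub> (derived G (carrier G))) = p ^ 2"
    and "\<exists>\<chi> \<in> irreducible_characters G. character_degree G \<chi> > real p"
  shows "\<exists>\<chi> \<in> irreducible_characters G.
           real p < character_degree G \<chi> \<and>
           character_degree G \<chi> \<le> real p powr ((real p + 1) / 2)"
proof -
  obtain m where m: "Coset.order G = p ^ m" using assms(4) by blast
  interpret group G by fact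
  interpret p_group G p m by unfold_locales (use assms m in auto)
  have g2: "derived G (carrier G) = gam2" by (simp add: derived_eq_bracket gam2_def)
  interpret p_group_abelianization_square G p m
    using lagrange[OF gam_subgroup(1)] assms(5)
    by unfold_locales (simp add: g2 Coset.order_def)
  let ?P = "\<lambda>(n, \<rho>). irreducible_representation G n \<rho> \<and> n > p"
  obtain n0 \<rho>0 where 0: "irreducible_representation G n0 \<rho>0"
    "character_degree G (character_of G \<rho>0) > real p"
    using assms(6) by (auto simp: irreducible_characters_def)
  then have "?P (n0, \<rho>0)"
    using irreducible_character_of_representation(2)[OF assms(2) 0(1)] by simp
  moreover have "card (case x of (n, \<rho>) \<Rightarrow> mat_ker n \<rho>) < Suc (card (carrier G))" for x
    using finite_carrier by (auto simp: mat_ker_def less_Suc_eq_le intro!: card_mono split: prod.split)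
  ultimately obtain x where x: "?P x" "\<And>y. ?P y \<Longrightarrow> card (case y of (n, \<rho>) \<Rightarrow> mat_ker n \<rho>) \<le> card (case x of (n, \<rho>) \<Rightarrow> mat_ker n \<rho>)"
    using ex_has_greatest_nat[of ?P "(n0, \<rho>0)" "\<lambda>(n, \<rho>). card (mat_ker n \<rho>)" "Suc (card (carrier G))"]
    by (auto simp: split_def)
  obtain n \<rho> where n\<rho>: "x = (n, \<rho>)" by (cases x)
  have \<rho>: "irreducible_representation G n \<rho>" "n > p" using x(1) n\<rho> by auto
  have "\<exists>k. p = 2 * k + 1 \<and> n \<le> p ^ Suc k"
  proof (rule degree_bound[OF \<rho>])
    fix k \<sigma> assume \<sigma>: "irreducible_representation G k \<sigma>" "k > p"
    have "card (mat_ker k \<sigma>) \<le> card (mat_ker n \<rho>)" using x(2)[of "(k, \<sigma>)"] \<sigma> n\<rho> by simp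
    moreover have "finite (mat_ker k \<sigma>)" using finite_carrier by (simp add: mat_ker_def)
    ultimately show "\<not> mat_ker n \<rho> \<subset> mat_ker k \<sigma>" using psubset_card_mono by (metis leD)
  qed
  then obtain k where k: "p = 2 * k + 1" "n \<le> p ^ Suc k" by blast
  have "real n \<le> real p ^ Suc k" using k(2) by (metis of_nat_le_iff of_nat_power)
  also have "\<dots> = real p powr real (Suc k)" using p_gt_1 by (intro powr_realpow[symmetric]) simp
  also have "real (Suc k) = (real p + 1) / 2" using k(1) by simp
  finally have "real n \<le> real p powr ((real p + 1) / 2)" .
  then show ?thesis
    using irreducible_character_of_representation[OF assms(2) \<rho>(1)] \<rho>(2) by (intro bexI[of _ "character_of G \<rho>"]) auto
qed

end
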